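(* Let $(d_0,\ldots,d_n)$ be positive integers with $\sum_{i=0}^n\frac1{d_i}=1$ and put $w_i=\mathrm{lcm}(d_0,\ldots,d_n)/d_i$, $w=\{w_i\}$. The family $\mathcal{F}(\Delta(w))$ of Calabi-Yau hypersurfaces in the weighted projective space $\mathbf{P}_{\Delta(w)}=\mathbf{P}(w_0,\ldots,w_n)$ consists of deformations of Fermat-type hypersurfaces $v_0^{d_0}+\cdots+v_n^{d_n}=0$. If $(\Delta,M)$ is a reflexive pair such that $\Delta$ is a reflexive simplex with weights $w=\{w_i\}$, then the corresponding family $\mathcal{F}(\Delta)$ in $\mathbf{P}_\Delta$ consists of quotients of some subfamily in $\mathcal{F}(\Delta(w))$ by the action of the finite abelian group $\pi_1(\Delta,M)$.
   Context: Let $M$ be a free abelian group of rank $n$, $N=\mathrm{Hom}(M,\mathbf{Z})$. $(\Delta,M)$ is reflexive if $\Delta\subset M_{\mathbf{Q}}$ is an $n$-dimensional convex polytope with vertices in $M$ and $0$ in its interior such that each affine hyperplane spanned by an $(n-1)$-dimensional face is $\{x:\langle x,l\rangle=c\}$ with $l\in N$ primitive and $|c|=1$. Its dual is $\Delta^*=\{y\in N_{\mathbf{Q}}:\langle x,y\rangle\ge-1\ \forall x\in\Delta\}$. If $\Delta$ is a simplex with vertices $p_0,\ldots,p_n$, its weights are the positive integers $w_0,\ldots,w_n$ with $\gcd(w_i)=1$ and $\sum w_ip_i=0$. $M(w)=\{x\in\mathbf{Z}^{n+1}:\sum w_ix_i=0\}$ and $\Delta(w)=\{x\in\mathbf{Q}^{n+1}:\sum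 w_ix_i=0,\ x_i\ge-1\ (0\le i\le n)\}$; $(\Delta(w),M(w))$ is a reflexive pair with $\mathbf{P}_{\Delta(w)}\cong\mathbf{P}(w_0,\ldots,w_n)$, in which hypersurfaces from $\mathcal{F}(\Delta(w))$ are given by weighted homogeneous polynomials in $v_0,\ldots,v_n$ of degree $\sum w_i=\mathrm{lcm}(d_i)$. For a reflexive polyhedron $\Delta$, $\mathcal{F}(\Delta)$ is the family of $\Delta$-regular hypersurfaces $\overline{Z}_f$ in the projective toric variety $\mathbf{P}_\Delta$ of the polytope $\Delta$: closures of $\{f=0\}\subset\mathbf{T}$, $f$ a Laurent polynomial with Newton polyhedron $\Delta$, such that the intersection with every torus orbit $\mathbf{T}_\Theta$ ($\Theta$ a face of $\Delta$) is empty or smooth of codimension $1$ in $\mathbf{T}_\Theta$. "Deformations of Fermat-type hypersurfaces" means that the Fermat-type hypersurface is a $\Delta(w)$-regular member of the same family. $\pi_1(\Delta,M)=N/N_{\Delta^*}$, where $N_{\Delta^*}\subset N$ is the sublattice generated by the vertices of $\Delta^*$. *)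

theory Defs
  imports
    "HOL-Analysis.Analysis"
    "HOL-Library.Poly_Mapping"
    "HOL-Algebra.Coset"
    "HOL-Algebra.Generated_Groups"
    "HOL-Algebra.Group_Action"
begin

section \<open>Lattices, reflexive pairs and their fundamental groups\<close>

text \<open>A free abelian group of finite rank is given as a lattice \<open>M\<close> inside a Euclidean space, with
  \<open>M \<otimes> \<real>\<close> realised as \<open>span M\<close>. All polytopes below have their vertices in \<open>span M\<close>; those with
  vertices in \<open>M\<close> or \<open>M \<otimes> \<rat>\<close> are determined by these vertices, so working over the reals
  (where \<^const>\<open>polytope\<close> and \<^const>\<open>face_of\<close> are available) instead of the rationals does not
  change vertices, faces or lattice points.\<close>

definition is_lattice :: "'v::euclidean_space set \<Rightarrow> bool" where
  "is_lattice M \<longleftrightarrow>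
     (\<exists>B. independent B \<and> M = {\<Sum>b\<in>B. of_int (c b) *\<^sub>R b | c :: 'v \<Rightarrow> int. True})"

text \<open>The dual lattice is \<open>N = Hom(M, \<int>)\<close>: every homomorphism extends uniquely to a linear form on
  \<open>span M\<close>, and \<open>y \<in> span M\<close> stands for the form \<open>x \<mapsto> x \<bullet> y\<close>.\<close>

definition dual_lattice :: "'v::euclidean_space set \<Rightarrow> 'v set" where
  "dual_lattice M = {y \<in> span M. \<forall>x\<in>M. x \<bullet> y \<in> \<int>}"

definition primitive_in :: "'v::euclidean_space set \<Rightarrow> 'v \<Rightarrow> bool" where
  "primitive_in N l \<longleftrightarrow> l \<in> N \<and> \<not> (\<exists>k::nat. \<exists>l'\<in>N. k \<ge> 2 \<and> l = real k *\<^sub>R l')"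

text \<open>As the affine hull of \<open>\<Delta>\<close> is \<open>span M\<close>, its relative interior is its interior in \<open>span M\<close>.\<close>

definition reflexive_pair :: "'v::euclidean_space set \<Rightarrow> 'v set \<Rightarrow> bool" where
  "reflexive_pair \<Delta> M \<longleftrightarrow>
     is_lattice M \<and> polytope \<Delta> \<and> \<Delta> \<subseteq> span M \<and> aff_dim \<Delta> = int (dim M) \<and>
     {v. v extreme_point_of \<Delta>} \<subseteq> M \<and> 0 \<in> rel_interior \<Delta> \<and>
     (\<forall>F. F facet_of \<Delta> \<longrightarrow>
        (\<exists>l c. primitive_in (dual_lattice M) l \<and> \<bar>c\<bar> = (1::real) \<and>
               affine hull F = {x \<in> span M. x \<bullet> l = c}))"

definition dual_polytope :: "'v::euclidean_space set \<Rightarrow> 'v set \<Rightarrow> 'v set" where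
  "dual_polytope \<Delta> M = {y \<in> span M. \<forall>x\<in>\<Delta>. x \<bullet> y \<ge> -1}"

definition simplex_with_weights ::
    "'v::euclidean_space set \<Rightarrow> ('i::finite \<Rightarrow> nat) \<Rightarrow> bool" where
  "simplex_with_weights \<Delta> w \<longleftrightarrow>
     (int (card (UNIV :: 'i set)) - 1) simplex \<Delta> \<and>
     (\<forall>i. w i > 0) \<and> Gcd (range w) = 1 \<and>
     (\<exists>p. bij_betw p UNIV {v. v extreme_point_of \<Delta>} \<and> (\<Sum>i\<in>UNIV. real (w i) *\<^sub>R p i) = 0)"

definition additive_group :: "'v::euclidean_space set \<Rightarrow> 'v monoid" where
  "additive_group L = \<lparr>carrier = L, monoid.mult = (+), one = 0\<rparr>"

definition fundamental_group :: "'v::euclidean_space set \<Rightarrow> 'v set \<Rightarrow> 'v set monoid" where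
  "fundamental_group \<Delta> M =
     (let N = additive_group (dual_lattice M)
      in N Mod (generate N {v. v extreme_point_of dual_polytope \<Delta> M}))"


section \<open>Complex varieties as spaces with functions\<close>

text \<open>A variety is its set of closed points with the Zariski topology and, for every open \<open>U\<close>, the
  set of regular functions on \<open>U\<close>. Such a function is a total HOL function of which only the values on
  \<open>U\<close> matter.\<close>

record 'p variety =
  zar :: "'p topology"
  reg :: "'p set \<Rightarrow> ('p \<Rightarrow> complex) set"

abbreviation points :: "'p variety \<Rightarrow> 'p set" where
  "points X \<equiv> topspace (zar X)"

definition subvariety :: "'p variety \<Rightarrow> 'p set \<Rightarrow> 'p variety" where
  "subvariety X Z =
     \<lparr>zar = subtopology (zar X) Z,
      reg = (\<lambda>U. {\<phi>. \<forall>x\<in>U. \<exists>W \<psi>. openin (zar X) W \<and> x \<in> W \<and> \<psi> \<in> reg X W \<and>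
                                    (\<forall>y\<in>U \<inter> W. \<phi> y = \<psi> y)})\<rparr>"

definition morphism :: "'p variety \<Rightarrow> 'q variety \<Rightarrow> ('p \<Rightarrow> 'q) \<Rightarrow> bool" where
  "morphism X Y f \<longleftrightarrow> continuous_map (zar X) (zar Y) f \<and>
     (\<forall>V \<phi>. openin (zar Y) V \<and> \<phi> \<in> reg Y V \<longrightarrow> \<phi> \<circ> f \<in> reg X {x \<in> points X. f x \<in> V})"

definition isomorphism :: "'p variety \<Rightarrow> 'q variety \<Rightarrow> ('p \<Rightarrow> 'q) \<Rightarrow> bool" where
  "isomorphism X Y f \<longleftrightarrow> morphism X Y f \<and>
     (\<exists>g. morphism Y X g \<and> (\<forall>x\<in>points X. g (f x) = x) \<and> (\<forall>y\<in>points Y. f (g y) = y))"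

text \<open>\<^const>\<open>group_action\<close> wants every group element to act by a function that is undefined outside the
  space acted upon, whence the \<^const>\<open>restrict\<close>.\<close>

definition acts_on :: "'g monoid \<Rightarrow> ('g \<Rightarrow> 'p \<Rightarrow> 'p) \<Rightarrow> 'p variety \<Rightarrow> bool" where
  "acts_on G act X \<longleftrightarrow>
     group_action G (points X) (\<lambda>g. restrict (act g) (points X)) \<and>
     (\<forall>g\<in>carrier G. isomorphism X X (act g))"

text \<open>\<open>q\<close> exhibits \<open>Y\<close> as the quotient \<open>X / G\<close>: its fibres are the orbits, \<open>Y\<close> carries the quotient
  topology, and the regular functions on \<open>Y\<close> are the \<open>G\<close>-invariant regular functions on \<open>X\<close>.\<close>

definition quotient_by ::
    "'g monoid \<Rightarrow> ('g \<Rightarrow> 'p \<Rightarrow> 'p) \<Rightarrow> 'p variety \<Rightarrow> 'q variety \<Rightarrow> ('p \<Rightarrow> 'q) \<Rightarrow> bool" where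
  "quotient_by G act X Y q \<longleftrightarrow>
     acts_on G act X \<and>
     quotient_map (zar X) (zar Y) q \<and>
     (\<forall>x\<in>points X. \<forall>y\<in>points X. q x = q y \<longleftrightarrow> (\<exists>g\<in>carrier G. act g x = y)) \<and>
     (\<forall>V \<phi>. openin (zar Y) V \<longrightarrow>
        (\<phi> \<in> reg Y V \<longleftrightarrow> \<phi> \<circ> q \<in> reg X {x \<in> points X. q x \<in> V}))"

text \<open>\<open>Proj\<close> of a graded ring \<open>S\<close> of functions on an affine cone, on its closed points: \<open>P\<close> is
  the set of orbits of the multiplicative group on the cone without its vertex, and \<open>S k\<close> consists of
  the functions of degree \<open>k\<close>. Non-vanishing of such a function, and the value of a quotient of two of
  the same degree, do not depend on the representative \<open>c\<close> of an orbit.\<close>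

definition proj_variety ::
    "'c set set \<Rightarrow> (nat \<Rightarrow> ('c \<Rightarrow> complex) set) \<Rightarrow> 'c set variety" where
  "proj_variety P S =
     (let T = topology_generated_by {{x \<in> P. \<forall>c\<in>x. h c \<noteq> 0} | h k. h \<in> S k}
      in \<lparr>zar = T,
          reg = (\<lambda>U. {\<phi>. \<forall>x\<in>U. \<exists>W k g h. openin T W \<and> x \<in> W \<and> W \<subseteq> U \<and> g \<in> S k \<and> h \<in> S k \<and>
                           (\<forall>y\<in>W. \<forall>c\<in>y. h c \<noteq> 0 \<and> \<phi> y = g c / h c)})\<rparr>)"


section \<open>The projective toric variety of a polytope\<close>

text \<open>\<open>P\<^sub>\<Delta> = Proj S\<^sub>\<Delta>\<close>, where \<open>S\<^sub>\<Delta>\<close> is the semigroup ring of the monoid of all \<open>(k, m)\<close> with \<open>m\<close> a lattice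
  point of \<open>k\<Delta>\<close>, graded by \<open>k\<close>.\<close>

definition cone_monoid :: "'v::euclidean_space set \<Rightarrow> 'v set \<Rightarrow> (nat \<times> 'v) set" where
  "cone_monoid \<Delta> M = {(k, m). m \<in> M \<and> m \<in> (\<lambda>x. real k *\<^sub>R x) ` \<Delta>}"

text \<open>Closed points of \<open>Spec S\<^sub>\<Delta>\<close> are monoid homomorphisms from the cone monoid to the multiplicative
  monoid of complex numbers (extended by 0); the irrelevant locus is removed.\<close>

definition cone_points :: "'v::euclidean_space set \<Rightarrow> 'v set \<Rightarrow> (nat \<times> 'v \<Rightarrow> complex) set" where
  "cone_points \<Delta> M =
     {\<xi>. (\<forall>a. a \<notin> cone_monoid \<Delta> M \<longrightarrow> \<xi> a = 0) \<and> \<xi> (0, 0) = 1 \<and>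
         (\<forall>(k, m) \<in> cone_monoid \<Delta> M. \<forall>(k', m') \<in> cone_monoid \<Delta> M.
            \<xi> (k + k', m + m') = \<xi> (k, m) * \<xi> (k', m')) \<and>
         (\<exists>(k, m) \<in> cone_monoid \<Delta> M. k > 0 \<and> \<xi> (k, m) \<noteq> 0)}"

definition scaling_orbit :: "(nat \<times> 'v \<Rightarrow> complex) \<Rightarrow> (nat \<times> 'v \<Rightarrow> complex) set" where
  "scaling_orbit \<xi> = {\<lambda>(k, m). c ^ k * \<xi> (k, m) | c. c \<noteq> 0}"

definition section_value ::
    "('v \<Rightarrow>\<^sub>0 complex) \<Rightarrow> nat \<Rightarrow> (nat \<times> 'v \<Rightarrow> complex) \<Rightarrow> complex" where
  "section_value f k \<xi> = (\<Sum>m\<in>Poly_Mapping.keys f. Poly_Mapping.lookup f m * \<xi> (k, m))"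

definition toric_sections ::
    "'v::euclidean_space set \<Rightarrow> 'v set \<Rightarrow> nat \<Rightarrow> ((nat \<times> 'v \<Rightarrow> complex) \<Rightarrow> complex) set" where
  "toric_sections \<Delta> M k =
     {section_value f k | f. \<forall>m\<in>Poly_Mapping.keys f. (k, m) \<in> cone_monoid \<Delta> M}"

definition toric_variety ::
    "'v::euclidean_space set \<Rightarrow> 'v set \<Rightarrow> (nat \<times> 'v \<Rightarrow> complex) set variety" where
  "toric_variety \<Delta> M = proj_variety (scaling_orbit ` cone_points \<Delta> M) (toric_sections \<Delta> M)"

text \<open>The torus is \<open>T = Hom(M, \<complex>\<^sup>*)\<close>; values of \<open>t\<close> outside \<open>M\<close> are never used.\<close>

definition torus :: "'v::euclidean_space set \<Rightarrow> ('v \<Rightarrow> complex) set" where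
  "torus M = {t. (\<forall>m\<in>M. t m \<noteq> 0) \<and> (\<forall>m\<in>M. \<forall>m'\<in>M. t (m + m') = t m * t m')}"

definition torus_point ::
    "'v::euclidean_space set \<Rightarrow> 'v set \<Rightarrow> ('v \<Rightarrow> complex) \<Rightarrow> (nat \<times> 'v \<Rightarrow> complex) set" where
  "torus_point \<Delta> M t =
     scaling_orbit (\<lambda>(k, m). if (k, m) \<in> cone_monoid \<Delta> M then t m else 0)"

definition torus_translation ::
    "('v \<Rightarrow> complex) \<Rightarrow> (nat \<times> 'v \<Rightarrow> complex) set \<Rightarrow> (nat \<times> 'v \<Rightarrow> complex) set" where
  "torus_translation t x = (\<lambda>\<xi> (k, m). t m * \<xi> (k, m)) ` x"

definition torus_orbit ::
    "'v::euclidean_space set \<Rightarrow> 'v set \<Rightarrow> 'v set \<Rightarrow> (nat \<times> 'v \<Rightarrow> complex) set set" where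
  "torus_orbit \<Delta> M \<Theta> =
     {x \<in> points (toric_variety \<Delta> M).
        \<forall>\<xi>\<in>x. \<forall>a \<in> cone_monoid \<Delta> M. \<xi> a \<noteq> 0 \<longleftrightarrow> a \<in> cone_monoid \<Theta> M}"


section \<open>Families of regular hypersurfaces\<close>

text \<open>Laurent polynomials are finitely supported functions on \<open>M\<close>.\<close>

definition has_newton_polyhedron ::
    "('v::euclidean_space \<Rightarrow>\<^sub>0 complex) \<Rightarrow> 'v set \<Rightarrow> 'v set \<Rightarrow> bool" where
  "has_newton_polyhedron f \<Delta> M \<longleftrightarrow>
     Poly_Mapping.keys f \<subseteq> M \<and> convex hull (Poly_Mapping.keys f) = \<Delta>"

definition hypersurface ::
    "'v::euclidean_space set \<Rightarrow> 'v set \<Rightarrow> ('v \<Rightarrow>\<^sub>0 complex) \<Rightarrow>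
     (nat \<times> 'v \<Rightarrow> complex) set set" where
  "hypersurface \<Delta> M f =
     zar (toric_variety \<Delta> M) closure_of
       {torus_point \<Delta> M t | t.
          t \<in> torus M \<and> (\<Sum>m\<in>Poly_Mapping.keys f. Poly_Mapping.lookup f m * t m) = 0}"

text \<open>Regularity refers to the scheme-theoretic intersection of the hypersurface with \<open>T\<^sub>\<Theta>\<close> (a double
  point, say, is not smooth), which is the subscheme of \<open>T\<^sub>\<Theta>\<close> with equation \<open>f\<^sub>\<Theta> = 0\<close>, where \<open>f\<^sub>\<Theta>\<close> is the
  part of \<open>f\<close> supported on \<open>\<Theta>\<close>. It is smooth of codimension 1 at a point iff the differential of the
  equation along \<open>T\<^sub>\<Theta>\<close> does not vanish there. The tangent spaces of \<open>T\<^sub>\<Theta>\<close> are spanned by the invariant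
  vector fields belonging to \<open>u \<in> N\<close>, which send the character \<open>m\<close> to \<open>(m \<bullet> u)\<close> times itself.\<close>

definition smooth_on_orbit_at ::
    "'v::euclidean_space set \<Rightarrow> ('v \<Rightarrow>\<^sub>0 complex) \<Rightarrow> 'v set \<Rightarrow>
     (nat \<times> 'v \<Rightarrow> complex) set \<Rightarrow> bool" where
  "smooth_on_orbit_at M f \<Theta> x \<longleftrightarrow>
     (\<forall>\<xi>\<in>x. \<exists>u\<in>dual_lattice M.
        (\<Sum>m\<in>Poly_Mapping.keys f \<inter> \<Theta>.
           of_real (m \<bullet> u) * Poly_Mapping.lookup f m * \<xi> (1, m)) \<noteq> 0)"

definition regular_polynomial ::
    "'v::euclidean_space set \<Rightarrow> 'v set \<Rightarrow> ('v \<Rightarrow>\<^sub>0 complex) \<Rightarrow> bool" where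
  "regular_polynomial \<Delta> M f \<longleftrightarrow>
     has_newton_polyhedron f \<Delta> M \<and>
     (\<forall>\<Theta>. \<Theta> face_of \<Delta> \<and> \<Theta> \<noteq> {} \<longrightarrow>
        (\<forall>x \<in> hypersurface \<Delta> M f \<inter> torus_orbit \<Delta> M \<Theta>. smooth_on_orbit_at M f \<Theta> x))"

definition regular_family ::
    "'v::euclidean_space set \<Rightarrow> 'v set \<Rightarrow> (nat \<times> 'v \<Rightarrow> complex) set set set" where
  "regular_family \<Delta> M = {hypersurface \<Delta> M f | f. regular_polynomial \<Delta> M f}"


section \<open>Weighted projective spaces and Fermat hypersurfaces\<close>

text \<open>The finite type \<open>'i\<close> plays the role of the index set \<open>{0, \<dots>, n}\<close>.\<close>

definition weight_lattice :: "('i::finite \<Rightarrow> nat) \<Rightarrow> (real ^ 'i) set" where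
  "weight_lattice w = {x. (\<forall>i. x $ i \<in> \<int>) \<and> (\<Sum>i\<in>UNIV. real (w i) * x $ i) = 0}"

definition weight_polytope :: "('i::finite \<Rightarrow> nat) \<Rightarrow> (real ^ 'i) set" where
  "weight_polytope w = {x. (\<Sum>i\<in>UNIV. real (w i) * x $ i) = 0 \<and> (\<forall>i. x $ i \<ge> -1)}"

definition weighted_orbit :: "('i::finite \<Rightarrow> nat) \<Rightarrow> complex ^ 'i \<Rightarrow> (complex ^ 'i) set" where
  "weighted_orbit w v = {\<chi> i. c ^ w i * v $ i | c. c \<noteq> 0}"

definition weighted_forms ::
    "('i::finite \<Rightarrow> nat) \<Rightarrow> nat \<Rightarrow> (complex ^ 'i \<Rightarrow> complex) set" where
  "weighted_forms w e =
     {\<lambda>v. \<Sum>a\<in>Poly_Mapping.keys F.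
            Poly_Mapping.lookup F a * (\<Prod>i\<in>UNIV. v $ i ^ Poly_Mapping.lookup a i)
      | F :: ('i \<Rightarrow>\<^sub>0 nat) \<Rightarrow>\<^sub>0 complex.
        \<forall>a\<in>Poly_Mapping.keys F. (\<Sum>i\<in>UNIV. w i * Poly_Mapping.lookup a i) = e}"

definition weighted_projective_space :: "('i::finite \<Rightarrow> nat) \<Rightarrow> (complex ^ 'i) set variety" where
  "weighted_projective_space w = proj_variety (weighted_orbit w ` (UNIV - {0})) (weighted_forms w)"

text \<open>The lattice point \<open>m\<close> of \<open>k\<Delta>(w)\<close> corresponds to the monomial with exponents
  \<open>m\<^sub>i + k \<ge> 0\<close>, of weighted degree \<open>k \<cdot> \<Sum>w\<^sub>i\<close>. Scaling \<open>v\<close> by \<open>c\<close> scales the degree \<open>k\<close> coordinates of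
  its image by the \<open>k\<close>-th power of \<open>c\<close> to the \<open>\<Sum>w\<^sub>i\<close>, so the image of an orbit is a full orbit.\<close>

definition weighted_to_toric ::
    "('i::finite \<Rightarrow> nat) \<Rightarrow> (complex ^ 'i) set \<Rightarrow> (nat \<times> (real ^ 'i) \<Rightarrow> complex) set" where
  "weighted_to_toric w x =
     (\<lambda>v (k, m). if (k, m) \<in> cone_monoid (weight_polytope w) (weight_lattice w)
                 then \<Prod>i\<in>UNIV. v $ i ^ nat \<lfloor>m $ i + real k\<rfloor> else 0) ` x"

definition fermat_weights :: "('i::finite \<Rightarrow> nat) \<Rightarrow> 'i \<Rightarrow> nat" where
  "fermat_weights d i = Lcm (range d) div d i"

definition fermat_hypersurface :: "('i::finite \<Rightarrow> nat) \<Rightarrow> (complex ^ 'i) set set" where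
  "fermat_hypersurface d =
     {x \<in> points (weighted_projective_space (fermat_weights d)).
        \<forall>v\<in>x. (\<Sum>i\<in>UNIV. v $ i ^ d i) = 0}"

end

(*
  Let l_i be the vertices of the dual simplex. Since the weights of Delta are w_i = lcm(d)/d_i and
  sum w_i = lcm(d), pairing the vertex p_i with l_j gives d_i - 1 if i = j and -1 otherwise. Hence
  x |-> (<x, l_i>)_i embeds M into M(w) with finite index and maps Delta onto Delta(w). Both
  P_Delta(w) and P_Delta are quotients of the weighted projective space by finite groups of roots
  of unity: every point of the cone of P_Delta is given by Cox coordinates v through
  (k, m) |-> prod v_i^(<m, l_i> + k), because characters of subgroups of Z^(n+1) with values in
  the divisible group C* extend. A form becomes invariant after projecting it to an isotypic
  component and multiplying it by a monomial of the opposite character, which gives the topology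
  and the regular functions of the quotient. An element y of N acts on P_Delta(w) by the torus
  element exp(2 pi i <m, y>); it acts trivially iff y lies in the lattice generated by the l_i.
  Restriction of functions from M(w) to M is then the quotient map, it is open, so hypersurfaces
  of P_Delta pull back to hypersurfaces of P_Delta(w) with the same equation, and regularity is
  preserved because it only involves derivatives along N.
*)
theory Submission
  imports Defs
begin

section \<open>Projective varieties as quotients of cones\<close>

text \<open>A regular function is recorded by equations \<open>\<phi> y * h c = g c\<close> that
  hold on a whole set of points (\<open>ratio_on\<close>) and are linear in the pair (g, h). Such an
  equation can be averaged over a finite group without passing to smaller neighbourhoods, and the
  same criterion serves open sets and subvarieties. The map from P_Delta(w) to P_Delta is not
  analysed directly: both varieties receive Cox maps from P(w), these form a commutative triangle
  with the restriction map, and topology and functions are transported along its two sides. For M(w)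
  itself the roots of unity act inside the weighted orbits because the weights are coprime, so that
  side is an isomorphism. The monomial that makes a form invariant has exponent (L - 1) b, where L =
  lcm(d) and b is an exponent of the chosen isotypic class. It works because L times any integer
  vector is an exponent of the lattice, the vertex p_i having exponent d_i e_i; it also turns
  weighted degree e into e L, the degree of a toric section of degree e.\<close>

definition nonvanishing :: "'c set set \<Rightarrow> ('c \<Rightarrow> complex) \<Rightarrow> 'c set set" where
  "nonvanishing P h = {x \<in> P. \<forall>c\<in>x. h c \<noteq> 0}"

text \<open>The equation is required on all of \<open>U\<close>, while \<open>h\<close> has to be
  nonzero only at \<open>x\<close>: cross-multiplication makes sense where \<open>h\<close>
  vanishes. No topology is mentioned, so the predicate applies to arbitrary sets of points, in
  particular to open subsets of a subvariety.\<close>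

definition ratio_on :: "(nat \<Rightarrow> ('c \<Rightarrow> complex) set) \<Rightarrow> 'c set set \<Rightarrow> ('c set \<Rightarrow> complex) \<Rightarrow> bool" where
  "ratio_on S U \<phi> \<longleftrightarrow>
     (\<forall>x\<in>U. \<exists>k. \<exists>g\<in>S k. \<exists>h\<in>S k. (\<forall>c\<in>x. h c \<noteq> 0) \<and> (\<forall>y\<in>U. \<forall>c\<in>y. \<phi> y * h c = g c))"

lemma ratio_onE:
  assumes "ratio_on S U \<phi>" "x \<in> U"
  obtains k g h where "g \<in> S k" "h \<in> S k" "\<forall>c\<in>x. h c \<noteq> 0" "\<forall>y\<in>U. \<forall>c\<in>y. \<phi> y * h c = g c"
  using bspec[OF assms(1)[unfolded ratio_on_def] assms(2)] by blast

lemma ratio_on_cong: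
  assumes "\<And>y. y \<in> U \<Longrightarrow> \<phi> y = \<psi> y"
  shows "ratio_on S U \<phi> \<longleftrightarrow> ratio_on S U \<psi>"
  unfolding ratio_on_def using assms by simp

text \<open>Common abstraction of weighted cones and toric cones. In \<open>homogeneous\<close> one
  scalar \<open>u\<close> serves all degrees. In \<open>sections_mult\<close> the product is
  prescribed only on the cone, since coordinates of a toric cone multiply only at actual cone
  points.\<close>

locale graded_cone =
  fixes P :: "'c set set" and S :: "nat \<Rightarrow> ('c \<Rightarrow> complex) set"
  assumes orbit_nonempty: "x \<in> P \<Longrightarrow> x \<noteq> {}"
    and homogeneous: "x \<in> P \<Longrightarrow> c \<in> x \<Longrightarrow> c' \<in> x \<Longrightarrow> \<exists>u. u \<noteq> 0 \<and> (\<forall>k. \<forall>h\<in>S k. h c' = u ^ k * h c)"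
    and sections_mult: "g \<in> S k \<Longrightarrow> h \<in> S l \<Longrightarrow> \<exists>f\<in>S (k + l). \<forall>x\<in>P. \<forall>c\<in>x. f c = g c * h c"
    and sections_zero: "(\<lambda>_. 0) \<in> S k"
    and some_section_nonzero: "x \<in> P \<Longrightarrow> \<exists>k. \<exists>h\<in>S k. \<forall>c\<in>x. h c \<noteq> 0"
begin

abbreviation "X \<equiv> proj_variety P S"
abbreviation "D \<equiv> nonvanishing P"

lemma nonzero_on_orbit: 
  assumes "x \<in> P" "c \<in> x" "h \<in> S k" "h c \<noteq> 0" shows "x \<in> D h"
proof -
  have "h c' \<noteq> 0" if c': "c' \<in> x" for c'
  proof -
    obtain u where "u \<noteq> 0" "\<forall>k. \<forall>h\<in>S k. h c' = u ^ k * h c"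
      using homogeneous[OF assms(1,2) c'] by blast
    then have "h c' = u ^ k * h c" using assms(3) by blast
    then show ?thesis using assms(4) \<open>u \<noteq> 0\<close> by simp
  qed
  then show ?thesis using assms by (auto simp: nonvanishing_def)
qed

lemma zero_on_orbit:
  assumes "x \<in> P" "x \<notin> D h" "h \<in> S k" "c \<in> x" shows "h c = 0"
  using nonzero_on_orbit assms by blast

lemma nonvanishing_mult: "\<forall>x\<in>P. \<forall>c\<in>x. f c = g c * h c \<Longrightarrow> D f = D g \<inter> D h"
  by (auto simp: nonvanishing_def)

lemma zar_eq: "zar X = topology_generated_by {D h | h k. h \<in> S k}"
  by (simp add: proj_variety_def Let_def nonvanishing_def)

text \<open>Products of sections turn intersections of sets \<open>D g\<close> and
  \<open>D h\<close> into sets of the same form, so these sets are a base and not merely a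
  subbase.\<close>

lemma openin_zar_iff:
  "openin (zar X) U \<longleftrightarrow> U \<subseteq> P \<and> (\<forall>x\<in>U. \<exists>k. \<exists>h\<in>S k. x \<in> D h \<and> D h \<subseteq> U)" (is "_ \<longleftrightarrow> ?R U")
proof
  assume "openin (zar X) U"
  then have "generate_topology_on {D h | h k. h \<in> S k} U"
    by (simp add: zar_eq openin_topology_generated_by_iff)
  then show "?R U"
  proof induction
    case Empty then show ?case by simp
  next
    case (Int a b)
    have "\<exists>k. \<exists>h\<in>S k. x \<in> D h \<and> D h \<subseteq> a \<inter> b" if x: "x \<in> a \<inter> b" for x
    proof -
      obtain k g where g: "g \<in> S k" "x \<in> D g" "D g \<subseteq> a" using Int x by blast
      obtain l h where h: "h \<in> S l" "x \<in> D h" "D h \<subseteq> b" using Int x by blast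
      obtain f where f: "f \<in> S (k + l)" "\<forall>x\<in>P. \<forall>c\<in>x. f c = g c * h c"
        using sections_mult[OF g(1) h(1)] by blast
      show ?thesis
        using f(1) nonvanishing_mult[OF f(2)] g h by (intro exI[of _ "k + l"] bexI[of _ f]) auto
    qed
    then show ?case using Int by blast
  next
    case (UN K) then show ?case by (meson Sup_le_iff Union_iff order_trans Sup_upper)
  next
    case (Basis s) then show ?case by (auto simp: nonvanishing_def)
  qed
next
  assume R: "?R U"
  have "U = \<Union>{D h | h k. h \<in> S k \<and> D h \<subseteq> U}" using R by blast
  moreover have "openin (zar X) (\<Union>{D h | h k. h \<in> S k \<and> D h \<subseteq> U})"
    by (rule openin_Union) (auto simp: zar_eq intro!: topology_generated_by_Basis)
  ultimately show "openin (zar X) U" by simp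
qed

lemma openin_nonvanishing: "h \<in> S k \<Longrightarrow> openin (zar X) (D h)"
  unfolding openin_zar_iff by (auto simp: nonvanishing_def)

lemma points_eq [simp]: "points X = P"
proof
  show "points X \<subseteq> P" using openin_zar_iff by blast
  have "openin (zar X) P"
    unfolding openin_zar_iff using some_section_nonzero by (auto simp: nonvanishing_def)
  then show "P \<subseteq> points X" by (simp add: openin_subset)
qed

text \<open>A local fraction g / h near \<open>x\<close> becomes an equation on all of
  \<open>U\<close> after multiplying both terms by a section \<open>s\<close> with \<open>x\<close>
  in \<open>D s\<close> and \<open>D s\<close> inside the neighbourhood: where \<open>s\<close>
  vanishes, both sides are zero. \<open>U\<close> is an arbitrary set of points, as subvarieties
  require.\<close>

lemma ratio_on_of_reg:
  assumes U: "U \<subseteq> P"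
    and loc: "\<And>x. x \<in> U \<Longrightarrow> \<exists>W k g h. openin (zar X) W \<and> x \<in> W \<and> g \<in> S k \<and> h \<in> S k \<and>
       (\<forall>y\<in>W. \<forall>c\<in>y. h c \<noteq> 0) \<and> (\<forall>y\<in>W \<inter> U. \<forall>c\<in>y. \<phi> y = g c / h c)"
  shows "ratio_on S U \<phi>"
  unfolding ratio_on_def
proof
  fix x assume x: "x \<in> U"
  obtain W k g h where W: "openin (zar X) W" "x \<in> W" and gh: "g \<in> S k" "h \<in> S k"
    and nz: "\<forall>y\<in>W. \<forall>c\<in>y. h c \<noteq> 0" and eq: "\<forall>y\<in>W \<inter> U. \<forall>c\<in>y. \<phi> y = g c / h c"
    using loc[OF x] by blast
  obtain l s where s: "s \<in> S l" "x \<in> D s" "D s \<subseteq> W" using W openin_zar_iff by blast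
  obtain g' h' where g': "g' \<in> S (k + l)" "\<forall>x\<in>P. \<forall>c\<in>x. g' c = g c * s c"
    and h': "h' \<in> S (k + l)" "\<forall>x\<in>P. \<forall>c\<in>x. h' c = h c * s c"
    using sections_mult[OF gh(1) s(1)] sections_mult[OF gh(2) s(1)] by blast
  have "\<phi> y * h' c = g' c" if y: "y \<in> U" "c \<in> y" for y c
  proof -
    have yP: "y \<in> P" using y U by blast
    have "\<phi> y * (h c * s c) = g c * s c"
    proof (cases "y \<in> D s")
      case True then show ?thesis using nz eq s y by (auto simp: field_simps)
    next
      case False then have "s c = 0" using zero_on_orbit s y U by blast
      then show ?thesis by simp
    qed
    then show ?thesis using g'(2) h'(2) yP y(2) by simp
  qed
  moreover have "\<forall>c\<in>x. h' c \<noteq> 0" using s W nz h'(2) x U by (auto simp: nonvanishing_def)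
  ultimately show "\<exists>k. \<exists>g\<in>S k. \<exists>h\<in>S k. (\<forall>c\<in>x. h c \<noteq> 0) \<and> (\<forall>y\<in>U. \<forall>c\<in>y. \<phi> y * h c = g c)"
    by (intro exI[of _ "k + l"] bexI[OF _ g'(1)] bexI[OF _ h'(1)]) blast
qed

lemma reg_iff:
  assumes U: "openin (zar X) U"
  shows "\<phi> \<in> reg X U \<longleftrightarrow> ratio_on S U \<phi>"
proof
  have UP: "U \<subseteq> P" using U openin_zar_iff by blast
  let ?T = "topology_generated_by {{x \<in> P. \<forall>c\<in>x. h c \<noteq> 0} | h k. h \<in> S k}"
  have T: "?T = zar X" by (simp add: proj_variety_def Let_def)
  have mem: "\<phi> \<in> reg X U \<longleftrightarrow> (\<forall>x\<in>U. \<exists>W k g h. openin (zar X) W \<and> x \<in> W \<and> W \<subseteq> U \<and> g \<in> S k \<and> h \<in> S k \<and>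
                           (\<forall>y\<in>W. \<forall>c\<in>y. h c \<noteq> 0 \<and> \<phi> y = g c / h c))"
    unfolding T[symmetric] by (simp add: proj_variety_def Let_def)
  {
    assume "\<phi> \<in> reg X U"
    then show "ratio_on S U \<phi>"
      unfolding mem by (intro ratio_on_of_reg[OF UP]) (metis IntE)
  next
    assume R: "ratio_on S U \<phi>"
    show "\<phi> \<in> reg X U" unfolding mem
    proof
      fix x assume x: "x \<in> U"
      obtain k g h where gh: "g \<in> S k" "h \<in> S k" "\<forall>c\<in>x. h c \<noteq> 0" "\<forall>y\<in>U. \<forall>c\<in>y. \<phi> y * h c = g c"
        by (rule ratio_onE[OF R x])
      show "\<exists>W k g h. openin (zar X) W \<and> x \<in> W \<and> W \<subseteq> U \<and> g \<in> S k \<and> h \<in> S k \<and>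
                           (\<forall>y\<in>W. \<forall>c\<in>y. h c \<noteq> 0 \<and> \<phi> y = g c / h c)"
        using gh x UP openin_Int[OF U openin_nonvanishing[OF gh(2)]]
        by (intro exI[of _ "U \<inter> D h"] exI[of _ k] exI[of _ g] exI[of _ h])
           (auto simp: nonvanishing_def field_simps)
    qed
  }
qed

text \<open>A function on a subvariety is regular when it extends locally to the ambient variety.
  The fraction g / h taken from a global equation provides such an extension on
  \<open>D h\<close>.\<close>

lemma reg_subvariety_iff:
  assumes U: "U \<subseteq> P"
  shows "\<phi> \<in> reg (subvariety X Z) U \<longleftrightarrow> ratio_on S U \<phi>"
proof
  assume "\<phi> \<in> reg (subvariety X Z) U"
  then have loc: "\<forall>x\<in>U. \<exists>W \<psi>. openin (zar X) W \<and> x \<in> W \<and> \<psi> \<in> reg X W \<and> (\<forall>y\<in>U \<inter> W. \<phi> y = \<psi> y)"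
    by (simp add: subvariety_def)
  show "ratio_on S U \<phi>"
  proof (rule ratio_on_of_reg[OF U])
    fix x assume x: "x \<in> U"
    then obtain W \<psi> where W: "openin (zar X) W" "x \<in> W" "ratio_on S W \<psi>" "\<forall>y\<in>U \<inter> W. \<phi> y = \<psi> y"
      using loc reg_iff by meson
    obtain k g h where gh: "g \<in> S k" "h \<in> S k" "\<forall>c\<in>x. h c \<noteq> 0" "\<forall>y\<in>W. \<forall>c\<in>y. \<psi> y * h c = g c"
      by (rule ratio_onE[OF W(3,2)])
    show "\<exists>W k g h. openin (zar X) W \<and> x \<in> W \<and> g \<in> S k \<and> h \<in> S k \<and>
       (\<forall>y\<in>W. \<forall>c\<in>y. h c \<noteq> 0) \<and> (\<forall>y\<in>W \<inter> U. \<forall>c\<in>y. \<phi> y = g c / h c)"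
      using gh x W U openin_Int[OF W(1) openin_nonvanishing[OF gh(2)]]
        by (intro exI[of _ "W \<inter> D h"] exI[of _ k] exI[of _ g] exI[of _ h])
           (auto simp: nonvanishing_def field_simps)
  qed
next
  assume R: "ratio_on S U \<phi>"
  have "\<exists>W \<psi>. openin (zar X) W \<and> x \<in> W \<and> \<psi> \<in> reg X W \<and> (\<forall>y\<in>U \<inter> W. \<phi> y = \<psi> y)" if x: "x \<in> U" for x
  proof -
    obtain k g h where gh: "g \<in> S k" "h \<in> S k" "\<forall>c\<in>x. h c \<noteq> 0" "\<forall>y\<in>U. \<forall>c\<in>y. \<phi> y * h c = g c"
      by (rule ratio_onE[OF R x])
    \<comment> \<open>Any representative gives the same quotient on \<open>D h\<close>, because
      \<open>g\<close> and \<open>h\<close> are homogeneous of the same degree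
      \<open>k\<close>.\<close>
    define \<psi> where "\<psi> y = (let c = SOME c. c \<in> y in g c / h c)" for y
    have \<psi>: "\<psi> y * h c = g c" if yc: "y \<in> D h" "c \<in> y" for y c
    proof -
      have y: "y \<in> P" using yc by (simp add: nonvanishing_def)
      have "(SOME c. c \<in> y) \<in> y" using yc(2) by (rule someI)
      then obtain u where "u \<noteq> 0" "\<forall>k. \<forall>h\<in>S k. h c = u ^ k * h (SOME c. c \<in> y)"
        using homogeneous[OF y \<open>(SOME c. c \<in> y) \<in> y\<close> yc(2)] by blast
      moreover have "h (SOME c. c \<in> y) \<noteq> 0"
        using yc \<open>(SOME c. c \<in> y) \<in> y\<close> by (auto simp: nonvanishing_def)
      moreover have "h c = u ^ k * h (SOME c. c \<in> y)" "g c = u ^ k * g (SOME c. c \<in> y)"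
        using calculation(2) gh by blast+
      ultimately show ?thesis by (simp add: \<psi>_def Let_def)
    qed
    have "ratio_on S (D h) \<psi>" unfolding ratio_on_def
      by (intro ballI exI[of _ k] bexI[OF _ gh(1)] bexI[OF _ gh(2)])
         (use \<psi> in \<open>auto simp: nonvanishing_def\<close>)
    then have "\<psi> \<in> reg X (D h)" using reg_iff openin_nonvanishing gh by blast
    moreover have "\<phi> y = \<psi> y" if yUh: "y \<in> U \<inter> D h" for y
    proof -
      obtain c where c: "c \<in> y" using orbit_nonempty yUh U by blast
      then have "\<phi> y * h c = \<psi> y * h c" using \<psi> gh yUh by auto
      then show ?thesis using c yUh by (auto simp: nonvanishing_def)
    qed
    moreover have "x \<in> D h" using gh x U by (auto simp: nonvanishing_def)
    ultimately show ?thesis using openin_nonvanishing gh by blast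
  qed
  then show "\<phi> \<in> reg (subvariety X Z) U" by (simp add: subvariety_def)
qed

end

lemma zar_subvariety [simp]: "zar (subvariety X Z) = subtopology (zar X) Z"
  by (simp add: subvariety_def)

section \<open>Morphisms induced by maps of cones\<close>

text \<open>In \<open>pull_back\<close> the degree \<open>l\<close> depends only on
  \<open>k\<close>, so the numerator and the denominator of a fraction pull back to sections of one
  common degree.\<close>

locale cone_map = src: graded_cone P S + tgt: graded_cone P' S'
  for P :: "'c set set" and S :: "nat \<Rightarrow> ('c \<Rightarrow> complex) set"
    and P' :: "'d set set" and S' :: "nat \<Rightarrow> ('d \<Rightarrow> complex) set" +
  fixes F :: "'c \<Rightarrow> 'd"
  assumes image_orbit: "x \<in> P \<Longrightarrow> F ` x \<in> P'"
    and pull_back: "\<exists>l. \<forall>h\<in>S' k. \<exists>h'\<in>S l. \<forall>x\<in>P. \<forall>c\<in>x. h' c = h (F c)"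
begin

lemma ratio_on_pull_back:
  assumes V: "V \<subseteq> P'" "ratio_on S' V \<phi>" and U: "U \<subseteq> P" "image F ` U \<subseteq> V"
  shows "ratio_on S U (\<phi> \<circ> image F)"
  unfolding ratio_on_def
proof
  fix x assume x: "x \<in> U"
  then have "F ` x \<in> V" using U by blast
  then obtain k g h where gh: "g \<in> S' k" "h \<in> S' k" "\<forall>c\<in>F ` x. h c \<noteq> 0" "\<forall>y\<in>V. \<forall>c\<in>y. \<phi> y * h c = g c"
    by (rule ratio_onE[OF V(2)])
  obtain l where l: "\<forall>h\<in>S' k. \<exists>h'\<in>S l. \<forall>x\<in>P. \<forall>c\<in>x. h' c = h (F c)" using pull_back by blast
  obtain g' h' where "g' \<in> S l" "\<forall>x\<in>P. \<forall>c\<in>x. g' c = g (F c)" "h' \<in> S l" "\<forall>x\<in>P. \<forall>c\<in>x. h' c = h (F c)"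
    using bspec[OF l gh(1)] bspec[OF l gh(2)] by blast
  then have *: "g' \<in> S l" "h' \<in> S l" "\<And>z c. z \<in> U \<Longrightarrow> c \<in> z \<Longrightarrow> g' c = g (F c)"
      "\<And>z c. z \<in> U \<Longrightarrow> c \<in> z \<Longrightarrow> h' c = h (F c)"
    using U by blast+
  have "\<phi> (F ` z) * h' c = g' c" if z: "z \<in> U" "c \<in> z" for z c
    using gh(4) *(3,4)[OF z] z U by auto
  moreover have "\<forall>c\<in>x. h' c \<noteq> 0" using *(4)[OF x] gh(3) by auto
  ultimately show "\<exists>k. \<exists>g\<in>S k. \<exists>h\<in>S k. (\<forall>c\<in>x. h c \<noteq> 0) \<and> (\<forall>y\<in>U. \<forall>c\<in>y. (\<phi> \<circ> image F) y * h c = g c)"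
    by (intro exI[of _ l] bexI[OF _ *(1)] bexI[OF _ *(2)]) auto
qed

lemma continuous_image: "continuous_map (zar src.X) (zar tgt.X) (image F)"
  unfolding continuous_map
proof (intro conjI allI impI)
  show "image F ` points src.X \<subseteq> points tgt.X" using image_orbit by auto
  fix V assume V: "openin (zar tgt.X) V"
  show "openin (zar src.X) {x \<in> points src.X. F ` x \<in> V}"
    unfolding src.openin_zar_iff
  proof (intro conjI ballI)
    fix x assume x: "x \<in> {x \<in> points src.X. F ` x \<in> V}"
    then obtain k h where h: "h \<in> S' k" "F ` x \<in> tgt.D h" "tgt.D h \<subseteq> V"
      using V unfolding tgt.openin_zar_iff by blast
    obtain l h' where h': "h' \<in> S l" "\<forall>x\<in>P. \<forall>c\<in>x. h' c = h (F c)" using pull_back h by meson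
    have "src.D h' = {x \<in> P. F ` x \<in> tgt.D h}"
      using h'(2) image_orbit by (auto simp: nonvanishing_def)
    then show "\<exists>k. \<exists>h\<in>S k. x \<in> src.D h \<and> src.D h \<subseteq> {x \<in> points src.X. F ` x \<in> V}"
      using h h'(1) x by (intro exI[of _ l] bexI[of _ h']) auto
  qed auto
qed

text \<open>\<open>f\<close> has to agree with \<open>image F\<close> only at points of the source:
  the group action used later is defined by choosing a coset representative and coincides with the
  image map of another representative only there.\<close>

lemma morphism_image:
  assumes f: "\<And>x. x \<in> P \<Longrightarrow> f x = F ` x"
  shows "morphism src.X tgt.X f"
  unfolding morphism_def
proof (intro conjI allI impI)
  show cont: "continuous_map (zar src.X) (zar tgt.X) f"
    by (rule continuous_map_eq[OF continuous_image]) (simp add: f)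
  fix V \<phi> assume V: "openin (zar tgt.X) V \<and> \<phi> \<in> reg tgt.X V"
  let ?U = "{x \<in> points src.X. f x \<in> V}"
  have U: "openin (zar src.X) ?U" using openin_continuous_map_preimage[OF cont] V by blast
  have sub: "V \<subseteq> P'" "?U \<subseteq> P" "image F ` ?U \<subseteq> V" using V tgt.openin_zar_iff f by auto
  have "ratio_on S' V \<phi>" using V tgt.reg_iff[of V \<phi>] by simp
  then have "ratio_on S ?U (\<phi> \<circ> image F)" using sub by (intro ratio_on_pull_back[of V])
  moreover have "ratio_on S ?U (\<phi> \<circ> image F) \<longleftrightarrow> ratio_on S ?U (\<phi> \<circ> f)"
    by (rule ratio_on_cong) (simp add: f)
  ultimately show "\<phi> \<circ> f \<in> reg src.X ?U" using src.reg_iff[OF U] by blast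
qed

lemma morphism_image_subvariety:
  assumes Z: "Z \<subseteq> P" "Z' \<subseteq> P'" and f: "\<And>x. x \<in> Z \<Longrightarrow> f x = F ` x" "\<And>x. x \<in> Z \<Longrightarrow> f x \<in> Z'"
  shows "morphism (subvariety src.X Z) (subvariety tgt.X Z') f"
  unfolding morphism_def
proof (intro conjI allI impI)
  have "continuous_map (subtopology (zar src.X) Z) (zar tgt.X) f"
    by (rule continuous_map_eq[OF continuous_map_from_subtopology[OF continuous_image]]) (simp add: f)
  then show "continuous_map (zar (subvariety src.X Z)) (zar (subvariety tgt.X Z')) f"
    using f by (auto simp: continuous_map_in_subtopology)
  fix V \<phi> assume V: "openin (zar (subvariety tgt.X Z')) V \<and> \<phi> \<in> reg (subvariety tgt.X Z') V"
  let ?U = "{x \<in> points (subvariety src.X Z). f x \<in> V}"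
  have VP: "V \<subseteq> P'" using V Z openin_subset[of "zar (subvariety tgt.X Z')" V] by auto
  have UP: "?U \<subseteq> P" by auto
  have FU: "image F ` ?U \<subseteq> V" using f by auto
  have "ratio_on S' V \<phi>" using V tgt.reg_subvariety_iff[OF VP] by simp
  then have "ratio_on S ?U (\<phi> \<circ> image F)" using VP UP FU by (intro ratio_on_pull_back[of V])
  moreover have "ratio_on S ?U (\<phi> \<circ> image F) \<longleftrightarrow> ratio_on S ?U (\<phi> \<circ> f)"
    by (rule ratio_on_cong) (simp add: f)
  ultimately show "\<phi> \<circ> f \<in> reg (subvariety src.X Z) ?U" using src.reg_subvariety_iff[OF UP] by blast
qed

end

section \<open>Quotient maps of projective varieties\<close>

definition saturated_under :: "'p set \<Rightarrow> ('p \<Rightarrow> 'q) \<Rightarrow> 'p set \<Rightarrow> bool" where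
  "saturated_under P f U \<longleftrightarrow> U \<subseteq> P \<and> (\<forall>x\<in>U. \<forall>y\<in>P. f x = f y \<longrightarrow> y \<in> U)"

text \<open>Everything a quotient map of projective varieties provides except the group: a form \<open>H\<close> on
  the source that does not vanish at \<open>x\<close> can be made a form on the target, uniformly in the functions
  \<open>\<phi>\<close> with \<open>\<phi> H = G\<close> (for a finite group: by projecting to an isotypic component and multiplying by a
  monomial of the opposite character).\<close>

locale cone_quotient = cone_map +
  assumes surj_orbits: "y \<in> P' \<Longrightarrow> \<exists>x\<in>P. y = F ` x"
    and descend: "x \<in> P \<Longrightarrow> G \<in> S k \<Longrightarrow> H \<in> S k \<Longrightarrow> \<forall>c\<in>x. H c \<noteq> 0 \<Longrightarrow>
      \<exists>l. \<exists>g\<in>S' l. \<exists>h\<in>S' l. (\<forall>c\<in>x. h (F c) \<noteq> 0) \<and>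
        (\<forall>U \<phi>. saturated_under P (image F) U \<longrightarrow> (\<forall>y\<in>U. \<forall>c\<in>y. \<phi> (F ` y) * H c = G c) \<longrightarrow>
               (\<forall>y\<in>U. \<forall>c\<in>y. \<phi> (F ` y) * h (F c) = g (F c)))"
begin

text \<open>The descended denominator \<open>h\<close> gives a basic open set around the image point
  that stays inside the image of \<open>U\<close>. \<open>descend\<close> is applied with numerator
  zero to the complement of the saturation of \<open>U\<close>, where \<open>H\<close> vanishes.
  There the equation holds for every function \<phi>, and this freedom forces \<open>h\<close> to
  vanish as well.\<close>

lemma open_map_image: "open_map (zar src.X) (zar tgt.X) (image F)"
  unfolding open_map_def
proof (intro allI impI)
  fix U assume U: "openin (zar src.X) U"
  then have UP: "U \<subseteq> P" using src.openin_zar_iff by blast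
  show "openin (zar tgt.X) (image F ` U)"
    unfolding tgt.openin_zar_iff
  proof (intro conjI ballI)
    show "image F ` U \<subseteq> P'" using UP image_orbit by blast
    fix y assume "y \<in> image F ` U"
    then obtain x where x: "x \<in> U" "y = F ` x" by blast
    then obtain k H where H: "H \<in> S k" "x \<in> src.D H" "src.D H \<subseteq> U"
      using U unfolding src.openin_zar_iff by blast
    let ?C = "{z \<in> P. F ` z \<notin> image F ` U}"
    have sat: "saturated_under P (image F) ?C" by (auto simp: saturated_under_def)
    have H0: "\<forall>z\<in>?C. \<forall>c\<in>z. H c = 0" using H src.zero_on_orbit by blast
    obtain l g h where gh: "g \<in> S' l" "h \<in> S' l" "\<forall>c\<in>x. h (F c) \<noteq> 0"
      and univ: "\<forall>U \<phi>. saturated_under P (image F) U \<longrightarrow> (\<forall>y\<in>U. \<forall>c\<in>y. \<phi> (F ` y) * H c = 0) \<longrightarrow>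
               (\<forall>y\<in>U. \<forall>c\<in>y. \<phi> (F ` y) * h (F c) = g (F c))"
    proof -
      have "x \<in> P" "\<forall>c\<in>x. H c \<noteq> 0" using x UP H(2) by (auto simp: nonvanishing_def)
      from descend[OF this(1) src.sections_zero H(1) this(2)] show thesis
        by (elim exE bexE conjE) (rule that; assumption)
    qed
    have all: "\<forall>y\<in>?C. \<forall>c\<in>y. \<phi> (F ` y) * h (F c) = g (F c)" for \<phi>
      by (rule mp[OF mp[OF spec[OF spec[OF univ, of ?C], of \<phi>] sat]]) (simp add: H0)
    \<comment> \<open>The constant function 0 shows that \<open>g\<close> is zero on the complement;
      the constant function 1 then shows the same for \<open>h\<close>.\<close>
    have h0: "\<forall>z\<in>?C. \<forall>c\<in>z. h (F c) = 0"
      using all[of "\<lambda>_. 0"] all[of "\<lambda>_. 1"] by auto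
    have "z \<in> image F ` U" if z: "z \<in> tgt.D h" for z
    proof -
      obtain z' where z': "z' \<in> P" "z = F ` z'"
        using z surj_orbits unfolding nonvanishing_def by blast
      then obtain c where "c \<in> z'" "h (F c) \<noteq> 0"
        using z src.orbit_nonempty by (fastforce simp: nonvanishing_def)
      then show ?thesis using h0 z' by blast
    qed
    then have "tgt.D h \<subseteq> image F ` U" by blast
    moreover have "y \<in> tgt.D h" using gh x image_orbit UP by (auto simp: nonvanishing_def)
    ultimately show "\<exists>k. \<exists>h\<in>S' k. y \<in> tgt.D h \<and> tgt.D h \<subseteq> image F ` U" using gh by blast
  qed
qed

lemma image_points: "image F ` P = P'"
  using image_orbit surj_orbits by blast

text \<open>One direction pulls fractions back. For the other, the preimage of \<open>V\<close> is
  saturated, so \<open>descend\<close> turns an equation upstairs into one between sections of the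
  target.\<close>

lemma ratio_on_descend:
  assumes V: "V \<subseteq> P'"
  shows "ratio_on S' V \<phi> \<longleftrightarrow> ratio_on S {x \<in> P. F ` x \<in> V} (\<phi> \<circ> image F)"
proof
  assume "ratio_on S' V \<phi>"
  then show "ratio_on S {x \<in> P. F ` x \<in> V} (\<phi> \<circ> image F)"
    using V by (intro ratio_on_pull_back) auto
next
  assume R: "ratio_on S {x \<in> P. F ` x \<in> V} (\<phi> \<circ> image F)"
  let ?U = "{x \<in> P. F ` x \<in> V}"
  have sat: "saturated_under P (image F) ?U" by (auto simp: saturated_under_def)
  show "ratio_on S' V \<phi>" unfolding ratio_on_def
  proof
    fix y assume y: "y \<in> V"
    then obtain x where x: "x \<in> P" "y = F ` x" using V surj_orbits by blast
    obtain k G H where GH: "G \<in> S k" "H \<in> S k" "\<forall>c\<in>x. H c \<noteq> 0"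
       "\<forall>y\<in>?U. \<forall>c\<in>y. \<phi> (F ` y) * H c = G c"
      using R x y unfolding ratio_on_def by (auto simp: o_def)
    obtain l g h where gh: "g \<in> S' l" "h \<in> S' l" "\<forall>c\<in>x. h (F c) \<noteq> 0"
      and univ: "\<forall>U \<phi>. saturated_under P (image F) U \<longrightarrow> (\<forall>y\<in>U. \<forall>c\<in>y. \<phi> (F ` y) * H c = G c) \<longrightarrow>
               (\<forall>y\<in>U. \<forall>c\<in>y. \<phi> (F ` y) * h (F c) = g (F c))"
    proof -
      from descend[OF x(1) GH(1-3)] show thesis
        by (elim exE bexE conjE) (rule that; assumption)
    qed
    note all = mp[OF mp[OF spec[OF spec[OF univ, of ?U], of \<phi>] sat] GH(4)]
    have "\<phi> z * h c = g c" if z: "z \<in> V" "c \<in> z" for z c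
    proof -
      obtain z' where z': "z' \<in> P" "z = F ` z'" using z V surj_orbits by blast
      then obtain c' where "c' \<in> z'" "c = F c'" using z by blast
      then show ?thesis using all z z' by auto
    qed
    moreover have "\<forall>c\<in>y. h c \<noteq> 0" using gh(3) x by blast
    ultimately show "\<exists>k. \<exists>g\<in>S' k. \<exists>h\<in>S' k. (\<forall>c\<in>y. h c \<noteq> 0) \<and> (\<forall>y\<in>V. \<forall>c\<in>y. \<phi> y * h c = g c)"
      by (intro exI[of _ l] bexI[OF _ gh(1)] bexI[OF _ gh(2)]) blast
  qed
qed

text \<open>Openness gives continuity of the inverse map, and \<open>ratio_on_descend\<close> shows
  that the inverse respects regular functions.\<close>

lemma isomorphism_image:
  assumes inj: "inj_on (image F) P"
  shows "isomorphism src.X tgt.X (image F)"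
proof -
  let ?g = "inv_into P (image F)"
  have gf: "?g (F ` x) = x" if "x \<in> P" for x using inj that by (rule inv_into_f_f)
  have fg: "F ` ?g y = y" and gP: "?g y \<in> P" if "y \<in> P'" for y
    using that image_points by (auto simp: f_inv_into_f inv_into_into)
  have pre: "{y \<in> P'. ?g y \<in> U} = image F ` U" if "U \<subseteq> P" for U
    using that gf fg image_orbit by (auto simp: image_iff subset_iff) metis
  have "continuous_map (zar tgt.X) (zar src.X) ?g"
    unfolding continuous_map
  proof (intro conjI allI impI)
    show "?g ` points tgt.X \<subseteq> points src.X" using gP by auto
    fix U assume U: "openin (zar src.X) U"
    then have "U \<subseteq> P" using openin_subset by fastforce
    then show "openin (zar tgt.X) {x \<in> points tgt.X. ?g x \<in> U}"
      using U open_map_image pre by (simp add: open_map_def)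
  qed
  moreover have "\<phi> \<circ> ?g \<in> reg tgt.X {x \<in> points tgt.X. ?g x \<in> U}"
    if U: "openin (zar src.X) U" "\<phi> \<in> reg src.X U" for U \<phi>
  proof -
    have UP: "U \<subseteq> P" using U openin_subset by fastforce
    have "openin (zar tgt.X) (image F ` U)" using U open_map_image by (simp add: open_map_def)
    moreover have "ratio_on S' (image F ` U) (\<phi> \<circ> ?g)"
    proof (subst ratio_on_descend)
      show "image F ` U \<subseteq> P'" using UP image_orbit by auto
      have "{x \<in> P. F ` x \<in> (`) F ` U} = U" using UP inj by (auto simp: inj_on_def)
      moreover have "ratio_on S U (\<phi> \<circ> ?g \<circ> image F)"
        using U src.reg_iff UP gf ratio_on_cong[of U "\<phi> \<circ> ?g \<circ> image F" \<phi>] by (auto simp: subset_iff)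
      ultimately show "ratio_on S {x \<in> P. F ` x \<in> (`) F ` U} (\<phi> \<circ> ?g \<circ> image F)" by simp
    qed
    ultimately show ?thesis using tgt.reg_iff pre UP by simp
  qed
  ultimately have "morphism tgt.X src.X ?g" unfolding morphism_def by simp
  then show ?thesis
    unfolding isomorphism_def using morphism_image[of "image F"] gf fg
    by (intro conjI exI[of _ ?g]) (simp_all only: src.points_eq tgt.points_eq, blast+)
qed

end

section \<open>Characters of subgroups of the integer lattice\<close>

text \<open>With \<open>powi\<close> a zero coordinate contributes 1 for exponent 0 and 0 for every
  other exponent. Hence additivity in the exponent is available when all coordinates are nonzero or
  all exponents are nonnegative, but not in general.\<close>

definition monom_at :: "complex ^ 'i::finite \<Rightarrow> int ^ 'i \<Rightarrow> complex" where
  "monom_at v a = (\<Prod>i\<in>UNIV. v $ i powi (a $ i))"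

lemma monom_at_0 [simp]: "monom_at v 0 = 1"
  by (simp add: monom_at_def)

lemma monom_at_nonzero: "(\<And>i. v $ i \<noteq> 0) \<Longrightarrow> monom_at v a \<noteq> 0"
  by (simp add: monom_at_def)

lemma monom_at_add: "(\<And>i. v $ i \<noteq> 0) \<Longrightarrow> monom_at v (a + b) = monom_at v a * monom_at v b"
  by (simp add: monom_at_def power_int_add prod.distrib)

lemma monom_at_mult: "monom_at (\<chi> i. u $ i * v $ i) a = monom_at u a * monom_at v a"
  by (simp add: monom_at_def power_int_mult_distrib prod.distrib)

lemma monom_at_nonneg: "(\<And>i. 0 \<le> a $ i) \<Longrightarrow> monom_at v a = (\<Prod>i\<in>UNIV. v $ i ^ nat (a $ i))"
  by (simp add: monom_at_def power_int_def)

lemma monom_at_add_nonneg: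
  assumes "\<And>i. 0 \<le> a $ i" "\<And>i. 0 \<le> b $ i"
  shows "monom_at v (a + b) = monom_at v a * monom_at v b"
  using assms by (simp add: monom_at_nonneg nat_add_distrib power_add prod.distrib)

lemma monom_at_cong:
  assumes "\<And>i. a $ i \<noteq> 0 \<Longrightarrow> u $ i = v $ i"
  shows "monom_at u a = monom_at v a"
  unfolding monom_at_def using assms by (intro prod.cong refl) (metis power_int_0_right)

lemma monom_at_split:
  "monom_at v a = v $ j powi (a $ j) * (\<Prod>i\<in>UNIV - {j}. v $ i powi (a $ i))"
  unfolding monom_at_def by (simp add: prod.remove)

definition int_subgroup :: "(int ^ 'i::finite) set \<Rightarrow> bool" where
  "int_subgroup H \<longleftrightarrow> 0 \<in> H \<and> (\<forall>a\<in>H. \<forall>b\<in>H. a - b \<in> H)"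

definition character_on :: "(int ^ 'i::finite) set \<Rightarrow> (int ^ 'i \<Rightarrow> complex) \<Rightarrow> bool" where
  "character_on H \<eta> \<longleftrightarrow> (\<forall>a\<in>H. \<eta> a \<noteq> 0) \<and> (\<forall>a\<in>H. \<forall>b\<in>H. \<eta> (a + b) = \<eta> a * \<eta> b)"

lemma int_subgroup_add:
  assumes "int_subgroup H" "a \<in> H" "b \<in> H" shows "a + b \<in> H"
proof -
  have "0 - b \<in> H" using assms by (auto simp only: int_subgroup_def)
  then have "a - (0 - b) \<in> H" using assms by (auto simp only: int_subgroup_def)
  then show ?thesis by simp
qed

lemma int_subgroup_diff: "int_subgroup H \<Longrightarrow> a \<in> H \<Longrightarrow> b \<in> H \<Longrightarrow> a - b \<in> H"
  and int_subgroup_zero: "int_subgroup H \<Longrightarrow> 0 \<in> H"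
  by (auto simp: int_subgroup_def)

lemma int_subgroup_scale:
  assumes H: "int_subgroup H" and a: "a \<in> H" shows "n *s a \<in> H"
proof (induction n rule: int_induct[where k = 0])
  case base then show ?case using int_subgroup_zero[OF H] by simp
next
  case (step1 i) then show ?case using int_subgroup_add[OF H _ a, of "i *s a"] by (simp add: vector_sadd_rdistrib)
next
  case (step2 i) then show ?case using int_subgroup_diff[OF H _ a, of "i *s a"]
    by (simp add: vector_sub_rdistrib)
qed

lemma character_on_zero: "character_on H \<eta> \<Longrightarrow> 0 \<in> H \<Longrightarrow> \<eta> 0 = 1"
  unfolding character_on_def by (metis add_0 mult_cancel_right1)

lemma character_on_scale:
  assumes H: "int_subgroup H" and \<eta>: "character_on H \<eta>" and a: "a \<in> H"
  shows "\<eta> (n *s a) = \<eta> a powi n"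
proof (induction n rule: int_induct[where k = 0])
  case base then show ?case using character_on_zero[OF \<eta> int_subgroup_zero[OF H]] by simp
next
  case (step1 i)
  have "\<eta> ((i + 1) *s a) = \<eta> (i *s a) * \<eta> a"
    using \<eta> a int_subgroup_scale[OF H a, of i] by (simp add: character_on_def vector_sadd_rdistrib)
  then show ?case using step1 \<eta> a by (simp add: power_int_add character_on_def)
next
  case (step2 i)
  have "\<eta> ((i - 1) *s a + a) = \<eta> ((i - 1) *s a) * \<eta> a"
    using \<eta> a int_subgroup_scale[OF H a, of "i - 1"] unfolding character_on_def by blast
  moreover have "(i - 1) *s a + a = i *s a" by (simp add: vector_sub_rdistrib)
  ultimately show ?case using step2 \<eta> a by (simp add: power_int_diff character_on_def field_simps)
qed

lemma int_ideal_principal: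
  fixes A :: "int set"
  assumes "0 \<in> A" and diff: "\<And>a b. a \<in> A \<Longrightarrow> b \<in> A \<Longrightarrow> a - b \<in> A"
  shows "\<exists>r\<in>A. \<forall>a\<in>A. r dvd a"
proof (cases "A = {0}")
  case True then show ?thesis by auto
next
  case False
  have neg: "- a \<in> A" if "a \<in> A" for a using diff[OF assms(1) that] by simp
  have add: "a + b \<in> A" if "a \<in> A" "b \<in> A" for a b using diff[OF that(1) neg[OF that(2)]] by simp
  have nmult: "int n * a \<in> A" if "a \<in> A" for n a
    by (induction n) (use assms(1) add that in \<open>auto simp: distrib_right\<close>)
  have mult: "n * a \<in> A" if "a \<in> A" for n a
    using nmult[OF that, of "nat n"] neg[OF nmult[OF that, of "nat (- n)"]] by (cases "n \<ge> 0") auto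
  obtain a where a: "a \<in> A" "a \<noteq> 0" using False assms(1) by blast
  then have ex: "\<exists>n. 0 < n \<and> int n \<in> A"
    using neg[of a] by (intro exI[of _ "nat \<bar>a\<bar>"]) (auto simp: abs_if)
  define r where "r = (LEAST n. 0 < n \<and> int n \<in> A)"
  have r: "0 < r" "int r \<in> A" using LeastI_ex[OF ex] by (auto simp: r_def)
  have "int r dvd b" if b: "b \<in> A" for b
  proof -
    have "b - (b div int r) * int r \<in> A" using b r mult diff by blast
    then have mem: "b mod int r \<in> A" by (simp add: minus_div_mult_eq_mod)
    show ?thesis
    proof (rule ccontr)
      assume "\<not> int r dvd b"
      then have "b mod int r \<noteq> 0" by (simp add: dvd_eq_mod_eq_0)
      moreover have lt: "0 \<le> b mod int r" "b mod int r < int r" using r(1) by simp_all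
      ultimately have "0 < b mod int r" by linarith
      moreover from this have "r \<le> nat (b mod int r)"
        using mem Least_le[of "\<lambda>n. 0 < n \<and> int n \<in> A" "nat (b mod int r)"] by (simp add: r_def[symmetric])
      ultimately show False using lt by linarith
    qed
  qed
  then show ?thesis using r by blast
qed

text \<open>Induction on the coordinates that occur. The \<open>j\<close>-th coordinates of
  \<open>H\<close> form an ideal generated by some \<open>r\<close>, attained at \<open>a0\<close>.
  The vectors with \<open>j\<close>-th coordinate zero are settled by the induction hypothesis,
  which leaves the \<open>j\<close>-th entry of \<open>s\<close> free. Choosing it to give the right
  value at \<open>a0\<close> settles all of \<open>H\<close>, since subtracting a multiple of
  \<open>a0\<close> leads back to coordinate zero.\<close>

lemma character_extends_aux:
  fixes J :: "'i::finite set"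
  assumes "finite J" "int_subgroup H" "\<And>a i. a \<in> H \<Longrightarrow> i \<notin> J \<Longrightarrow> a $ i = 0" "character_on H \<eta>"
  shows "\<exists>s. (\<forall>i. s $ i \<noteq> 0) \<and> (\<forall>a\<in>H. \<eta> a = monom_at s a)"
  using assms
proof (induction J arbitrary: H)
  case empty
  then have "a = 0" if "a \<in> H" for a using that by (simp add: vec_eq_iff)
  then have "\<eta> a = monom_at (\<chi> i. 1) a" if "a \<in> H" for a
    using that character_on_zero[OF empty(3)] int_subgroup_zero[OF empty(1)] by fastforce
  then show ?case by (intro exI[of _ "\<chi> i. 1"]) auto
next
  case (insert j J)
  let ?H' = "{a\<in>H. a $ j = 0}"
  have "int_subgroup ?H'" using insert(4) by (auto simp: int_subgroup_def)
  moreover have "character_on ?H' \<eta>" using insert(6) by (auto simp: character_on_def)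
  moreover have "a $ i = 0" if "a \<in> ?H'" "i \<notin> J" for a i using insert(5)[of a i] that by auto
  ultimately obtain s0 where s0: "\<And>i. s0 $ i \<noteq> 0" "\<And>a. a \<in> ?H' \<Longrightarrow> \<eta> a = monom_at s0 a"
    using insert(3)[of ?H'] by blast
  have "0 \<in> (\<lambda>a. a $ j) ` H" using int_subgroup_zero[OF insert(4)] by force
  moreover have "u - v \<in> (\<lambda>a. a $ j) ` H" if uv: "u \<in> (\<lambda>a. a $ j) ` H" "v \<in> (\<lambda>a. a $ j) ` H" for u v
  proof -
    obtain a b where "a \<in> H" "b \<in> H" "u = a $ j" "v = b $ j" using uv by blast
    then show ?thesis using int_subgroup_diff[OF insert(4), of a b] by (intro image_eqI[of _ _ "a - b"]) auto
  qed
  ultimately obtain r where r: "r \<in> (\<lambda>a. a $ j) ` H" "\<And>u. u \<in> (\<lambda>a. a $ j) ` H \<Longrightarrow> r dvd u"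
    using int_ideal_principal[of "(\<lambda>a. a $ j) ` H"] by blast
  obtain a0 where a0: "a0 \<in> H" "r = a0 $ j" using r(1) by blast
  have dvd: "r dvd a $ j" if "a \<in> H" for a using r(2) that by blast
  show ?case
  proof (cases "r = 0")
    case True
    then have "?H' = H" using dvd by auto
    then show ?thesis using s0 by auto
  next
    case False
    \<comment> \<open>\<open>z\<close> is the value that the \<open>j\<close>-th factor must take at
      \<open>a0\<close>, and \<open>\<rho>\<close> is an \<open>r\<close>-th root of it, available
      because \<open>z\<close> and \<open>r\<close> are nonzero.\<close>
    define z where "z = \<eta> a0 / (\<Prod>i\<in>UNIV - {j}. s0 $ i powi (a0 $ i))"
    define \<rho> where "\<rho> = exp (Ln z / of_int r)"
    have "z \<noteq> 0" using insert(6) a0 s0(1) by (simp add: z_def character_on_def)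
    then have \<rho>: "\<rho> powi r = z" using False by (simp add: \<rho>_def exp_power_int)
    define s where "s = (\<chi> i. if i = j then \<rho> else s0 $ i)"
    have s_nz: "s $ i \<noteq> 0" for i using s0(1) by (simp add: s_def \<rho>_def)
    have s_a0: "monom_at s a0 = \<eta> a0"
    proof -
      have "monom_at s a0 = z * (\<Prod>i\<in>UNIV - {j}. s0 $ i powi (a0 $ i))"
        unfolding monom_at_split[of s a0 j] using \<rho> a0 by (simp add: s_def)
      then show ?thesis using s0(1) by (simp add: z_def)
    qed
    have "\<eta> a = monom_at s a" if a: "a \<in> H" for a
    proof -
      obtain n where n: "a $ j = r * n" using dvd[OF a] by blast
      have b: "n *s a0 \<in> H" using int_subgroup_scale[OF insert(4) a0(1)] .
      have "a - n *s a0 \<in> ?H'" using int_subgroup_diff[OF insert(4) a b] n a0 by simp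
      then have "\<eta> (a - n *s a0) = monom_at s (a - n *s a0)"
        using s0(2)[of "a - n *s a0"] by (auto intro!: monom_at_cong simp: s_def)
      moreover have "\<eta> (n *s a0) = monom_at s (n *s a0)"
      proof -
        have "character_on UNIV (monom_at s)"
          by (simp add: character_on_def monom_at_add monom_at_nonzero s_nz)
        then have "monom_at s (n *s a0) = monom_at s a0 powi n"
          by (intro character_on_scale[of UNIV]) (auto simp: int_subgroup_def)
        then show ?thesis using character_on_scale[OF insert(4,6) a0(1)] s_a0 by simp
      qed
      moreover have "\<eta> (a - n *s a0 + n *s a0) = \<eta> (a - n *s a0) * \<eta> (n *s a0)"
        using insert(6) b int_subgroup_diff[OF insert(4) a b] unfolding character_on_def by blast
      moreover have "monom_at s (a - n *s a0 + n *s a0) = monom_at s (a - n *s a0) * monom_at s (n *s a0)"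
        by (rule monom_at_add) (rule s_nz)
      ultimately show ?thesis by simp
    qed
    then show ?thesis using s_nz by blast
  qed
qed

lemma character_extends:
  assumes "int_subgroup H" "character_on H \<eta>"
  shows "\<exists>s. (\<forall>i. s $ i \<noteq> 0) \<and> (\<forall>a\<in>H. \<eta> a = monom_at s a)"
  using character_extends_aux[of UNIV H \<eta>] assms by auto

text \<open>A character of the sum of the two subgroups is defined as 1 on \<open>\<Lambda>\<close>
  and as \<open>\<eta>\<close> on \<open>B\<close>; triviality of \<open>\<eta>\<close> on the
  intersection makes it well defined. It serves to correct a torus element known only on some
  coordinates to one that is trivial on the exponent group.\<close>

lemma character_extends_trivially:
  assumes \<Lambda>: "int_subgroup \<Lambda>" and B: "int_subgroup B" and \<eta>: "character_on B \<eta>"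
    and triv: "\<And>a. a \<in> \<Lambda> \<Longrightarrow> a \<in> B \<Longrightarrow> \<eta> a = 1"
  shows "\<exists>s. (\<forall>i. s $ i \<noteq> 0) \<and> (\<forall>a\<in>\<Lambda>. monom_at s a = 1) \<and> (\<forall>b\<in>B. monom_at s b = \<eta> b)"
proof -
  let ?H = "{a + b | a b. a \<in> \<Lambda> \<and> b \<in> B}"
  define \<theta> where "\<theta> x = \<eta> (SOME b. b \<in> B \<and> x - b \<in> \<Lambda>)" for x
  have \<theta>: "\<theta> x = \<eta> b" if "b \<in> B" "x - b \<in> \<Lambda>" for x b
  proof -
    let ?b = "SOME b. b \<in> B \<and> x - b \<in> \<Lambda>"
    have b': "?b \<in> B" "x - ?b \<in> \<Lambda>" using someI[of "\<lambda>b. b \<in> B \<and> x - b \<in> \<Lambda>" b] that by auto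
    have "?b - b \<in> B" using int_subgroup_diff[OF B b'(1) that(1)] .
    moreover have "?b - b \<in> \<Lambda>" using int_subgroup_diff[OF \<Lambda> that(2) b'(2)] by simp
    ultimately have "\<eta> (?b - b) = 1" using triv by blast
    moreover have "\<eta> (?b - b + b) = \<eta> (?b - b) * \<eta> b"
      using \<eta> \<open>?b - b \<in> B\<close> that(1) unfolding character_on_def by blast
    ultimately show ?thesis by (simp add: \<theta>_def)
  qed
  have H: "int_subgroup ?H"
    unfolding int_subgroup_def
  proof (intro conjI ballI)
    show "0 \<in> ?H" using int_subgroup_zero[OF \<Lambda>] int_subgroup_zero[OF B]
      by (intro CollectI exI[of _ 0]) simp
    fix x y assume "x \<in> ?H" "y \<in> ?H"
    then obtain a b a' b' where *: "a \<in> \<Lambda>" "b \<in> B" "x = a + b" "a' \<in> \<Lambda>" "b' \<in> B" "y = a' + b'" by blast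
    have "x - y = (a - a') + (b - b')" using * by simp
    then show "x - y \<in> ?H" using int_subgroup_diff[OF \<Lambda> *(1,4)] int_subgroup_diff[OF B *(2,5)] by blast
  qed
  have "character_on ?H \<theta>"
    unfolding character_on_def
  proof (intro conjI ballI)
    fix x assume "x \<in> ?H"
    then obtain a b where x: "a \<in> \<Lambda>" "b \<in> B" "x = a + b" by blast
    have \<theta>x: "\<theta> x = \<eta> b" using x by (intro \<theta>) auto
    then show "\<theta> x \<noteq> 0" using x \<eta> by (simp add: character_on_def)
    fix y assume "y \<in> ?H"
    then obtain a' b' where y: "a' \<in> \<Lambda>" "b' \<in> B" "y = a' + b'" by blast
    have \<theta>y: "\<theta> y = \<eta> b'" using y by (intro \<theta>) auto
    have "x + y - (b + b') = a + a'" using x y by simp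
    then have "\<theta> (x + y) = \<eta> (b + b')"
      using int_subgroup_add[OF B x(2) y(2)] int_subgroup_add[OF \<Lambda> x(1) y(1)] by (intro \<theta>) simp_all
    then show "\<theta> (x + y) = \<theta> x * \<theta> y" using \<theta>x \<theta>y \<eta> x y by (simp add: character_on_def)
  qed
  from character_extends[OF H this]
  obtain s where s: "\<forall>i. s $ i \<noteq> 0" "\<forall>a\<in>?H. \<theta> a = monom_at s a" by (elim exE conjE)
  have "monom_at s a = 1" if "a \<in> \<Lambda>" for a
  proof -
    have "a \<in> ?H" using that int_subgroup_zero[OF B]
      by (intro CollectI exI[of _ a] exI[of _ 0]) simp
    moreover have "\<theta> a = \<eta> 0" using that int_subgroup_zero[OF B] by (intro \<theta>) auto
    ultimately show ?thesis using bspec[OF s(2), of a] character_on_zero[OF \<eta> int_subgroup_zero[OF B]] by simp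
  qed
  moreover have "monom_at s b = \<eta> b" if "b \<in> B" for b
  proof -
    have "b \<in> ?H" using that int_subgroup_zero[OF \<Lambda>]
      by (intro CollectI exI[of _ 0] exI[of _ b]) simp
    moreover have "\<theta> b = \<eta> b" using that int_subgroup_zero[OF \<Lambda>] by (intro \<theta>) auto
    ultimately show ?thesis using bspec[OF s(2), of b] by simp
  qed
  ultimately show ?thesis using s(1) by blast
qed

text \<open>The assumption that \<open>\<Lambda>\<close> meets \<open>\<int>a\<close> makes the order \<open>r\<close> of \<open>a\<close> modulo \<open>\<Lambda>\<close> finite, and \<open>a\<close> is
  sent to a primitive \<open>r\<close>-th root of unity.\<close>

lemma character_separates:
  assumes \<Lambda>: "int_subgroup \<Lambda>" and a: "a \<notin> \<Lambda>" and fin: "N *s a \<in> \<Lambda>" "N \<noteq> 0"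
  shows "\<exists>s. (\<forall>i. s $ i \<noteq> 0) \<and> (\<forall>b\<in>\<Lambda>. monom_at s b = 1) \<and> monom_at s a \<noteq> 1"
proof -
  have "a \<noteq> 0" using a int_subgroup_zero[OF \<Lambda>] by auto
  then obtain j where j: "a $ j \<noteq> 0" by (auto simp: vec_eq_iff)
  let ?A = "{n. n *s a \<in> \<Lambda>}"
  have "0 \<in> ?A" using int_subgroup_zero[OF \<Lambda>] by simp
  moreover have "m - n \<in> ?A" if "m \<in> ?A" "n \<in> ?A" for m n
    using int_subgroup_diff[OF \<Lambda>, of "m *s a" "n *s a"] that by (simp add: vector_sub_rdistrib)
  ultimately obtain r where r: "r \<in> ?A" "\<And>n. n \<in> ?A \<Longrightarrow> r dvd n"
    using int_ideal_principal[of ?A] by blast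
  have r0: "r \<noteq> 0" using r(2)[of N] fin by auto
  have r1: "\<bar>r\<bar> \<noteq> 1"
  proof
    assume "\<bar>r\<bar> = 1"
    then have "r * r = 1" by (metis abs_mult_self_eq mult_1)
    then have "r *s (r *s a) = a" by (simp add: vector_smult_assoc)
    then show False using int_subgroup_scale[OF \<Lambda>, of "r *s a" r] r(1) a by simp
  qed
  define \<omega> where "\<omega> = cis (2 * pi / of_int r)"
  \<comment> \<open>Division by the nonzero coordinate \<open>a $ j\<close> recovers n from n a, so
    \<open>\<eta>\<close> sends n a to the n-th power of \<open>\<omega>\<close>.\<close>
  define \<eta> where "\<eta> x = \<omega> powi (x $ j div a $ j)" for x :: "int ^ 'a"
  let ?B = "range (\<lambda>n. n *s a)"
  have \<eta>: "\<eta> (n *s a) = \<omega> powi n" for n using j by (simp add: \<eta>_def)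
  have \<omega>: "\<omega> \<noteq> 0" by (simp add: \<omega>_def)
  have "int_subgroup ?B"
    unfolding int_subgroup_def by (auto simp flip: vector_sub_rdistrib intro: image_eqI[of _ _ 0])
  moreover have "character_on ?B \<eta>"
    unfolding character_on_def by (auto simp flip: vector_sadd_rdistrib simp: \<eta> \<omega> power_int_add)
  moreover have "\<eta> x = 1" if x: "x \<in> \<Lambda>" "x \<in> ?B" for x
  proof -
    obtain n where n: "x = n *s a" using x by blast
    then obtain k where k: "n = r * k" using r(2)[of n] x by auto
    have "\<omega> powi r = 1" using r0 by (simp add: \<omega>_def Complex.cis_power_int)
    then show ?thesis using n k \<eta> by (simp add: power_int_mult)
  qed
  ultimately obtain s where s: "\<And>i. s $ i \<noteq> 0" "\<And>b. b \<in> \<Lambda> \<Longrightarrow> monom_at s b = 1" "\<And>b. b \<in> ?B \<Longrightarrow> monom_at s b = \<eta> b"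
    using character_extends_trivially[OF \<Lambda>, of ?B \<eta>] by blast
  have "monom_at s a = \<omega>" using s(3)[OF rangeI, of 1] \<eta>[of 1] by simp
  moreover have "\<omega> \<noteq> 1"
  proof
    assume "\<omega> = 1"
    then have "cos (2 * pi / of_int r) = 1" by (simp add: \<omega>_def complex_eq_iff)
    then obtain k :: int where "2 * pi / of_int r = of_int k * 2 * pi" using cos_one_2pi_int by blast
    then have "real_of_int (k * r) = 1" using r0 by (simp add: field_simps)
    then have "k * r = 1" by linarith
    then show False using r1 by (metis abs_mult abs_one zmult_eq_1_iff abs_minus_cancel)
  qed
  ultimately show ?thesis using s(1,2) by blast
qed

text \<open>A nowhere vanishing homomorphism on a monoid extends to its group of differences by
  taking quotients of values, and there \<open>character_extends\<close> applies.\<close>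

lemma monoid_character_extends:
  assumes zero: "0 \<in> T" and add: "\<And>a b. a \<in> T \<Longrightarrow> b \<in> T \<Longrightarrow> a + b \<in> T"
    and \<xi>: "\<And>a. a \<in> T \<Longrightarrow> \<xi> a \<noteq> 0" "\<And>a b. a \<in> T \<Longrightarrow> b \<in> T \<Longrightarrow> \<xi> (a + b) = \<xi> a * \<xi> b"
  shows "\<exists>s. (\<forall>i. s $ i \<noteq> 0) \<and> (\<forall>a\<in>T. \<xi> a = monom_at s a)"
proof -
  let ?H = "{a - b | a b. a \<in> T \<and> b \<in> T}"
  define \<eta> where "\<eta> x = (let (a, b) = (SOME (a, b). a \<in> T \<and> b \<in> T \<and> x = a - b) in \<xi> a / \<xi> b)" for x
  have \<eta>: "\<eta> (a - b) = \<xi> a / \<xi> b" if ab: "a \<in> T" "b \<in> T" for a b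
  proof -
    obtain a' b' where eq: "(SOME (a', b'). a' \<in> T \<and> b' \<in> T \<and> a - b = a' - b') = (a', b')"
      by (cases "SOME (a', b'). a' \<in> T \<and> b' \<in> T \<and> a - b = a' - b'") blast
    have "case (a', b') of (a', b') \<Rightarrow> a' \<in> T \<and> b' \<in> T \<and> a - b = a' - b'"
      unfolding eq[symmetric] by (rule someI[of _ "(a, b)"]) (simp add: ab)
    then have *: "a' \<in> T" "b' \<in> T" "a + b' = a' + b" by (auto simp: algebra_simps)
    have "\<xi> a * \<xi> b' = \<xi> (a + b')" by (rule \<xi>(2)[OF ab(1) *(2), symmetric])
    also have "\<dots> = \<xi> (a' + b)" by (simp only: *(3))
    also have "\<dots> = \<xi> a' * \<xi> b" by (rule \<xi>(2)[OF *(1) ab(2)])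
    finally have "\<xi> a * \<xi> b' = \<xi> a' * \<xi> b" .
    moreover have "\<eta> (a - b) = \<xi> a' / \<xi> b'" unfolding \<eta>_def eq Let_def by simp
    ultimately show ?thesis using \<xi>(1)[OF ab(2)] \<xi>(1)[OF *(2)] by (simp add: frac_eq_eq)
  qed
  have H: "int_subgroup ?H"
    unfolding int_subgroup_def
  proof (intro conjI ballI)
    show "0 \<in> ?H" using zero by (intro CollectI exI[of _ 0]) simp
    fix x y assume "x \<in> ?H" "y \<in> ?H"
    then obtain a b a' b' where "a \<in> T" "b \<in> T" "x = a - b" "a' \<in> T" "b' \<in> T" "y = a' - b'" by blast
    then show "x - y \<in> ?H"
      using add by (intro CollectI exI[of _ "a + b'"] exI[of _ "b + a'"]) simp
  qed
  have "character_on ?H \<eta>"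
    unfolding character_on_def
  proof (intro conjI ballI)
    fix x assume "x \<in> ?H"
    then obtain a b where x: "a \<in> T" "b \<in> T" "x = a - b" by blast
    then show "\<eta> x \<noteq> 0" using \<xi>(1) \<eta> by simp
    fix y assume "y \<in> ?H"
    then obtain a' b' where y: "a' \<in> T" "b' \<in> T" "y = a' - b'" by blast
    have "x + y = (a + a') - (b + b')" using x y by simp
    moreover have "\<eta> ((a + a') - (b + b')) = \<xi> (a + a') / \<xi> (b + b')" using add x y by (intro \<eta>) auto
    ultimately have "\<eta> (x + y) = \<xi> (a + a') / \<xi> (b + b')" by simp
    then show "\<eta> (x + y) = \<eta> x * \<eta> y" using \<eta> \<xi>(2) x y by simp
  qed
  from character_extends[OF H this]
  obtain s where s: "\<forall>i. s $ i \<noteq> 0" "\<forall>a\<in>?H. \<eta> a = monom_at s a" by (elim exE conjE)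
  have "\<xi> a = monom_at s a" if a: "a \<in> T" for a
  proof -
    have "a - 0 \<in> ?H" using a zero by (intro CollectI exI[of _ a] exI[of _ 0]) simp
    then have "\<eta> (a - 0) = monom_at s (a - 0)" using s(2) by blast
    moreover have "\<xi> 0 = 1" using \<xi>(2)[OF zero zero] \<xi>(1)[OF zero] by simp
    ultimately show ?thesis using \<eta>[OF a zero] by simp
  qed
  then show ?thesis using s(1) by blast
qed

section \<open>Forms and toric sections\<close>

lemma exists_poly_mapping:
  assumes "finite A"
  shows "\<exists>F. Poly_Mapping.lookup F = (\<lambda>b. if b \<in> A then g b else (0::'b::zero))"
proof -
  have "finite {b. (if b \<in> A then g b else 0) \<noteq> 0}"
    by (rule finite_subset[OF _ assms]) auto
  then show ?thesis
    by (intro exI[of _ "Abs_poly_mapping (\<lambda>b. if b \<in> A then g b else 0)"]) simp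
qed

lemma sum_fibres:
  fixes g :: "'a \<Rightarrow> complex"
  assumes "finite I"
  shows "(\<Sum>b\<in>m ` I. (\<Sum>i\<in>{i\<in>I. m i = b}. g i) * c b) = (\<Sum>i\<in>I. g i * c (m i))"
proof -
  have "(\<Sum>b\<in>m ` I. (\<Sum>i\<in>{i\<in>I. m i = b}. g i) * c b) = (\<Sum>b\<in>m ` I. \<Sum>i\<in>{i\<in>I. m i = b}. g i * c (m i))"
    by (intro sum.cong refl) (simp add: sum_distrib_right)
  also have "\<dots> = (\<Sum>i\<in>I. g i * c (m i))"
    using assms by (intro sum.group) auto
  finally show ?thesis .
qed

lemma sum_lookup_superset:
  fixes f :: "'a \<Rightarrow>\<^sub>0 complex"
  assumes "finite A" "Poly_Mapping.keys f \<subseteq> A"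
  shows "(\<Sum>m\<in>Poly_Mapping.keys f. Poly_Mapping.lookup f m * c m) = (\<Sum>m\<in>A. Poly_Mapping.lookup f m * c m)"
  using assms by (intro sum.mono_neutral_left) (auto simp: in_keys_iff)

text \<open>The family \<open>m\<close> may repeat lattice points, as happens for products of
  sections; adding the coefficients over each fibre yields a genuine Laurent polynomial.\<close>

lemma toric_sections_sum:
  assumes "finite I" "\<And>i. i \<in> I \<Longrightarrow> (k, m i) \<in> cone_monoid \<Delta> M"
  shows "(\<lambda>\<xi>. \<Sum>i\<in>I. g i * \<xi> (k, m i)) \<in> toric_sections \<Delta> M k"
proof -
  obtain F where F: "Poly_Mapping.lookup F = (\<lambda>b. if b \<in> m ` I then (\<Sum>i\<in>{i\<in>I. m i = b}. g i) else 0)"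
    using exists_poly_mapping[of "m ` I" "\<lambda>b. \<Sum>i\<in>{i\<in>I. m i = b}. g i"] assms(1) by auto
  have keys: "Poly_Mapping.keys F \<subseteq> m ` I" by (auto simp: in_keys_iff F split: if_splits)
  have "section_value F k \<xi> = (\<Sum>i\<in>I. g i * \<xi> (k, m i))" for \<xi>
  proof -
    have "section_value F k \<xi> = (\<Sum>b\<in>m ` I. (\<Sum>i\<in>{i\<in>I. m i = b}. g i) * \<xi> (k, b))"
      unfolding section_value_def using keys assms
      by (subst sum_lookup_superset[of "m ` I"]) (auto simp: F intro!: sum.cong)
    also have "\<dots> = (\<Sum>i\<in>I. g i * \<xi> (k, m i))"
      by (rule sum_fibres[where c = "\<lambda>b. \<xi> (k, b)", OF assms(1)])
    finally show ?thesis .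
  qed
  then have "(\<lambda>\<xi>. \<Sum>i\<in>I. g i * \<xi> (k, m i)) = section_value F k" by auto
  moreover have "\<forall>m\<in>Poly_Mapping.keys F. (k, m) \<in> cone_monoid \<Delta> M" using keys assms by auto
  ultimately show ?thesis unfolding toric_sections_def by blast
qed

lemma toric_sectionsE:
  assumes "h \<in> toric_sections \<Delta> M k"
  obtains A g where "finite A" "\<And>m. m \<in> A \<Longrightarrow> (k, m) \<in> cone_monoid \<Delta> M"
    "h = (\<lambda>\<xi>. \<Sum>m\<in>A. g m * \<xi> (k, m))"
proof -
  obtain f where f: "h = section_value f k" "\<forall>m\<in>Poly_Mapping.keys f. (k, m) \<in> cone_monoid \<Delta> M"
    using assms unfolding toric_sections_def by blast
  show thesis
    by (rule that[of "Poly_Mapping.keys f" "Poly_Mapping.lookup f"])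
       (use f in \<open>auto simp: section_value_def fun_eq_iff\<close>)
qed

section \<open>Weighted homogeneous forms\<close>

definition weighted_degree :: "('i::finite \<Rightarrow> nat) \<Rightarrow> int ^ 'i \<Rightarrow> int" where
  "weighted_degree w a = (\<Sum>i\<in>UNIV. int (w i) * a $ i)"

lemma weighted_degree_add: "weighted_degree w (a + b) = weighted_degree w a + weighted_degree w b"
  by (simp add: weighted_degree_def distrib_left sum.distrib)

lemma weighted_degree_scale: "weighted_degree w (n *s a) = n * weighted_degree w a"
  by (simp add: weighted_degree_def sum_distrib_left mult.left_commute)

lemma weighted_forms_sum:
  fixes a :: "'k \<Rightarrow> int ^ 'i::finite"
  assumes "finite I" "\<And>i j. i \<in> I \<Longrightarrow> 0 \<le> a i $ j" "\<And>i. i \<in> I \<Longrightarrow> weighted_degree w (a i) = int e"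
  shows "(\<lambda>v. \<Sum>i\<in>I. g i * monom_at v (a i)) \<in> weighted_forms w e"
proof -
  define dec where "dec x = Abs_poly_mapping (\<lambda>j. nat (x $ j))" for x :: "int ^ 'i"
  have dec: "Poly_Mapping.lookup (dec x) = (\<lambda>j. nat (x $ j))" for x by (simp add: dec_def)
  let ?m = "\<lambda>i. dec (a i)"
  obtain F where F: "Poly_Mapping.lookup F = (\<lambda>b. if b \<in> ?m ` I then (\<Sum>i\<in>{i\<in>I. ?m i = b}. g i) else 0)"
    using exists_poly_mapping[of "?m ` I" "\<lambda>b. \<Sum>i\<in>{i\<in>I. ?m i = b}. g i"] assms(1) by auto
  have keys: "Poly_Mapping.keys F \<subseteq> ?m ` I" by (auto simp: in_keys_iff F split: if_splits)
  let ?c = "\<lambda>v b. (\<Prod>i\<in>UNIV. v $ i ^ Poly_Mapping.lookup b i)"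
  have "(\<Sum>b\<in>Poly_Mapping.keys F. Poly_Mapping.lookup F b * ?c v b) = (\<Sum>i\<in>I. g i * monom_at v (a i))" for v
  proof -
    have "(\<Sum>b\<in>Poly_Mapping.keys F. Poly_Mapping.lookup F b * ?c v b) = 
      (\<Sum>b\<in>?m ` I. (\<Sum>i\<in>{i\<in>I. ?m i = b}. g i) * ?c v b)"
      using keys assms by (subst sum_lookup_superset[of "?m ` I"]) (auto simp: F intro!: sum.cong)
    also have "\<dots> = (\<Sum>i\<in>I. g i * ?c v (?m i))"
      by (rule sum_fibres[where c = "?c v", OF assms(1)])
    also have "\<dots> = (\<Sum>i\<in>I. g i * monom_at v (a i))"
      using assms(2) by (intro sum.cong refl) (simp add: dec monom_at_nonneg)
    finally show ?thesis .
  qed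
  moreover have "(\<Sum>j\<in>UNIV. w j * Poly_Mapping.lookup b j) = e" if b: "b \<in> Poly_Mapping.keys F" for b
  proof -
    obtain i where i: "i \<in> I" "b = ?m i" using b keys by blast
    have "int (\<Sum>j\<in>UNIV. w j * Poly_Mapping.lookup b j) = weighted_degree w (a i)"
      using assms(2)[OF i(1)] by (simp add: i dec weighted_degree_def)
    then show ?thesis unfolding assms(3)[OF i(1)] by (simp only: of_nat_eq_iff)
  qed
  ultimately show ?thesis unfolding weighted_forms_def by (intro CollectI exI[of _ F]) auto
qed

lemma weighted_formsE:
  assumes "h \<in> weighted_forms w e"
  obtains A g where "finite A" "\<And>a i. a \<in> A \<Longrightarrow> 0 \<le> a $ i" "\<And>a. a \<in> A \<Longrightarrow> weighted_degree w a = int e"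
    "h = (\<lambda>v. \<Sum>a\<in>A. g a * monom_at v a)"
proof -
  obtain F where F: "h = (\<lambda>v. \<Sum>a\<in>Poly_Mapping.keys F.
            Poly_Mapping.lookup F a * (\<Prod>i\<in>UNIV. v $ i ^ Poly_Mapping.lookup a i))"
     "\<forall>a\<in>Poly_Mapping.keys F. (\<Sum>i\<in>UNIV. w i * Poly_Mapping.lookup a i) = e"
    using assms unfolding weighted_forms_def by blast
  define enc where "enc b = (\<chi> i. int (Poly_Mapping.lookup b i))" for b :: "'a \<Rightarrow>\<^sub>0 nat"
  have inj: "inj_on enc B" for B by (auto simp: inj_on_def enc_def vec_eq_iff intro!: poly_mapping_eqI)
  let ?inv = "inv_into (Poly_Mapping.keys F) enc"
  show thesis
  proof (rule that[of "enc ` Poly_Mapping.keys F" "\<lambda>a. Poly_Mapping.lookup F (?inv a)"])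
    show "weighted_degree w a = int e" if "a \<in> enc ` Poly_Mapping.keys F" for a
      using that F(2) by (auto simp: enc_def weighted_degree_def simp flip: of_nat_mult of_nat_sum)
    have "monom_at v (enc b) = (\<Prod>i\<in>UNIV. v $ i ^ Poly_Mapping.lookup b i)" for v b
      by (simp add: monom_at_nonneg enc_def)
    then show "h = (\<lambda>v. \<Sum>a\<in>enc ` Poly_Mapping.keys F. Poly_Mapping.lookup F (?inv a) * monom_at v a)"
      by (simp add: F(1) sum.reindex[OF inj] inv_into_f_f[OF inj] o_def)
  qed (auto simp: enc_def)
qed

lemma monom_at_weights:
  "t \<noteq> 0 \<Longrightarrow> monom_at (\<chi> i. t ^ w i) a = t powi weighted_degree w a"
proof -
  assume t: "t \<noteq> 0"
  have "t powi (\<Sum>i\<in>A. f i) = (\<Prod>i\<in>A. t powi f i)" if "finite A" for A and f :: "'a \<Rightarrow> int"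
    using that by induction (use t in \<open>auto simp: power_int_add\<close>)
  then show ?thesis
    by (simp add: monom_at_def weighted_degree_def power_int_mult flip: power_int_of_nat)
qed

lemma monom_at_weighted_scale:
  assumes "t \<noteq> 0"
  shows "monom_at (\<chi> i. t ^ w i * v $ i) a = t powi weighted_degree w a * monom_at v a"
  using monom_at_mult[of "\<chi> i. t ^ w i" v a] monom_at_weights[OF assms, of w a] by simp

lemma weighted_orbit_refl: "v \<in> weighted_orbit w v"
  unfolding weighted_orbit_def by (intro CollectI exI[of _ 1]) (simp add: vec_eq_iff)

lemma weighted_orbit_scale:
  assumes "v' \<in> weighted_orbit w v"
  obtains t where "t \<noteq> 0" "v' = (\<chi> i. t ^ w i * v $ i)"
  using assms unfolding weighted_orbit_def by blast

lemma weighted_orbit_eq: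
  assumes "v' \<in> weighted_orbit w v" shows "weighted_orbit w v' = weighted_orbit w v"
proof -
  obtain t where t: "t \<noteq> 0" "v' = (\<chi> i. t ^ w i * v $ i)" using assms by (rule weighted_orbit_scale)
  show ?thesis unfolding weighted_orbit_def
  proof (intro equalityI subsetI)
    fix u assume "u \<in> {\<chi> i. c ^ w i * v' $ i |c. c \<noteq> 0}"
    then obtain c where "c \<noteq> 0" "u = (\<chi> i. c ^ w i * v' $ i)" by blast
    then show "u \<in> {\<chi> i. c ^ w i * v $ i |c. c \<noteq> 0}"
      using t by (intro CollectI exI[of _ "c * t"]) (simp add: vec_eq_iff power_mult_distrib)
  next
    fix u assume "u \<in> {\<chi> i. c ^ w i * v $ i |c. c \<noteq> 0}"
    then obtain c where "c \<noteq> 0" "u = (\<chi> i. c ^ w i * v $ i)" by blast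
    then show "u \<in> {\<chi> i. c ^ w i * v' $ i |c. c \<noteq> 0}"
      using t by (intro CollectI exI[of _ "c / t"]) (simp add: vec_eq_iff power_divide)
  qed
qed

lemma graded_cone_weighted:
  fixes w :: "'i::finite \<Rightarrow> nat"
  assumes w: "\<And>i. w i > 0"
  shows "graded_cone (weighted_orbit w ` (UNIV - {0})) (weighted_forms w)"
proof
  fix x assume "x \<in> weighted_orbit w ` (UNIV - {0})"
  then obtain v where v: "v \<noteq> 0" "x = weighted_orbit w v" by blast
  then show "x \<noteq> {}" using weighted_orbit_refl by blast
  have scale: "h (\<chi> i. t ^ w i * c $ i) = t ^ k * h c" if t: "t \<noteq> 0" and h: "h \<in> weighted_forms w k" for t h k c
  proof -
    obtain A g where A: "finite A" "\<And>a. a \<in> A \<Longrightarrow> weighted_degree w a = int k"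
      "h = (\<lambda>v. \<Sum>a\<in>A. g a * monom_at v a)" using weighted_formsE[OF h] by metis
    then show ?thesis
      using t by (simp add: monom_at_weighted_scale sum_distrib_left mult.left_commute)
  qed
  {
    fix c c' assume c: "c \<in> x" "c' \<in> x"
    then have "c' \<in> weighted_orbit w c" using weighted_orbit_eq v by blast
    then obtain t where "t \<noteq> 0" "c' = (\<chi> i. t ^ w i * c $ i)" by (rule weighted_orbit_scale)
    then show "\<exists>u. u \<noteq> 0 \<and> (\<forall>k. \<forall>h\<in>weighted_forms w k. h c' = u ^ k * h c)" using scale by blast
  }
  obtain i where i: "v $ i \<noteq> 0" using v by (auto simp: vec_eq_iff)
  have eq: "monom_at u (axis i 1) = u $ i" for u
    by (subst monom_at_split[of _ _ i]) (simp add: axis_def)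
  \<comment> \<open>The \<open>i\<close>-th coordinate is itself a form, of degree
    \<open>w i\<close>, and it vanishes nowhere on the orbit of a vector whose \<open>i\<close>-th
    entry is nonzero.\<close>
  have "(\<lambda>u. \<Sum>j\<in>{i}. 1 * monom_at u (axis j 1)) \<in> weighted_forms w (w i)"
    by (rule weighted_forms_sum) (auto simp: axis_def weighted_degree_def if_distrib cong: if_cong)
  then have "(\<lambda>u. u $ i) \<in> weighted_forms w (w i)" by (simp add: eq)
  moreover have "c $ i \<noteq> 0" if "c \<in> x" for c
    using that v(2) i by (auto simp: weighted_orbit_def)
  ultimately show "\<exists>k. \<exists>h\<in>weighted_forms w k. \<forall>c\<in>x. h c \<noteq> 0"
    by (intro exI[of _ "w i"] bexI[of _ "\<lambda>u. u $ i"]) auto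
next
  fix g h k l assume gh: "g \<in> weighted_forms w k" "h \<in> weighted_forms w l"
  obtain A f where A: "finite A" "\<And>a i. a \<in> A \<Longrightarrow> 0 \<le> a $ i" "\<And>a. a \<in> A \<Longrightarrow> weighted_degree w a = int k"
    "g = (\<lambda>v. \<Sum>a\<in>A. f a * monom_at v a)" using weighted_formsE[OF gh(1)] by metis
  obtain B f' where B: "finite B" "\<And>a i. a \<in> B \<Longrightarrow> 0 \<le> a $ i" "\<And>a. a \<in> B \<Longrightarrow> weighted_degree w a = int l"
    "h = (\<lambda>v. \<Sum>a\<in>B. f' a * monom_at v a)" using weighted_formsE[OF gh(2)] by metis
  have "(\<lambda>v. \<Sum>z\<in>A \<times> B. (f (fst z) * f' (snd z)) * monom_at v (fst z + snd z)) \<in> weighted_forms w (k + l)"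
    using A B by (intro weighted_forms_sum) (auto simp: weighted_degree_add)
  moreover have "(\<Sum>z\<in>A \<times> B. (f (fst z) * f' (snd z)) * monom_at v (fst z + snd z)) = g v * h v" for v
  proof -
    have "(\<Sum>z\<in>A \<times> B. (f (fst z) * f' (snd z)) * monom_at v (fst z + snd z)) =
      (\<Sum>z\<in>A \<times> B. (f (fst z) * monom_at v (fst z)) * (f' (snd z) * monom_at v (snd z)))"
      using A B by (intro sum.cong refl) (auto simp: monom_at_add_nonneg)
    also have "\<dots> = g v * h v"
      by (simp add: A(4) B(4) sum_product sum.cartesian_product case_prod_unfold)
    finally show ?thesis .
  qed
  ultimately show "\<exists>f\<in>weighted_forms w (k + l). \<forall>x\<in>weighted_orbit w ` (UNIV - {0}). \<forall>c\<in>x. f c = g c * h c"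
    by (intro bexI) auto
next
  fix k show "(\<lambda>_. 0) \<in> weighted_forms w k"
    using weighted_forms_sum[of "{}"] by simp
qed

section \<open>Toric cones and their sections\<close>

lemma scaling_orbit_refl: "\<xi> \<in> scaling_orbit \<xi>"
  unfolding scaling_orbit_def by (intro CollectI exI[of _ 1]) auto

lemma scaling_orbit_eq:
  assumes "\<eta> \<in> scaling_orbit \<xi>" shows "scaling_orbit \<eta> = scaling_orbit \<xi>"
proof -
  obtain t where t: "t \<noteq> 0" "\<eta> = (\<lambda>(k, m). t ^ k * \<xi> (k, m))" using assms unfolding scaling_orbit_def by blast
  show ?thesis unfolding scaling_orbit_def
  proof (intro equalityI subsetI)
    fix u assume "u \<in> {\<lambda>(k, m). c ^ k * \<eta> (k, m) |c. c \<noteq> 0}"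
    then obtain c where "c \<noteq> 0" "u = (\<lambda>(k, m). c ^ k * \<eta> (k, m))" by blast
    then show "u \<in> {\<lambda>(k, m). c ^ k * \<xi> (k, m) |c. c \<noteq> 0}"
      using t by (intro CollectI exI[of _ "c * t"]) (auto simp: fun_eq_iff power_mult_distrib)
  next
    fix u assume "u \<in> {\<lambda>(k, m). c ^ k * \<xi> (k, m) |c. c \<noteq> 0}"
    then obtain c where "c \<noteq> 0" "u = (\<lambda>(k, m). c ^ k * \<xi> (k, m))" by blast
    then show "u \<in> {\<lambda>(k, m). c ^ k * \<eta> (k, m) |c. c \<noteq> 0}"
      using t by (intro CollectI exI[of _ "c / t"]) (auto simp: fun_eq_iff power_divide)
  qed
qed

lemma cone_points_scale:
  assumes "\<xi> \<in> cone_points \<Delta> M" "t \<noteq> 0"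
  shows "(\<lambda>(k, m). t ^ k * \<xi> (k, m)) \<in> cone_points \<Delta> M"
  using assms unfolding cone_points_def by (auto simp: power_add)

lemma cone_point_of_orbit:
  assumes "x \<in> scaling_orbit ` cone_points \<Delta> M" "\<xi> \<in> x"
  shows "\<xi> \<in> cone_points \<Delta> M" "x = scaling_orbit \<xi>"
proof -
  obtain \<eta> where \<eta>: "\<eta> \<in> cone_points \<Delta> M" "x = scaling_orbit \<eta>" using assms by blast
  then show "x = scaling_orbit \<xi>" using scaling_orbit_eq assms by blast
  obtain t where "t \<noteq> 0" "\<xi> = (\<lambda>(k, m). t ^ k * \<eta> (k, m))"
    using assms(2) \<eta>(2) unfolding scaling_orbit_def by blast
  then show "\<xi> \<in> cone_points \<Delta> M" using cone_points_scale[OF \<eta>(1)] by simp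
qed

lemma cone_points_mult:
  assumes "\<xi> \<in> cone_points \<Delta> M" "(k, m) \<in> cone_monoid \<Delta> M" "(k', m') \<in> cone_monoid \<Delta> M"
  shows "\<xi> (k + k', m + m') = \<xi> (k, m) * \<xi> (k', m')"
  using assms unfolding cone_points_def by fast

lemma graded_cone_toric:
  assumes add: "\<And>k m k' m'. (k, m) \<in> cone_monoid \<Delta> M \<Longrightarrow> (k', m') \<in> cone_monoid \<Delta> M \<Longrightarrow>
    (k + k', m + m') \<in> cone_monoid \<Delta> M"
  shows "graded_cone (scaling_orbit ` cone_points \<Delta> M) (toric_sections \<Delta> M)"
proof
  fix x assume x: "x \<in> scaling_orbit ` cone_points \<Delta> M"
  then show "x \<noteq> {}" using scaling_orbit_refl by blast
  have scale: "h (\<lambda>(k, m). t ^ k * \<xi> (k, m)) = t ^ k * h \<xi>" if h: "h \<in> toric_sections \<Delta> M k" for t h k \<xi>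
  proof -
    obtain A g where A: "h = (\<lambda>\<xi>. \<Sum>m\<in>A. g m * \<xi> (k, m))" using toric_sectionsE[OF h] by metis
    then show ?thesis by (simp add: sum_distrib_left mult.left_commute)
  qed
  {
    fix c c' assume c: "c \<in> x" "c' \<in> x"
    then have "c' \<in> scaling_orbit c" using cone_point_of_orbit(2)[OF x] by blast
    then obtain t where "t \<noteq> 0" "c' = (\<lambda>(k, m). t ^ k * c (k, m))" unfolding scaling_orbit_def by blast
    then show "\<exists>u. u \<noteq> 0 \<and> (\<forall>k. \<forall>h\<in>toric_sections \<Delta> M k. h c' = u ^ k * h c)" using scale by blast
  }
  obtain \<xi> where \<xi>: "\<xi> \<in> cone_points \<Delta> M" "x = scaling_orbit \<xi>" using x by blast
  obtain k m where km: "(k, m) \<in> cone_monoid \<Delta> M" "\<xi> (k, m) \<noteq> 0"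
    using \<xi>(1) unfolding cone_points_def by blast
  have "(\<lambda>\<xi>. \<Sum>j\<in>{m}. 1 * \<xi> (k, j)) \<in> toric_sections \<Delta> M k"
    using km by (intro toric_sections_sum) auto
  then have "(\<lambda>\<xi>. \<xi> (k, m)) \<in> toric_sections \<Delta> M k" by simp
  moreover have "\<forall>c\<in>x. c (k, m) \<noteq> 0" using km \<xi>(2) by (auto simp: scaling_orbit_def)
  ultimately show "\<exists>k. \<exists>h\<in>toric_sections \<Delta> M k. \<forall>c\<in>x. h c \<noteq> 0"
    by (intro exI[of _ k] bexI[of _ "\<lambda>\<xi>. \<xi> (k, m)"])
next
  fix g h k l assume gh: "g \<in> toric_sections \<Delta> M k" "h \<in> toric_sections \<Delta> M l"
  obtain A f where A: "finite A" "\<And>m. m \<in> A \<Longrightarrow> (k, m) \<in> cone_monoid \<Delta> M"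
    "g = (\<lambda>\<xi>. \<Sum>m\<in>A. f m * \<xi> (k, m))" using toric_sectionsE[OF gh(1)] by metis
  obtain B f' where B: "finite B" "\<And>m. m \<in> B \<Longrightarrow> (l, m) \<in> cone_monoid \<Delta> M"
    "h = (\<lambda>\<xi>. \<Sum>m\<in>B. f' m * \<xi> (l, m))" using toric_sectionsE[OF gh(2)] by metis
  have "(\<lambda>\<xi>. \<Sum>z\<in>A \<times> B. (f (fst z) * f' (snd z)) * \<xi> (k + l, fst z + snd z)) \<in> toric_sections \<Delta> M (k + l)"
    using A B add by (intro toric_sections_sum) auto
  note sum_section = this
  \<comment> \<open>Multiplicativity of \<xi> is available only at cone points, which is why the
    product of two sections is compared on the cone alone.\<close>
  have product: "(\<Sum>z\<in>A \<times> B. (f (fst z) * f' (snd z)) * \<xi> (k + l, fst z + snd z)) = g \<xi> * h \<xi>"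
    if \<xi>: "\<xi> \<in> cone_points \<Delta> M" for \<xi>
  proof -
    have "(\<Sum>z\<in>A \<times> B. (f (fst z) * f' (snd z)) * \<xi> (k + l, fst z + snd z)) =
      (\<Sum>z\<in>A \<times> B. (f (fst z) * \<xi> (k, fst z)) * (f' (snd z) * \<xi> (l, snd z)))"
      using A B by (intro sum.cong refl) (auto simp: cone_points_mult[OF \<xi>])
    also have "\<dots> = g \<xi> * h \<xi>"
      by (simp add: A(3) B(3) sum_product sum.cartesian_product case_prod_unfold)
    finally show ?thesis .
  qed
  show "\<exists>f\<in>toric_sections \<Delta> M (k + l). \<forall>x\<in>scaling_orbit ` cone_points \<Delta> M. \<forall>c\<in>x. f c = g c * h c"
    by (intro bexI[OF _ sum_section] ballI product cone_point_of_orbit(1))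
next
  fix k show "(\<lambda>_. 0) \<in> toric_sections \<Delta> M k"
    using toric_sections_sum[of "{}"] by simp
qed

section \<open>Simplices and Cox coordinates\<close>

lemma Lcm_range_pos:
  fixes d :: "'i::finite \<Rightarrow> nat"
  assumes "\<And>i. d i > 0" shows "Lcm (range d) > 0"
proof -
  have "Lcm (range d) \<noteq> 0" using assms by (subst Lcm_0_iff) (auto, metis less_numeral_extra(3))
  then show ?thesis unfolding neq0_conv .
qed

lemma fermat_weights_mult: "fermat_weights d i * d i = Lcm (range d)"
  by (simp add: fermat_weights_def)

lemma cone_pointsI:
  assumes "\<And>k m. (k, m) \<notin> cone_monoid \<Delta> M \<Longrightarrow> \<xi> (k, m) = 0" "\<xi> (0, 0) = 1"
    "\<And>k m k' m'. (k, m) \<in> cone_monoid \<Delta> M \<Longrightarrow> (k', m') \<in> cone_monoid \<Delta> M \<Longrightarrow>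
      \<xi> (k + k', m + m') = \<xi> (k, m) * \<xi> (k', m')"
    "(l, x) \<in> cone_monoid \<Delta> M" "l > 0" "\<xi> (l, x) \<noteq> 0"
  shows "\<xi> \<in> cone_points \<Delta> M"
proof -
  have "\<forall>a. a \<notin> cone_monoid \<Delta> M \<longrightarrow> \<xi> a = 0" using assms(1) by auto
  moreover have "\<forall>(k, m) \<in> cone_monoid \<Delta> M. \<forall>(k', m') \<in> cone_monoid \<Delta> M.
      \<xi> (k + k', m + m') = \<xi> (k, m) * \<xi> (k', m')" using assms(3) by auto
  moreover have "\<exists>(k, m) \<in> cone_monoid \<Delta> M. k > 0 \<and> \<xi> (k, m) \<noteq> 0"
    using assms(4-6) by (intro bexI[of _ "(l, x)"]) auto
  ultimately show ?thesis unfolding cone_points_def using assms(2) by (intro CollectI conjI)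
qed

text \<open>Data shared by Delta(w) in M(w), with the coordinates as facet forms, and by the
  reflexive simplex in \<open>M\<close>, with the pairings against the vertices of its dual. The
  forms \<open>lam\<close> stay abstract because a coordinate is the pairing with a unit vector,
  which lies outside the span of M(w). By \<open>lam_vertex\<close>, the vertex \<open>p i\<close>
  lies on all facets but the \<open>i\<close>-th.\<close>

locale toric_simplex =
  fixes d :: "'i::finite \<Rightarrow> nat" and \<Delta> M :: "'v::euclidean_space set"
    and lam :: "'i \<Rightarrow> 'v \<Rightarrow> real" and p :: "'i \<Rightarrow> 'v"
  assumes d_pos: "\<And>i. d i > 0" and d_sum: "(\<Sum>i\<in>UNIV. 1 / real (d i)) = 1"
    and lattice_zero: "0 \<in> M" and lattice_diff: "\<And>x y. x \<in> M \<Longrightarrow> y \<in> M \<Longrightarrow> x - y \<in> M"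
    and lam_linear: "\<And>i. linear (lam i)"
    and lam_int: "\<And>i x. x \<in> M \<Longrightarrow> lam i x \<in> \<int>"
    and vertex_in: "\<And>i. p i \<in> M"
    and lam_vertex: "\<And>i j. lam j (p i) = (if i = j then real (d i) else 0) - 1"
    and lam_weights: "\<And>x. x \<in> span M \<Longrightarrow> (\<Sum>i\<in>UNIV. lam i x / real (d i)) = 0"
    and lam_inj: "\<And>x. x \<in> span M \<Longrightarrow> (\<And>i. lam i x = 0) \<Longrightarrow> x = 0"
    and polytope_eq: "\<Delta> = {x \<in> span M. \<forall>i. lam i x \<ge> -1}"
begin

definition L :: nat where "L = Lcm (range d)"
abbreviation w :: "'i \<Rightarrow> nat" where "w \<equiv> fermat_weights d"

lemma L_pos: "L > 0"
  unfolding L_def by (rule Lcm_range_pos[OF d_pos])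

lemma w_mult_d: "w i * d i = L"
  by (simp add: L_def fermat_weights_mult)

lemma real_w: "real (w i) = real L / real (d i)"
  using w_mult_d[of i] d_pos[of i] by (simp add: field_simps flip: of_nat_mult)

lemma w_pos: "w i > 0"
  using w_mult_d[of i] L_pos by (cases "w i") auto

text \<open>The condition on the sum of the 1/d_i makes the product of all coordinates a form of
  weighted degree L.\<close>

lemma sum_w: "(\<Sum>i\<in>UNIV. w i) = L"
proof -
  have "real (\<Sum>i\<in>UNIV. w i) = real L * (\<Sum>i\<in>UNIV. 1 / real (d i))"
    by (simp add: real_w sum_distrib_left)
  then have "real (\<Sum>i\<in>UNIV. w i) = real L" by (simp only: d_sum mult_1_right)
  then show ?thesis by (simp only: of_nat_eq_iff)
qed

lemma sum_w_lam: "x \<in> span M \<Longrightarrow> (\<Sum>i\<in>UNIV. real (w i) * lam i x) = 0"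
  using lam_weights[of x] by (simp add: real_w flip: sum_distrib_left times_divide_eq_right)

lemma lattice_add: "x \<in> M \<Longrightarrow> y \<in> M \<Longrightarrow> x + y \<in> M"
  using lattice_diff[of x "0 - y"] lattice_diff[of 0 y] lattice_zero by simp

lemma lattice_scale: "x \<in> M \<Longrightarrow> of_int n *\<^sub>R x \<in> M"
proof (induction n rule: int_induct[where k = 0])
  case base then show ?case using lattice_zero by simp
next
  case (step1 i) then show ?case using lattice_add[of "of_int i *\<^sub>R x" x] by (simp add: scaleR_left_distrib)
next
  case (step2 i) then show ?case using lattice_diff[of "of_int i *\<^sub>R x" x] by (simp add: scaleR_left_diff_distrib)
qed

lemma lattice_sum: "(\<And>i. i \<in> A \<Longrightarrow> f i \<in> M) \<Longrightarrow> sum f A \<in> M"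
  by (induction A rule: infinite_finite_induct) (auto simp: lattice_zero lattice_add)

lemmas lam_simps = linear_add[OF lam_linear] linear_diff[OF lam_linear] linear_scale[OF lam_linear]
  linear_0[OF lam_linear] linear_sum[OF lam_linear]

text \<open>The exponent vector of the Cox monomial belonging to \<open>(k, m)\<close>.\<close>

definition expo :: "int \<Rightarrow> 'v \<Rightarrow> int ^ 'i" where
  "expo k m = (\<chi> i. \<lfloor>lam i m\<rfloor> + k)"

lemma expo_nth: "m \<in> M \<Longrightarrow> of_int (expo k m $ i) = lam i m + of_int k"
  using lam_int[of m i] by (simp add: expo_def)

lemma expo_eqI:
  assumes "m \<in> M" "\<And>i. lam i m + of_int k = of_int (a $ i)" shows "expo k m = a"
  using expo_nth[OF assms(1), of k] assms(2) by (simp add: vec_eq_iff)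

lemma expo_diff: "m \<in> M \<Longrightarrow> m' \<in> M \<Longrightarrow> expo k m - expo k' m' = expo (k - k') (m - m')"
  by (rule expo_eqI[symmetric]) (simp_all add: lattice_diff expo_nth lam_simps)

lemma expo_add: "m \<in> M \<Longrightarrow> m' \<in> M \<Longrightarrow> expo k m + expo k' m' = expo (k + k') (m + m')"
  by (rule expo_eqI[symmetric]) (simp_all add: lattice_add expo_nth lam_simps)

lemma expo_zero [simp]: "expo 0 0 = 0"
  by (rule expo_eqI) (simp_all add: lattice_zero lam_simps)

lemma expo_vertex: "expo 1 (p i) = axis i (int (d i))"
  by (rule expo_eqI) (auto simp: vertex_in lam_vertex axis_def)

text \<open>The values \<open>lam i m\<close> contribute nothing, because their weighted sum is zero
  on the span; only the shift by \<open>k\<close> in every coordinate counts, with total weight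
  L.\<close>

lemma degree_expo:
  assumes "m \<in> M" shows "weighted_degree w (expo k m) = k * int L"
proof -
  have "real_of_int (weighted_degree w (expo k m)) = (\<Sum>i\<in>UNIV. real (w i) * lam i m) + of_int k * real L"
    unfolding sum_w[symmetric]
    by (simp add: weighted_degree_def expo_nth assms sum.distrib distrib_left sum_distrib_left mult.commute)
  also have "\<dots> = real_of_int (k * int L)" using sum_w_lam[OF span_base[OF assms]] by simp
  finally show ?thesis by linarith
qed

lemma expo_inj:
  assumes "m \<in> M" "m' \<in> M" "expo k m = expo k' m'"
  shows "k = k' \<and> m = m'"
proof -
  have k: "k = k'" using degree_expo[OF assms(1), of k] degree_expo[OF assms(2), of k'] assms(3) L_pos by simp
  have "lam i (m - m') = 0" for i
    using expo_nth[OF assms(1), of k i] expo_nth[OF assms(2), of k i] assms(3) k by (simp add: lam_simps)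
  then show ?thesis using k lam_inj[of "m - m'"] span_base[OF lattice_diff[OF assms(1,2)]] by simp
qed

text \<open>Image of the direct sum of the integers and \<open>M\<close> in the integer vectors. The
  finite quotient by this subgroup is dual to the group \<open>deck\<close> introduced
  below.\<close>

definition exponents :: "(int ^ 'i) set" where
  "exponents = {expo k m | k m. m \<in> M}"

lemma expo_in: "m \<in> M \<Longrightarrow> expo k m \<in> exponents"
  unfolding exponents_def by blast

lemma exponents_subgroup: "int_subgroup exponents"
  unfolding int_subgroup_def
proof (intro conjI ballI)
  show "0 \<in> exponents" using expo_in[OF lattice_zero, of 0] by simp
  fix a b assume "a \<in> exponents" "b \<in> exponents"
  then obtain k m k' m' where "a = expo k m" "b = expo k' m'" "m \<in> M" "m' \<in> M"
    unfolding exponents_def by blast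
  then show "a - b \<in> exponents" using expo_diff expo_in lattice_diff by metis
qed

lemma int_vertex_sum: "(\<Sum>i\<in>UNIV. of_int (int (w i) * a $ i) *\<^sub>R p i) \<in> M"
  by (intro lattice_sum lattice_scale vertex_in)

lemma lam_vertex_sum:
  "lam j (\<Sum>i\<in>UNIV. c i *\<^sub>R p i) = c j * real (d j) - (\<Sum>i\<in>UNIV. c i)"
proof -
  have "lam j (\<Sum>i\<in>UNIV. c i *\<^sub>R p i) = (\<Sum>i\<in>UNIV. (if i = j then c i * real (d i) else 0) - c i)"
    unfolding lam_simps lam_vertex by (intro sum.cong refl) (simp add: algebra_simps)
  then show ?thesis by (simp add: sum_subtractf)
qed

text \<open>The vertices realise L a: the \<open>j\<close>-th form of the combination with
  coefficients w_i a_i is w_j a_j d_j minus the weighted degree of \<open>a\<close>, and w_j d_j =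
  L.\<close>

lemma scaled_expo: "int L *s a = expo (weighted_degree w a) (\<Sum>i\<in>UNIV. of_int (int (w i) * a $ i) *\<^sub>R p i)"
proof (rule expo_eqI[symmetric, OF int_vertex_sum])
  fix j
  have "real (w j) * real (d j) = real L" using w_mult_d[of j] by (metis of_nat_mult)
  then have "real (w j) * of_int (a $ j) * real (d j) = real L * of_int (a $ j)" by (simp add: mult_ac)
  then show "lam j (\<Sum>i\<in>UNIV. of_int (int (w i) * a $ i) *\<^sub>R p i) + of_int (weighted_degree w a) =
      of_int ((int L *s a) $ j)"
    by (simp add: lam_vertex_sum weighted_degree_def)
qed

lemma scaled_in: "int L *s a \<in> exponents"
  unfolding scaled_expo by (rule expo_in[OF int_vertex_sum])

lemma polytope_iff: "x \<in> \<Delta> \<longleftrightarrow> x \<in> span M \<and> (\<forall>i. lam i x \<ge> -1)"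
  unfolding polytope_eq by simp

lemma cone_iff: "(k, m) \<in> cone_monoid \<Delta> M \<longleftrightarrow> m \<in> M \<and> (\<forall>i. 0 \<le> lam i m + real k)"
proof (cases "m \<in> M")
  case m: True
  show ?thesis
  proof (cases "k = 0")
    case True
    have "0 \<in> \<Delta>" by (simp add: polytope_iff span_zero lam_simps)
    then have "(k, m) \<in> cone_monoid \<Delta> M \<longleftrightarrow> m = 0" using True m by (auto simp: cone_monoid_def)
    \<comment> \<open>In degree 0 the cone is trivial: nonnegative values \<open>lam i m\<close>
      whose sum with positive weights is zero must all vanish.\<close>
    moreover have "m = 0" if nn: "\<forall>i. 0 \<le> lam i m"
    proof (rule lam_inj[OF span_base[OF m]])
      fix i
      have "\<forall>i\<in>UNIV. lam i m / real (d i) = 0"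
        using lam_weights[OF span_base[OF m]] nn by (subst (asm) sum_nonneg_eq_0_iff) auto
      then show "lam i m = 0" using d_pos[of i] by auto
    qed
    ultimately show ?thesis using m True by (auto simp: lam_simps)
  next
    case False
    then have "m \<in> (\<lambda>x. real k *\<^sub>R x) ` \<Delta> \<longleftrightarrow> (1 / real k) *\<^sub>R m \<in> \<Delta>"
      by (auto simp: image_iff intro!: bexI[of _ "(1 / real k) *\<^sub>R m"])
    also have "\<dots> \<longleftrightarrow> (\<forall>i. 0 \<le> lam i m + real k)"
    proof -
      have "-1 \<le> lam i ((1 / real k) *\<^sub>R m) \<longleftrightarrow> 0 \<le> lam i m + real k" for i
        using False by (auto simp: lam_simps field_simps)
      then show ?thesis using m by (simp only: polytope_iff) (simp add: span_scale span_base)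
    qed
    finally show ?thesis using m by (simp add: cone_monoid_def)
  qed
qed (simp add: cone_monoid_def)

lemma cone_in: "(k, m) \<in> cone_monoid \<Delta> M \<Longrightarrow> m \<in> M"
  by (simp add: cone_iff)

lemma cone_expo_nonneg: "(k, m) \<in> cone_monoid \<Delta> M \<Longrightarrow> 0 \<le> expo (int k) m $ i"
  using expo_nth[of m "int k" i] by (simp add: cone_iff) (metis of_int_0_le_iff)

text \<open>Nonnegative entries give a nonnegative weighted degree k L, which forces
  \<open>k\<close> to be nonnegative.\<close>

lemma cone_of_exponents:
  assumes "a \<in> exponents" "\<And>i. 0 \<le> a $ i"
  obtains k m where "(k, m) \<in> cone_monoid \<Delta> M" "a = expo (int k) m"
proof -
  obtain k m where km: "a = expo k m" "m \<in> M" using assms(1) unfolding exponents_def by blast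
  have "0 \<le> weighted_degree w a" unfolding weighted_degree_def using assms(2) by (simp add: sum_nonneg)
  then have "0 \<le> k * int L" using degree_expo[OF km(2)] km by simp
  then have k: "0 \<le> k" using L_pos by (simp add: zero_le_mult_iff)
  have "0 \<le> lam i m + real (nat k)" for i
    using assms(2)[of i] expo_nth[OF km(2), of k i] k km(1) by (metis of_int_0_le_iff of_nat_nat)
  then show thesis using km k by (intro that[of "nat k" m]) (auto simp: cone_iff)
qed

lemma cone_add:
  assumes "(k, m) \<in> cone_monoid \<Delta> M" "(k', m') \<in> cone_monoid \<Delta> M"
  shows "(k + k', m + m') \<in> cone_monoid \<Delta> M"
proof -
  have "0 \<le> lam i (m + m') + real (k + k')" for i
  proof -
    have "0 \<le> lam i m + real k" "0 \<le> lam i m' + real k'" using assms by (auto simp: cone_iff)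
    then show ?thesis by (simp add: lam_simps)
  qed
  then show ?thesis using assms by (auto simp: cone_iff lattice_add)
qed

lemma cone_zero: "(0, 0) \<in> cone_monoid \<Delta> M"
  and cone_one_zero: "(1, 0) \<in> cone_monoid \<Delta> M"
  and cone_vertex: "(1, p i) \<in> cone_monoid \<Delta> M"
  by (auto simp: cone_iff lattice_zero lam_simps lam_vertex vertex_in)

definition cox_map :: "complex ^ 'i \<Rightarrow> nat \<times> 'v \<Rightarrow> complex" where
  "cox_map v = (\<lambda>(k, m). if (k, m) \<in> cone_monoid \<Delta> M then monom_at v (expo (int k) m) else 0)"

lemma cox_map_vertex: "cox_map v (1, p i) = v $ i ^ d i"
proof -
  have "(\<Prod>j\<in>UNIV - {i}. v $ j powi (axis i (int (d i)) $ j)) = 1"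
    by (intro prod.neutral) (auto simp: axis_def)
  then show ?thesis
    using cone_vertex[of i] expo_vertex[of i] monom_at_split[of v "axis i (int (d i))" i] by (simp add: cox_map_def)
qed

lemma cox_map_in:
  assumes "v \<noteq> 0" shows "cox_map v \<in> cone_points \<Delta> M"
proof -
  have "cox_map v (k + k', m + m') = cox_map v (k, m) * cox_map v (k', m')"
    if km: "(k, m) \<in> cone_monoid \<Delta> M" "(k', m') \<in> cone_monoid \<Delta> M" for k m k' m'
    using km cone_add[OF km] cone_expo_nonneg monom_at_add_nonneg[of "expo (int k) m" "expo (int k') m'" v]
      expo_add[OF cone_in[OF km(1)] cone_in[OF km(2)], of "int k" "int k'"]
    by (simp add: cox_map_def)
  moreover obtain i where "v $ i \<noteq> 0" using assms by (auto simp: vec_eq_iff)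
  then have "cox_map v (1, p i) \<noteq> 0" unfolding cox_map_vertex by simp
  moreover have "cox_map v (0, 0) = 1" using cone_zero by (simp add: cox_map_def)
  ultimately show ?thesis
    by (intro cone_pointsI[OF _ _ _ cone_vertex[of i]]) (auto simp: cox_map_def)
qed

lemma cox_map_scale:
  assumes "t \<noteq> 0"
  shows "cox_map (\<chi> i. t ^ w i * v $ i) = (\<lambda>(k, m). (t ^ L) ^ k * cox_map v (k, m))"
proof -
  have "monom_at (\<chi> i. t ^ w i * v $ i) (expo (int k) m) = (t ^ L) ^ k * monom_at v (expo (int k) m)"
    if "m \<in> M" for k m
  proof -
    have "t powi (int k * int L) = (t ^ L) ^ k"
      by (metis power_int_of_nat power_mult mult.commute of_nat_mult)
    then show ?thesis by (simp add: monom_at_weighted_scale[OF assms] degree_expo[OF that])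
  qed
  then show ?thesis by (auto simp: fun_eq_iff cox_map_def cone_in)
qed

lemma image_cox_map: "cox_map ` weighted_orbit w v = scaling_orbit (cox_map v)"
proof (intro equalityI subsetI)
  fix \<xi> assume "\<xi> \<in> cox_map ` weighted_orbit w v"
  then obtain t where "t \<noteq> 0" "\<xi> = cox_map (\<chi> i. t ^ w i * v $ i)" unfolding weighted_orbit_def by blast
  then show "\<xi> \<in> scaling_orbit (cox_map v)"
    unfolding scaling_orbit_def using cox_map_scale by (intro CollectI exI[of _ "t ^ L"]) auto
next
  fix \<xi> assume "\<xi> \<in> scaling_orbit (cox_map v)"
  then obtain c where c: "c \<noteq> 0" "\<xi> = (\<lambda>(k, m). c ^ k * cox_map v (k, m))" unfolding scaling_orbit_def by blast
  \<comment> \<open>Scaling by \<open>t\<close> multiplies coordinates of degree 1 by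
    \<open>t ^ L\<close>; an L-th root of \<open>c\<close> therefore shows that the image of a
    weighted orbit is a full scaling orbit.\<close>
  define t where "t = exp (Ln c / of_nat L)"
  have "t ^ L = exp (of_nat L * (Ln c / of_nat L))" unfolding t_def by (rule exp_of_nat_mult[symmetric])
  then have "t ^ L = c" using c L_pos by simp
  then have "\<xi> = cox_map (\<chi> i. t ^ w i * v $ i)" using c cox_map_scale[of t v] by (simp add: t_def)
  moreover have "(\<chi> i. t ^ w i * v $ i) \<in> weighted_orbit w v"
    unfolding weighted_orbit_def by (intro CollectI exI[of _ t]) (simp add: t_def)
  ultimately show "\<xi> \<in> cox_map ` weighted_orbit w v" by blast
qed

text \<open>Regards a cone point as a function of exponent vectors. By injectivity of
  \<open>expo\<close> the choice is unique for nonnegative members of \<open>exponents\<close>; at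
  other vectors the value is arbitrary.\<close>

definition value_at :: "(nat \<times> 'v \<Rightarrow> complex) \<Rightarrow> int ^ 'i \<Rightarrow> complex" where
  "value_at \<xi> a = (let (k, m) = (SOME (k, m). (k, m) \<in> cone_monoid \<Delta> M \<and> a = expo (int k) m) in \<xi> (k, m))"

lemma value_at_expo:
  assumes "(k, m) \<in> cone_monoid \<Delta> M" shows "value_at \<xi> (expo (int k) m) = \<xi> (k, m)"
proof -
  have "(SOME (k', m'). (k', m') \<in> cone_monoid \<Delta> M \<and> expo (int k) m = expo (int k') m') = (k, m)"
  proof (rule some_equality)
    fix x assume "case x of (k', m') \<Rightarrow> (k', m') \<in> cone_monoid \<Delta> M \<and> expo (int k) m = expo (int k') m'"
    then show "x = (k, m)" using expo_inj[of m "snd x" "int k" "int (fst x)"] cone_in assms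
      by (auto split: prod.splits)
  qed (use assms in simp)
  then show ?thesis by (simp add: value_at_def)
qed

lemma value_at_add:
  assumes \<xi>: "\<xi> \<in> cone_points \<Delta> M"
    and "a \<in> exponents" "\<And>i. 0 \<le> a $ i" "b \<in> exponents" "\<And>i. 0 \<le> b $ i"
  shows "value_at \<xi> (a + b) = value_at \<xi> a * value_at \<xi> b"
proof -
  obtain k m where km: "(k, m) \<in> cone_monoid \<Delta> M" "a = expo (int k) m"
    using cone_of_exponents[OF assms(2,3)] by metis
  obtain k' m' where km': "(k', m') \<in> cone_monoid \<Delta> M" "b = expo (int k') m'"
    using cone_of_exponents[OF assms(4,5)] by metis
  have "a + b = expo (int (k + k')) (m + m')"
    using km km' expo_add[OF cone_in[OF km(1)] cone_in[OF km'(1)]] by simp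
  then show ?thesis
    using value_at_expo[OF km(1)] value_at_expo[OF km'(1)] value_at_expo[OF cone_add[OF km(1) km'(1)]]
      cone_points_mult[OF \<xi> km(1) km'(1)] km(2) km'(2) by simp
qed

lemma value_at_zero: "\<xi> \<in> cone_points \<Delta> M \<Longrightarrow> value_at \<xi> 0 = 1"
  using value_at_expo[OF cone_zero, of \<xi>] by (simp add: cone_points_def)

lemma value_at_scale:
  assumes \<xi>: "\<xi> \<in> cone_points \<Delta> M" and a: "a \<in> exponents" "\<And>i. 0 \<le> a $ i"
  shows "value_at \<xi> (int n *s a) = value_at \<xi> a ^ n"
proof (induction n)
  case (Suc n)
  have "value_at \<xi> (a + int n *s a) = value_at \<xi> a * value_at \<xi> (int n *s a)"
    using a int_subgroup_scale[OF exponents_subgroup a(1)] by (intro value_at_add[OF \<xi>]) auto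
  moreover have "int (Suc n) *s a = a + int n *s a" by (simp add: vec_eq_iff algebra_simps)
  ultimately show ?case using Suc by simp
qed (simp add: value_at_zero[OF \<xi>])

lemma value_at_sum:
  assumes \<xi>: "\<xi> \<in> cone_points \<Delta> M" and A: "finite A"
    and a: "\<And>j. j \<in> A \<Longrightarrow> a j \<in> exponents" "\<And>i j. j \<in> A \<Longrightarrow> 0 \<le> a j $ i"
  shows "value_at \<xi> (sum a A) = (\<Prod>j\<in>A. value_at \<xi> (a j)) \<and> sum a A \<in> exponents \<and> (\<forall>i. 0 \<le> sum a A $ i)"
  using A a
proof (induction A)
  case empty then show ?case using int_subgroup_zero[OF exponents_subgroup] value_at_zero[OF \<xi>] by simp
next
  case (insert j A)
  then have IH: "value_at \<xi> (sum a A) = (\<Prod>j\<in>A. value_at \<xi> (a j))" "sum a A \<in> exponents" "\<forall>i. 0 \<le> sum a A $ i" by auto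
  have "value_at \<xi> (a j + sum a A) = value_at \<xi> (a j) * value_at \<xi> (sum a A)"
    using IH insert by (intro value_at_add[OF \<xi>]) auto
  moreover have "a j + sum a A \<in> exponents" using IH insert int_subgroup_add[OF exponents_subgroup] by auto
  ultimately show ?case using IH insert by auto
qed

text \<open>The vertices generate a subgroup of exponent \<open>L\<close>, so they decide which coordinates vanish.\<close>

lemma value_at_power:
  assumes \<xi>: "\<xi> \<in> cone_points \<Delta> M" and a: "a \<in> exponents" "\<And>i. 0 \<le> a $ i"
  shows "value_at \<xi> a ^ L = (\<Prod>i\<in>UNIV. \<xi> (1, p i) ^ nat (int (w i) * a $ i))"
proof -
  \<comment> \<open>Since w_i d_i = L, the vector L a is the sum of the multiples by w_i a_i of the
    vertex exponents d_i e_i.\<close>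
  let ?b = "\<lambda>i. (int (w i) * a $ i) *s axis i (int (d i))"
  have ax: "axis i (int (d i)) \<in> exponents" for i using expo_in[OF vertex_in, of 1 i] by (simp add: expo_vertex)
  have "(\<Sum>i\<in>UNIV. ?b i) $ j = (int L *s a) $ j" for j
  proof -
    have "(\<Sum>i\<in>UNIV. ?b i) $ j = (\<Sum>i\<in>UNIV. if i = j then int (w i) * a $ i * int (d i) else 0)"
      unfolding sum_component by (intro sum.cong refl) (auto simp: axis_def)
    also have "\<dots> = int (w j * d j) * a $ j" by simp
    finally show ?thesis by (simp add: w_mult_d)
  qed
  then have eq: "(\<Sum>i\<in>UNIV. ?b i) = int L *s a" by (simp add: vec_eq_iff)
  have "value_at \<xi> (int L *s a) = (\<Prod>i\<in>UNIV. value_at \<xi> (?b i))"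
    unfolding eq[symmetric]
    by (rule value_at_sum[OF \<xi>, THEN conjunct1])
       (use a int_subgroup_scale[OF exponents_subgroup ax] in \<open>auto simp: axis_def\<close>)
  moreover have "value_at \<xi> (?b i) = \<xi> (1, p i) ^ nat (int (w i) * a $ i)" for i
  proof -
    have "?b i = int (nat (int (w i) * a $ i)) *s axis i (int (d i))" using a(2)[of i] by simp
    moreover have "value_at \<xi> (axis i (int (d i))) = \<xi> (1, p i)"
      using value_at_expo[OF cone_vertex[of i], of \<xi>] by (simp add: expo_vertex)
    moreover have "value_at \<xi> (int n *s axis i (int (d i))) = value_at \<xi> (axis i (int (d i))) ^ n" for n
      by (rule value_at_scale[OF \<xi> ax]) (simp add: axis_def)
    ultimately show ?thesis by metis
  qed
  ultimately show ?thesis using value_at_scale[OF \<xi> a] by simp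
qed

lemma value_at_nonzero_iff:
  assumes \<xi>: "\<xi> \<in> cone_points \<Delta> M" and a: "a \<in> exponents" "\<And>i. 0 \<le> a $ i"
  shows "value_at \<xi> a \<noteq> 0 \<longleftrightarrow> (\<forall>i. a $ i \<noteq> 0 \<longrightarrow> \<xi> (1, p i) \<noteq> 0)"
proof -
  have "value_at \<xi> a \<noteq> 0 \<longleftrightarrow> value_at \<xi> a ^ L \<noteq> 0" using L_pos by simp
  also have "\<dots> \<longleftrightarrow> (\<forall>i. \<xi> (1, p i) ^ nat (int (w i) * a $ i) \<noteq> 0)"
    unfolding value_at_power[OF assms] by simp
  also have "\<dots> \<longleftrightarrow> (\<forall>i. a $ i \<noteq> 0 \<longrightarrow> \<xi> (1, p i) \<noteq> 0)"
  proof -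
    have "\<xi> (1, p i) ^ nat (int (w i) * a $ i) \<noteq> 0 \<longleftrightarrow> (a $ i \<noteq> 0 \<longrightarrow> \<xi> (1, p i) \<noteq> 0)" for i
    proof (cases "a $ i = 0")
      case False
      then have "0 < int (w i) * a $ i" using a(2)[of i] w_pos[of i] by (intro mult_pos_pos) auto
      then show ?thesis using False by simp
    qed simp
    then show ?thesis by blast
  qed
  finally show ?thesis .
qed

text \<open>The vertices with nonzero coordinate determine a face, on whose exponents \<xi> is
  nowhere zero and so extends to a character \<open>s\<close>. Replacing the entries of
  \<open>s\<close> outside the face by 0 reproduces the zeros of \<xi> as well.\<close>

lemma cox_map_surj:
  assumes \<xi>: "\<xi> \<in> cone_points \<Delta> M"
  obtains v where "v \<noteq> 0" "\<xi> = cox_map v"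
proof -
  define J where "J = {i. \<xi> (1, p i) \<noteq> 0}"
  let ?T = "{a \<in> exponents. (\<forall>i. 0 \<le> a $ i) \<and> (\<forall>i. a $ i \<noteq> 0 \<longrightarrow> i \<in> J)}"
  have "0 \<in> ?T" using int_subgroup_zero[OF exponents_subgroup] by simp
  moreover have "a + b \<in> ?T" if "a \<in> ?T" "b \<in> ?T" for a b
    using that int_subgroup_add[OF exponents_subgroup] by (auto, metis add_0)
  moreover have "value_at \<xi> a \<noteq> 0" if "a \<in> ?T" for a
    using that value_at_nonzero_iff[OF \<xi>] by (auto simp: J_def)
  moreover have "value_at \<xi> (a + b) = value_at \<xi> a * value_at \<xi> b" if "a \<in> ?T" "b \<in> ?T" for a b
    using that by (intro value_at_add[OF \<xi>]) auto
  ultimately have "\<exists>s. (\<forall>i. s $ i \<noteq> 0) \<and> (\<forall>a\<in>?T. value_at \<xi> a = monom_at s a)"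
    by (rule monoid_character_extends)
  then obtain s where s: "\<forall>i. s $ i \<noteq> 0" "\<forall>a\<in>?T. value_at \<xi> a = monom_at s a" by (elim exE conjE)
  define v where "v = (\<chi> i. if i \<in> J then s $ i else 0)"
  have key: "value_at \<xi> a = monom_at v a" if a: "a \<in> exponents" "\<And>i. 0 \<le> a $ i" for a
  proof (cases "\<forall>i. a $ i \<noteq> 0 \<longrightarrow> i \<in> J")
    case True
    then have "value_at \<xi> a = monom_at s a" using s(2) a by blast
    also have "\<dots> = monom_at v a" using True by (intro monom_at_cong) (auto simp: v_def)
    finally show ?thesis .
  next
    case False
    then obtain i where i: "a $ i \<noteq> 0" "i \<notin> J" by blast
    then have "monom_at v a = 0" by (subst monom_at_split[of _ _ i]) (simp add: v_def)
    then show ?thesis using value_at_nonzero_iff[OF \<xi> a] i by (auto simp: J_def)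
  qed
  have eq: "\<xi> = cox_map v"
  proof
    fix z :: "nat \<times> 'v"
    obtain k m where z: "z = (k, m)" by (cases z)
    show "\<xi> z = cox_map v z"
    proof (cases "(k, m) \<in> cone_monoid \<Delta> M")
      case True
      then show ?thesis
        using key[OF expo_in[OF cone_in[OF True]] cone_expo_nonneg[OF True]] value_at_expo[OF True, of \<xi>]
        by (simp add: z cox_map_def)
    next
      case False then show ?thesis using \<xi> by (auto simp: z cox_map_def cone_points_def)
    qed
  qed
  have "v \<noteq> 0"
  proof
    assume v0: "v = 0"
    obtain k m where km: "(k, m) \<in> cone_monoid \<Delta> M" "k > 0" "\<xi> (k, m) \<noteq> 0"
      using \<xi> unfolding cone_points_def by blast
    \<comment> \<open>With \<open>v\<close> = 0 every monomial of positive degree would vanish,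
      contrary to the removal of the irrelevant locus.\<close>
    have "weighted_degree w (expo (int k) m) \<noteq> 0" using degree_expo[OF cone_in[OF km(1)]] L_pos km(2) by simp
    then obtain i where "expo (int k) m $ i \<noteq> 0"
      unfolding weighted_degree_def by (metis (no_types, lifting) mult_zero_right sum.neutral)
    then have "monom_at v (expo (int k) m) = 0" by (subst monom_at_split[of _ _ i]) (simp add: v0)
    then show False using km eq by (simp add: cox_map_def)
  qed
  then show thesis using that eq by blast
qed

end

lemma monom_at_axis: "monom_at u (axis i n) = u $ i powi n"
proof -
  have "(\<Prod>j\<in>UNIV - {i}. u $ j powi (axis i n $ j)) = 1"
    by (intro prod.neutral) (auto simp: axis_def)
  then show ?thesis by (subst monom_at_split[of _ _ i]) simp
qed

lemma sum_if_mem_subset: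
  fixes c :: "'a \<Rightarrow> complex"
  assumes "finite A" "B \<subseteq> A"
  shows "(\<Sum>a\<in>A. (if a \<in> B then g a else 0) * c a) = (\<Sum>a\<in>B. g a * c a)"
  using assms by (intro sum.mono_neutral_cong_right) auto

section \<open>The group of roots of unity and averages over it\<close>

context toric_simplex begin

text \<open>The group whose orbits, combined with the scaling action, are the fibres of \<open>cox_map\<close>.\<close>

definition deck :: "(complex ^ 'i) set" where
  "deck = {s. (\<forall>i. s $ i \<noteq> 0) \<and> (\<forall>a\<in>exponents. monom_at s a = 1)}"

lemma cox_map_deck:
  assumes "s \<in> deck" shows "cox_map (\<chi> i. s $ i * v $ i) = cox_map v"
  using assms by (auto simp: fun_eq_iff cox_map_def deck_def monom_at_mult cone_in expo_in)

text \<open>On the common support of \<open>v\<close> and \<open>v'\<close> their ratio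
  \<open>t\<close> is trivial on all exponents supported there, while the entries off the support
  are free. \<open>character_extends_trivially\<close> uses this freedom to replace \<open>t\<close>
  by an element of \<open>deck\<close> with the same entries on the support.\<close>

lemma cox_map_eqD:
  assumes eq: "cox_map v = cox_map v'"
  shows "\<exists>s\<in>deck. v' = (\<chi> i. s $ i * v $ i)"
proof -
  have vertex: "v $ i ^ d i = v' $ i ^ d i" for i
    using fun_cong[OF eq, of "(1, p i)"] by (simp only: cox_map_vertex)
  have supp: "v $ i = 0 \<longleftrightarrow> v' $ i = 0" for i
    using vertex[of i] d_pos[of i] by (metis power_eq_0_iff)
  \<comment> \<open>The entry 1 at vanishing coordinates is a placeholder that keeps
    \<open>t\<close> invertible; the exponents in \<open>?B\<close> do not see it.\<close>
  define t where "t = (\<chi> i. if v $ i = 0 then 1 else v' $ i / v $ i)"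
  have t: "t $ i \<noteq> 0" "v' $ i = t $ i * v $ i" for i using supp[of i] by (simp_all add: t_def)
  have v': "v' = (\<chi> i. t $ i * v $ i)" using t(2) by (simp add: vec_eq_iff)
  let ?B = "{a :: int ^ 'i. \<forall>i. v $ i = 0 \<longrightarrow> a $ i = 0}"
  have B: "int_subgroup ?B" by (auto simp: int_subgroup_def)
  have char: "character_on ?B (monom_at t)"
    using t(1) by (auto simp: character_on_def monom_at_nonzero monom_at_add)
  have nonneg: "monom_at t a = 1" if a: "a \<in> exponents" "a \<in> ?B" "\<And>i. 0 \<le> a $ i" for a
  proof -
    obtain k m where km: "(k, m) \<in> cone_monoid \<Delta> M" "a = expo (int k) m"
      using cone_of_exponents[OF a(1,3)] by metis
    have "monom_at v a = monom_at v' a"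
      using fun_cong[OF eq, of "(k, m)"] km by (simp add: cox_map_def)
    also have "\<dots> = monom_at t a * monom_at v a" unfolding v' by (rule monom_at_mult)
    finally have "monom_at v a = monom_at t a * monom_at v a" .
    moreover have "monom_at v a \<noteq> 0" using a(2) by (auto simp: monom_at_def)
    ultimately show ?thesis by simp
  qed
  have triv: "monom_at t a = 1" if a: "a \<in> exponents" "a \<in> ?B" for a
  proof -
    \<comment> \<open>Equality of the images gives information only about nonnegative exponents.
      Adding L |a|, an exponent with the same support as \<open>a\<close>, makes \<open>a\<close>
      nonnegative.\<close>
    define c where "c = int L *s (\<chi> i. \<bar>a $ i\<bar>)"
    have c: "c \<in> exponents" unfolding c_def by (rule scaled_in)
    have cn: "0 \<le> c $ i" for i by (simp add: c_def)
    have an: "0 \<le> (a + c) $ i" for i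
    proof -
      have "1 * \<bar>a $ i\<bar> \<le> int L * \<bar>a $ i\<bar>" using L_pos by (intro mult_right_mono) auto
      then show ?thesis by (simp add: c_def)
    qed
    have cB: "c \<in> ?B" "a + c \<in> ?B" using a(2) by (auto simp: c_def)
    have "monom_at t (a + c) = 1"
      using nonneg[OF int_subgroup_add[OF exponents_subgroup a(1) c] cB(2) an] .
    moreover have "monom_at t c = 1" by (rule nonneg[OF c cB(1) cn])
    ultimately show ?thesis using monom_at_add[of t a c] t(1) by simp
  qed
  have "\<exists>s. (\<forall>i. s $ i \<noteq> 0) \<and> (\<forall>a\<in>exponents. monom_at s a = 1) \<and> (\<forall>b\<in>?B. monom_at s b = monom_at t b)"
    by (rule character_extends_trivially[OF exponents_subgroup B char]) (rule triv)
  then obtain s where s: "\<forall>i. s $ i \<noteq> 0" "\<forall>a\<in>exponents. monom_at s a = 1"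
    "\<forall>b\<in>?B. monom_at s b = monom_at t b" by (elim exE conjE)
  have "v' $ i = s $ i * v $ i" for i
  proof (cases "v $ i = 0")
    case False
    then have "axis i 1 \<in> ?B" by (auto simp: axis_def)
    from bspec[OF s(3) this] have "s $ i = t $ i" by (simp add: monom_at_axis)
    then show ?thesis using t(2) by simp
  qed (use supp in simp)
  then show ?thesis using s(1,2) by (intro bexI[of _ s]) (auto simp: vec_eq_iff deck_def)
qed

lemma deck_one: "(\<chi> i. 1) \<in> deck"
  by (simp add: deck_def monom_at_def)

lemma deck_mult: "s \<in> deck \<Longrightarrow> s' \<in> deck \<Longrightarrow> (\<chi> i. s $ i * s' $ i) \<in> deck"
  by (simp add: deck_def monom_at_mult)

lemma deck_root_of_unity:
  assumes "s \<in> deck" shows "s $ i ^ d i = 1"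
proof -
  have "axis i (int (d i)) \<in> exponents" using expo_in[OF vertex_in, of 1 i] by (simp add: expo_vertex)
  then show ?thesis using assms monom_at_axis[of s i "int (d i)"] by (simp add: deck_def)
qed

lemma finite_deck: "finite deck"
proof (rule finite_subset)
  show "deck \<subseteq> vec_lambda ` (\<Pi>\<^sub>E i\<in>UNIV. {z. z ^ d i = 1})"
  proof
    fix s assume "s \<in> deck"
    then show "s \<in> vec_lambda ` (\<Pi>\<^sub>E i\<in>UNIV. {z. z ^ d i = 1})"
      by (intro image_eqI[of _ _ "vec_nth s"]) (auto simp: deck_root_of_unity PiE_def)
  qed
  show "finite (vec_lambda ` (\<Pi>\<^sub>E i\<in>UNIV. {z :: complex. z ^ d i = 1}))"
    by (intro finite_imageI finite_PiE) (auto intro!: finite_roots_unity simp: d_pos Suc_leI)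
qed

text \<open>Orthogonality of characters: if \<open>a\<close> is not an exponent, some
  \<open>s1\<close> in \<open>deck\<close> has a nontrivial value at \<open>a\<close>, and
  multiplication by \<open>s1\<close> permutes \<open>deck\<close>, so the sum is a multiple of
  itself by a factor other than 1.\<close>

lemma deck_sum:
  "(\<Sum>s\<in>deck. monom_at s a) = (if a \<in> exponents then of_nat (card deck) else 0)"
proof (cases "a \<in> exponents")
  case True then show ?thesis by (simp add: deck_def)
next
  case False
  have "\<exists>s. (\<forall>i. s $ i \<noteq> 0) \<and> (\<forall>b\<in>exponents. monom_at s b = 1) \<and> monom_at s a \<noteq> 1"
    by (rule character_separates[OF exponents_subgroup False scaled_in]) (use L_pos in simp)
  then obtain s1 where s1: "s1 \<in> deck" "monom_at s1 a \<noteq> 1" by (auto simp: deck_def)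
  let ?f = "\<lambda>s. (\<chi> i. s1 $ i * s $ i)"
  have inj: "inj_on ?f deck" using s1(1) by (auto simp: inj_on_def vec_eq_iff deck_def)
  have "?f ` deck = deck"
    by (rule endo_inj_surj[OF finite_deck _ inj]) (use deck_mult s1(1) in auto)
  then have "(\<Sum>s\<in>deck. monom_at s a) = (\<Sum>s\<in>?f ` deck. monom_at s a)" by simp
  also have "\<dots> = monom_at s1 a * (\<Sum>s\<in>deck. monom_at s a)"
    by (simp add: sum.reindex[OF inj] o_def monom_at_mult sum_distrib_left)
  finally show ?thesis using s1(2) False by simp
qed

lemma card_deck: "card deck \<noteq> 0"
  using finite_deck deck_one by auto

text \<open>By orthogonality, weighting the translates with the inverse character of
  \<open>b\<close> removes every monomial whose exponent is not congruent to \<open>b\<close> modulo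
  \<open>exponents\<close>.\<close>

lemma isotypic_projection:
  assumes "finite A"
  shows "(\<Sum>s\<in>deck. monom_at s (- b) * (\<Sum>a\<in>A. h a * monom_at (\<chi> i. s $ i * c $ i) a)) =
    of_nat (card deck) * (\<Sum>a\<in>{a\<in>A. a - b \<in> exponents}. h a * monom_at c a)"
proof -
  have "(\<Sum>s\<in>deck. monom_at s (- b) * (\<Sum>a\<in>A. h a * monom_at (\<chi> i. s $ i * c $ i) a)) =
     (\<Sum>s\<in>deck. \<Sum>a\<in>A. h a * monom_at c a * monom_at s (a - b))"
  proof (intro sum.cong refl)
    fix s assume "s \<in> deck"
    then have "monom_at s (a + - b) = monom_at s a * monom_at s (- b)" for a
      by (intro monom_at_add) (auto simp: deck_def)
    then show "monom_at s (- b) * (\<Sum>a\<in>A. h a * monom_at (\<chi> i. s $ i * c $ i) a) =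
       (\<Sum>a\<in>A. h a * monom_at c a * monom_at s (a - b))"
      by (simp add: sum_distrib_left monom_at_mult mult_ac)
  qed
  also have "\<dots> = (\<Sum>a\<in>A. h a * monom_at c a * (\<Sum>s\<in>deck. monom_at s (a - b)))"
    by (subst sum.swap) (simp add: sum_distrib_left)
  also have "\<dots> = (\<Sum>a\<in>A. if a - b \<in> exponents then of_nat (card deck) * (h a * monom_at c a) else 0)"
    by (intro sum.cong refl) (simp add: deck_sum)
  also have "\<dots> = (\<Sum>a\<in>{a\<in>A. a - b \<in> exponents}. of_nat (card deck) * (h a * monom_at c a))"
    by (rule sum.inter_filter[OF assms, symmetric])
  finally show ?thesis by (simp add: sum_distrib_left)
qed

text \<open>Some isotypic part of \<open>H\<close> is nonzero at \<open>v0\<close>; numerator and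
  denominator are both projected to that class and multiplied by one monomial. Since \<phi> is
  evaluated on the target, its value is constant along \<open>deck\<close> and passes through the
  projection.\<close>

lemma descend_cox:
  assumes x: "x \<in> weighted_orbit w ` (UNIV - {0})"
    and G: "G \<in> weighted_forms w e" and H: "H \<in> weighted_forms w e" and nz: "\<forall>c\<in>x. H c \<noteq> 0"
  shows "\<exists>l. \<exists>g\<in>toric_sections \<Delta> M l. \<exists>h\<in>toric_sections \<Delta> M l. (\<forall>c\<in>x. h (cox_map c) \<noteq> 0) \<and>
    (\<forall>U \<phi>. saturated_under (weighted_orbit w ` (UNIV - {0})) (image cox_map) U \<longrightarrow>
       (\<forall>y\<in>U. \<forall>c\<in>y. \<phi> (cox_map ` y) * H c = G c) \<longrightarrow>
       (\<forall>y\<in>U. \<forall>c\<in>y. \<phi> (cox_map ` y) * h (cox_map c) = g (cox_map c)))"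
proof -
  obtain v0 where v0: "v0 \<noteq> 0" "x = weighted_orbit w v0" using x by blast
  obtain A1 g1 where A1: "finite A1" "\<And>a i. a \<in> A1 \<Longrightarrow> 0 \<le> a $ i" "\<And>a. a \<in> A1 \<Longrightarrow> weighted_degree w a = int e"
    "G = (\<lambda>v. \<Sum>a\<in>A1. g1 a * monom_at v a)" using weighted_formsE[OF G] by metis
  obtain A2 h1 where A2: "finite A2" "\<And>a i. a \<in> A2 \<Longrightarrow> 0 \<le> a $ i" "\<And>a. a \<in> A2 \<Longrightarrow> weighted_degree w a = int e"
    "H = (\<lambda>v. \<Sum>a\<in>A2. h1 a * monom_at v a)" using weighted_formsE[OF H] by metis
  define A where "A = A1 \<union> A2"
  \<comment> \<open>Numerator and denominator are padded with zero coefficients to a common set of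
    exponents, so that one choice of lattice points serves both.\<close>
  define g where "g a = (if a \<in> A1 then g1 a else 0)" for a
  define h where "h a = (if a \<in> A2 then h1 a else 0)" for a
  have A: "finite A" "\<And>a i. a \<in> A \<Longrightarrow> 0 \<le> a $ i" "\<And>a. a \<in> A \<Longrightarrow> weighted_degree w a = int e"
    using A1(1-3) A2(1-3) by (auto simp: A_def)
  have G_eq: "G v = (\<Sum>a\<in>A. g a * monom_at v a)" for v
    unfolding g_def A1(4) using A(1) by (subst sum_if_mem_subset) (auto simp: A_def)
  have H_eq: "H v = (\<Sum>a\<in>A. h a * monom_at v a)" for v
    unfolding h_def A2(4) using A(1) by (subst sum_if_mem_subset) (auto simp: A_def)
  define cl where "cl b = {a \<in> A. a - b \<in> exponents}" for b
  have cl_sym: "b - a \<in> exponents" if "a - b \<in> exponents" for a b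
    using int_subgroup_diff[OF exponents_subgroup int_subgroup_zero[OF exponents_subgroup] that] by simp
  have cl_trans: "a - c \<in> exponents" if "a - b \<in> exponents" "b - c \<in> exponents" for a b c
    using int_subgroup_add[OF exponents_subgroup that] by simp
  have cl_refl: "a - a \<in> exponents" for a using int_subgroup_zero[OF exponents_subgroup] by simp
  have cl_eq: "cl a = cl b" if "a - b \<in> exponents" for a b
    unfolding cl_def using that cl_sym cl_trans by blast
  have cl_mem: "a \<in> cl a" if "a \<in> A" for a using that cl_refl by (simp add: cl_def)
  have "(\<Sum>y\<in>cl ` A. \<Sum>a\<in>{a\<in>A. cl a = y}. h a * monom_at v0 a) = H v0"
    unfolding H_eq using A(1) by (intro sum.group) auto
  moreover have "H v0 \<noteq> 0" using nz v0 weighted_orbit_refl by blast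
  ultimately obtain y where "y \<in> cl ` A" "(\<Sum>a\<in>{a\<in>A. cl a = y}. h a * monom_at v0 a) \<noteq> 0"
    by (metis (no_types, lifting) sum.neutral)
  then obtain a0 where a0: "a0 \<in> A" "(\<Sum>a\<in>{a\<in>A. cl a = cl a0}. h a * monom_at v0 a) \<noteq> 0" by blast
  have "{a\<in>A. cl a = cl a0} = cl a0"
    using cl_eq cl_mem by (auto simp: cl_def)
  then have S0: "(\<Sum>a\<in>cl a0. h a * monom_at v0 a) \<noteq> 0" using a0 by simp
  \<comment> \<open>\<open>b\<close> is chosen with a monomial that is nonzero at \<open>v0\<close>,
    so that the multiplier built from it does not vanish there.\<close>
  then obtain b where b: "b \<in> cl a0" "h b * monom_at v0 b \<noteq> 0"
    by (metis (no_types, lifting) sum.neutral)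
  have bA: "b \<in> A" using b by (simp add: cl_def)
  have S: "(\<Sum>a\<in>cl b. h a * monom_at v0 a) \<noteq> 0" using S0 cl_eq[of b a0] b by (simp add: cl_def)
  \<comment> \<open>For \<open>a\<close> in the class of \<open>b\<close>, a + (L - 1) b = (a - b) +
    L b is a sum of two exponents. Its weighted degree L e belongs to toric sections of degree
    \<open>e\<close>.\<close>
  define r where "r = (int L - 1) *s b"
  have r: "0 \<le> r $ i" for i
  proof -
    have "1 * b $ i \<le> int L * b $ i" using A(2)[OF bA, of i] L_pos by (intro mult_right_mono) auto
    then show ?thesis by (simp add: r_def vector_sub_rdistrib)
  qed
  have "\<exists>m. (e, m) \<in> cone_monoid \<Delta> M \<and> a + r = expo (int e) m" if a: "a \<in> cl b" for a
  proof -
    have aA: "a \<in> A" "a - b \<in> exponents" using a by (auto simp: cl_def)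
    have eq: "a + r = (a - b) + int L *s b" by (simp add: r_def vector_sub_rdistrib)
    have "a + r \<in> exponents" unfolding eq by (rule int_subgroup_add[OF exponents_subgroup aA(2) scaled_in])
    moreover have "0 \<le> (a + r) $ i" for i using r A(2)[OF aA(1)] by simp
    ultimately obtain k m where km: "(k, m) \<in> cone_monoid \<Delta> M" "a + r = expo (int k) m"
      using cone_of_exponents by metis
    have "weighted_degree w (a + r) = int e + (int L - 1) * int e"
      unfolding r_def weighted_degree_add weighted_degree_scale A(3)[OF aA(1)] A(3)[OF bA] ..
    then have "int k * int L = int e * int L"
      using degree_expo[OF cone_in[OF km(1)], of "int k"] km(2) by (simp add: algebra_simps)
    then have "k = e" using L_pos by simp
    then show ?thesis using km by blast
  qed
  then obtain m where m: "\<And>a. a \<in> cl b \<Longrightarrow> (e, m a) \<in> cone_monoid \<Delta> M"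
     "\<And>a. a \<in> cl b \<Longrightarrow> a + r = expo (int e) (m a)" by metis
  have fin: "finite (cl b)" using A(1) by (simp add: cl_def)
  define sec where "sec f = (\<lambda>\<xi>. \<Sum>a\<in>cl b. f a * \<xi> (e, m a))" for f :: "int ^ 'i \<Rightarrow> complex"
  have sec_in: "sec f \<in> toric_sections \<Delta> M e" for f
    unfolding sec_def by (rule toric_sections_sum[OF fin m(1)])
  have sec_val: "sec f (cox_map c) = (\<Sum>a\<in>cl b. f a * monom_at c a) * monom_at c r" for f c
  proof -
    have "f a * cox_map c (e, m a) = f a * monom_at c a * monom_at c r" if a: "a \<in> cl b" for a
    proof -
      have "a \<in> A" using a by (simp add: cl_def)
      then have "monom_at c (a + r) = monom_at c a * monom_at c r"
        by (intro monom_at_add_nonneg A(2) r)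
      then show ?thesis using m[OF a] by (simp add: cox_map_def)
    qed
    then show ?thesis unfolding sec_def sum_distrib_right by (intro sum.cong refl)
  qed
  interpret tgt: graded_cone "scaling_orbit ` cone_points \<Delta> M" "toric_sections \<Delta> M"
    by (rule graded_cone_toric) (rule cone_add)
  have "monom_at v0 r \<noteq> 0"
  proof -
    have "monom_at v0 b \<noteq> 0" using b by simp
    then have "v0 $ i \<noteq> 0 \<or> b $ i = 0" for i by (auto simp: monom_at_def)
    then show ?thesis by (auto simp: monom_at_def r_def)
  qed
  then have "sec h (cox_map v0) \<noteq> 0" using S by (simp add: sec_val)
  moreover have "cox_map ` x \<in> scaling_orbit ` cone_points \<Delta> M" "cox_map v0 \<in> cox_map ` x"
    using v0 image_cox_map cox_map_in weighted_orbit_refl by blast+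
  ultimately have "cox_map ` x \<in> nonvanishing (scaling_orbit ` cone_points \<Delta> M) (sec h)"
    using tgt.nonzero_on_orbit sec_in by blast
  then have nonzero: "\<forall>c\<in>x. sec h (cox_map c) \<noteq> 0" by (simp add: nonvanishing_def)
  have univ: "\<phi> (cox_map ` y) * sec h (cox_map c) = sec g (cox_map c)"
    if sat: "saturated_under (weighted_orbit w ` (UNIV - {0})) (image cox_map) U"
      and eq: "\<forall>y\<in>U. \<forall>c\<in>y. \<phi> (cox_map ` y) * H c = G c" and y: "y \<in> U" "c \<in> y" for U \<phi> y c
  proof -
    have yP: "y \<in> weighted_orbit w ` (UNIV - {0})" using sat y by (auto simp: saturated_under_def)
    then have yc: "y = weighted_orbit w c" and c0: "c \<noteq> 0"
      using y(2) weighted_orbit_eq by (blast, auto simp: weighted_orbit_def vec_eq_iff)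
    \<comment> \<open>Saturation of \<open>U\<close> puts the orbit of each translate by
      \<open>deck\<close> into \<open>U\<close>, since its image is that of \<open>y\<close>. The
      equation may therefore be evaluated at all translates with one and the same value of
      \<phi>.\<close>
    have "\<phi> (cox_map ` y) * H (\<chi> i. s $ i * c $ i) = G (\<chi> i. s $ i * c $ i)" if s: "s \<in> deck" for s
    proof -
      let ?sc = "\<chi> i. s $ i * c $ i"
      have "?sc \<noteq> 0" using c0 s by (auto simp: vec_eq_iff deck_def)
      then have scP: "weighted_orbit w ?sc \<in> weighted_orbit w ` (UNIV - {0})" by simp
      have F: "cox_map ` weighted_orbit w ?sc = cox_map ` y"
        unfolding yc image_cox_map cox_map_deck[OF s] ..
      have "weighted_orbit w ?sc \<in> U"
        by (rule bspec[OF bspec[OF sat[unfolded saturated_under_def, THEN conjunct2] y(1)] scP, THEN mp])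
           (rule F[symmetric])
      from bspec[OF bspec[OF eq this] weighted_orbit_refl] show ?thesis unfolding F .
    qed
    then have "\<phi> (cox_map ` y) * (\<Sum>s\<in>deck. monom_at s (- b) * H (\<chi> i. s $ i * c $ i)) =
        (\<Sum>s\<in>deck. monom_at s (- b) * G (\<chi> i. s $ i * c $ i))"
      unfolding sum_distrib_left by (intro sum.cong refl) (metis mult.left_commute)
    then have "of_nat (card deck) * (\<phi> (cox_map ` y) * (\<Sum>a\<in>cl b. h a * monom_at c a)) =
        of_nat (card deck) * (\<Sum>a\<in>cl b. g a * monom_at c a)"
      unfolding G_eq H_eq isotypic_projection[OF A(1)] cl_def[symmetric] by (simp only: mult.left_commute)
    then have "\<phi> (cox_map ` y) * (\<Sum>a\<in>cl b. h a * monom_at c a) = (\<Sum>a\<in>cl b. g a * monom_at c a)"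
      using card_deck by simp
    then show ?thesis unfolding sec_val by (metis mult.assoc)
  qed
  show ?thesis
  proof (rule exI[of _ e], rule bexI[OF _ sec_in[of g]], rule bexI[OF _ sec_in[of h]], rule conjI[OF nonzero],
      intro allI impI)
    fix U \<phi>
    assume sat: "saturated_under (weighted_orbit w ` (UNIV - {0})) (image cox_map) U"
      and eq: "\<forall>y\<in>U. \<forall>c\<in>y. \<phi> (cox_map ` y) * H c = G c"
    show "\<forall>y\<in>U. \<forall>c\<in>y. \<phi> (cox_map ` y) * sec h (cox_map c) = sec g (cox_map c)"
      using univ[OF sat eq] by simp
  qed
qed

lemma cone_quotient_cox:
  "cone_quotient (weighted_orbit w ` (UNIV - {0})) (weighted_forms w)
     (scaling_orbit ` cone_points \<Delta> M) (toric_sections \<Delta> M) cox_map"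
proof -
  interpret src: graded_cone "weighted_orbit w ` (UNIV - {0})" "weighted_forms w"
    by (rule graded_cone_weighted) (rule w_pos)
  interpret tgt: graded_cone "scaling_orbit ` cone_points \<Delta> M" "toric_sections \<Delta> M"
    by (rule graded_cone_toric) (rule cone_add)
  show ?thesis
  proof
    show "cox_map ` x \<in> scaling_orbit ` cone_points \<Delta> M" if "x \<in> weighted_orbit w ` (UNIV - {0})" for x
      using that image_cox_map cox_map_in by blast
    fix k
    show "\<exists>l. \<forall>h\<in>toric_sections \<Delta> M k. \<exists>h'\<in>weighted_forms w l.
       \<forall>x\<in>weighted_orbit w ` (UNIV - {0}). \<forall>c\<in>x. h' c = h (cox_map c)"
    proof (intro exI[of _ "k * L"] ballI)
      fix h assume "h \<in> toric_sections \<Delta> M k"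
      then obtain A g where A: "finite A" "\<And>m. m \<in> A \<Longrightarrow> (k, m) \<in> cone_monoid \<Delta> M"
        "h = (\<lambda>\<xi>. \<Sum>m\<in>A. g m * \<xi> (k, m))" using toric_sectionsE[of h \<Delta> M k] by metis
      have "(\<lambda>v. \<Sum>m\<in>A. g m * monom_at v (expo (int k) m)) \<in> weighted_forms w (k * L)"
        using A by (intro weighted_forms_sum) (auto simp: cone_expo_nonneg degree_expo[OF cone_in[OF A(2)]])
      moreover have "(\<Sum>m\<in>A. g m * monom_at v (expo (int k) m)) = h (cox_map v)" for v
        using A by (auto simp: cox_map_def intro!: sum.cong)
      ultimately show "\<exists>h'\<in>weighted_forms w (k * L).
          \<forall>x\<in>weighted_orbit w ` (UNIV - {0}). \<forall>c\<in>x. h' c = h (cox_map c)"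
        by (intro bexI[of _ "\<lambda>v. \<Sum>m\<in>A. g m * monom_at v (expo (int k) m)"] ballI)
    qed
  next
    fix y assume "y \<in> scaling_orbit ` cone_points \<Delta> M"
    then obtain \<xi> where \<xi>: "\<xi> \<in> cone_points \<Delta> M" "y = scaling_orbit \<xi>" by blast
    obtain v where v: "v \<noteq> 0" "\<xi> = cox_map v" using cox_map_surj[OF \<xi>(1)] by blast
    show "\<exists>x\<in>weighted_orbit w ` (UNIV - {0}). y = cox_map ` x"
      by (rule bexI[of _ "weighted_orbit w v"]) (use v \<xi> in \<open>auto simp: image_cox_map\<close>)
  qed (rule descend_cox)
qed

lemma cox_map_orbit_eq_iff:
  "cox_map ` weighted_orbit w v = cox_map ` weighted_orbit w v' \<longleftrightarrow>
     (\<exists>s\<in>deck. weighted_orbit w v' = weighted_orbit w (\<chi> i. s $ i * v $ i))"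
proof
  assume eq: "cox_map ` weighted_orbit w v = cox_map ` weighted_orbit w v'"
  then obtain u where u: "u \<in> weighted_orbit w v'" "cox_map v = cox_map u"
    using weighted_orbit_refl by (metis imageE image_eqI)
  then show "\<exists>s\<in>deck. weighted_orbit w v' = weighted_orbit w (\<chi> i. s $ i * v $ i)"
    using cox_map_eqD[OF u(2)] weighted_orbit_eq[OF u(1)] by metis
next
  assume "\<exists>s\<in>deck. weighted_orbit w v' = weighted_orbit w (\<chi> i. s $ i * v $ i)"
  then show "cox_map ` weighted_orbit w v = cox_map ` weighted_orbit w v'"
    using cox_map_deck image_cox_map by metis
qed

end

section \<open>Reflexive simplices\<close>

text \<open>The vertex of Delta(w) at which every inequality but the \<open>i\<close>-th is tight:
  there w_i x_i is the sum of the other weights, L - w_i, so x_i = d_i - 1.\<close>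

definition weight_vertex :: "('i::finite \<Rightarrow> nat) \<Rightarrow> 'i \<Rightarrow> real ^ 'i" where
  "weight_vertex d i = (\<chi> j. (if i = j then real (d i) else 0) - 1)"

lemma real_fermat_weights:
  assumes "d i > 0" shows "real (fermat_weights d i) = real (Lcm (range d)) / real (d i)"
proof -
  have "real (fermat_weights d i) * real (d i) = real (Lcm (range d))"
    using fermat_weights_mult[of d i] by (metis of_nat_mult)
  then show ?thesis using assms by (simp add: field_simps)
qed

text \<open>The point that needs work is that M(w) spans its hyperplane: a vector x of the
  hyperplane is the combination of the vertices with coefficients x_i / d_i.\<close>

lemma toric_simplex_weight:
  fixes d :: "'i::finite \<Rightarrow> nat"
  assumes d: "\<And>i. d i > 0" "(\<Sum>i\<in>UNIV. 1 / real (d i)) = 1"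
  shows "toric_simplex d (weight_polytope (fermat_weights d)) (weight_lattice (fermat_weights d))
    (\<lambda>i x. x $ i) (weight_vertex d)"
proof -
  let ?w = "fermat_weights d" and ?M = "weight_lattice (fermat_weights d)"
  have weights: "(\<Sum>i\<in>UNIV. real (?w i) * x $ i) = 0 \<longleftrightarrow> (\<Sum>i\<in>UNIV. x $ i / real (d i)) = 0" for x :: "real ^ 'i"
  proof -
    have "(\<Sum>i\<in>UNIV. real (?w i) * x $ i) = real (Lcm (range d)) * (\<Sum>i\<in>UNIV. x $ i / real (d i))"
      unfolding sum_distrib_left by (intro sum.cong refl) (simp add: real_fermat_weights d(1))
    moreover have "real (Lcm (range d)) \<noteq> 0" using Lcm_range_pos[of d, OF d(1)] by linarith
    ultimately show ?thesis by (simp only: mult_eq_0_iff) blast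
  qed
  have M: "?M = {x. (\<forall>i. x $ i \<in> \<int>) \<and> (\<Sum>i\<in>UNIV. x $ i / real (d i)) = 0}"
    unfolding weight_lattice_def weights ..
  have dnz: "d i \<noteq> 0" for i using d(1)[of i] by simp
  have sub: "subspace {x :: real ^ 'i. (\<Sum>i\<in>UNIV. x $ i / real (d i)) = 0}"
    by (auto simp: subspace_def add_divide_distrib sum.distrib simp flip: times_divide_eq_right sum_distrib_left)
  have span_sub: "span ?M \<subseteq> {x. (\<Sum>i\<in>UNIV. x $ i / real (d i)) = 0}"
    by (rule span_minimal[OF _ sub]) (auto simp: M)
  have vertex: "weight_vertex d i \<in> ?M" for i
  proof -
    have "(\<Sum>j\<in>UNIV. weight_vertex d i $ j / real (d j)) =
        (\<Sum>j\<in>UNIV. (if i = j then 1 else 0) - 1 / real (d j))"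
      using d(1) by (intro sum.cong refl) (auto simp: weight_vertex_def diff_divide_distrib dnz)
    also have "\<dots> = 0" using d(2) by (simp add: sum_subtractf)
    finally show ?thesis by (simp add: M weight_vertex_def)
  qed
  have span_eq: "span ?M = {x. (\<Sum>i\<in>UNIV. x $ i / real (d i)) = 0}"
  proof (rule equalityI[OF span_sub], rule subsetI)
    fix x assume "x \<in> {x :: real ^ 'i. (\<Sum>i\<in>UNIV. x $ i / real (d i)) = 0}"
    then have x: "(\<Sum>i\<in>UNIV. x $ i / real (d i)) = 0" by simp
    have "x $ j = (\<Sum>i\<in>UNIV. (x $ i / real (d i)) *\<^sub>R weight_vertex d i) $ j" for j
    proof -
      have "(\<Sum>i\<in>UNIV. (x $ i / real (d i)) *\<^sub>R weight_vertex d i) $ j =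
         (\<Sum>i\<in>UNIV. (if i = j then x $ i else 0) - x $ i / real (d i))"
        unfolding sum_component using d(1)
        by (intro sum.cong refl) (auto simp: weight_vertex_def algebra_simps dnz)
      then show ?thesis using x by (simp add: sum_subtractf)
    qed
    then have "x = (\<Sum>i\<in>UNIV. (x $ i / real (d i)) *\<^sub>R weight_vertex d i)" unfolding vec_eq_iff by (rule allI)
    moreover have "(\<Sum>i\<in>UNIV. (x $ i / real (d i)) *\<^sub>R weight_vertex d i) \<in> span ?M"
      by (intro span_sum span_scale span_base vertex)
    ultimately show "x \<in> span ?M" by simp
  qed
  show ?thesis
  proof (rule toric_simplex.intro)
    show "linear (\<lambda>x. x $ i)" for i :: 'i
      by (rule linearI) simp_all
    show "weight_polytope ?w = {x \<in> span ?M. \<forall>i. -1 \<le> x $ i}"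
      unfolding weight_polytope_def weights span_eq by auto
    show "x - y \<in> ?M" if "x \<in> ?M" "y \<in> ?M" for x y
      using that by (auto simp: M diff_divide_distrib sum_subtractf)
  qed (use d vertex span_eq in \<open>auto simp: M weight_vertex_def vec_eq_iff\<close>)
qed

locale reflexive_simplex =
  toric_simplex d \<Delta> M "\<lambda>i x. x \<bullet> l i" p
  for d :: "'i::finite \<Rightarrow> nat" and \<Delta> M :: "'v::euclidean_space set" and l p :: "'i \<Rightarrow> 'v" +
  assumes normal_in_dual: "\<And>i. l i \<in> dual_lattice M"
    and weights_coprime: "Gcd (range (fermat_weights d)) = 1"
    and dual_extreme: "{v. v extreme_point_of dual_polytope \<Delta> M} = range l"

lemma lattice_props:
  assumes "is_lattice M"
  shows "0 \<in> M" "x \<in> M \<Longrightarrow> y \<in> M \<Longrightarrow> x - y \<in> M"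
proof -
  obtain B where M: "M = {\<Sum>b\<in>B. of_int (c b) *\<^sub>R b | c. True}" using assms by (auto simp: is_lattice_def)
  show "0 \<in> M" unfolding M by (intro CollectI exI[of _ "\<lambda>_. 0"]) simp
  assume "x \<in> M" "y \<in> M"
  then obtain c c' where "x = (\<Sum>b\<in>B. of_int (c b) *\<^sub>R b)" "y = (\<Sum>b\<in>B. of_int (c' b) *\<^sub>R b)"
    unfolding M by blast
  then show "x - y \<in> M" unfolding M
    by (intro CollectI exI[of _ "\<lambda>b. c b - c' b"]) (simp add: scaleR_left_diff_distrib sum_subtractf)
qed

lemma dual_lattice_zero: "0 \<in> dual_lattice M"
  by (simp add: dual_lattice_def span_zero)

lemma dual_lattice_scale: "y \<in> dual_lattice M \<Longrightarrow> of_int n *\<^sub>R y \<in> dual_lattice M"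
  by (simp add: dual_lattice_def span_scale)

lemma dual_lattice_add: "x \<in> dual_lattice M \<Longrightarrow> y \<in> dual_lattice M \<Longrightarrow> x + y \<in> dual_lattice M"
  by (simp add: dual_lattice_def span_add inner_add_right)

lemma sum_delta_minus_one:
  fixes f :: "'i::finite \<Rightarrow> real"
  shows "(\<Sum>i\<in>UNIV. f i * ((if i = j then x else 0) - 1)) = f j * x - sum f UNIV"
  and "(\<Sum>i\<in>UNIV. f i * ((if j = i then x else 0) - 1)) = f j * x - sum f UNIV"
proof -
  have "(\<Sum>i\<in>UNIV. f i * ((if i = j then x else 0) - 1)) = (\<Sum>i\<in>UNIV. (if i = j then f i * x else 0) - f i)"
    by (intro sum.cong refl) (simp add: algebra_simps)
  then show 1: "(\<Sum>i\<in>UNIV. f i * ((if i = j then x else 0) - 1)) = f j * x - sum f UNIV"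
    by (simp add: sum_subtractf)
  show "(\<Sum>i\<in>UNIV. f i * ((if j = i then x else 0) - 1)) = f j * x - sum f UNIV"
    unfolding 1[symmetric] by (intro sum.cong refl) auto
qed

text \<open>The candidate is the normal of the facet opposite \<open>p i\<close>, with the sign that
  makes it -1 on that facet. Its value at \<open>p i\<close> is then forced by the relation between
  the vertices.\<close>

lemma reflexive_simplex_normal:
  fixes d :: "'i::finite \<Rightarrow> nat" and \<Delta> M :: "'v::euclidean_space set"
  assumes d: "\<And>i. d i > 0" "(\<Sum>i\<in>UNIV. 1 / real (d i)) = 1"
    and pair: "reflexive_pair \<Delta> M"
    and aff: "\<not> affine_dependent (range p)" "inj p" "\<Delta> = convex hull (range p)"
    and bary: "(\<Sum>j\<in>UNIV. (1 / real (d j)) *\<^sub>R p j) = 0"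
  shows "\<exists>l\<in>dual_lattice M. \<forall>j. p j \<bullet> l = (if j = i then real (d j) else 0) - 1"
proof (cases "UNIV = {i}")
  \<comment> \<open>In dimension 0 there is no nonempty facet to supply a normal. Here
    \<open>d i\<close> = 1, and the zero form has the required value d_i - 1 = 0.\<close>
  case True
  then have all: "j = i" for j by blast
  have "1 / real (d i) = 1" using d(2) unfolding True by simp
  then have "d i = 1" using d(1)[of i] by (simp add: field_simps)
  then have "d j = 1" for j using all[of j] by simp
  then show ?thesis using all dual_lattice_zero by (intro bexI[of _ 0]) auto
next
  case False
  let ?F = "convex hull (range p - {p i})"
  have "range p - {p i} = p ` (UNIV - {i})" using aff(2) by (auto simp: inj_def)
  then have ne: "?F \<noteq> {}" and pF: "\<And>j. j \<noteq> i \<Longrightarrow> p j \<in> ?F" using False by (auto intro: hull_inc)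
  have "?F facet_of \<Delta>"
    unfolding aff(3) facet_of_convex_hull_affine_independent[OF aff(1)] using ne by blast
  then obtain l0 c where l0: "primitive_in (dual_lattice M) l0" "\<bar>c\<bar> = (1::real)"
      "affine hull ?F = {x \<in> span M. x \<bullet> l0 = c}"
    using pair unfolding reflexive_pair_def by blast
  have c: "p j \<bullet> l0 = c" if "j \<noteq> i" for j using pF[OF that] hull_inc[of "p j" ?F affine] l0(3) by auto
  have c1: "c = 1 \<or> c = -1" using l0(2) by linarith
  \<comment> \<open>As \<open>c\<close> is 1 or -1, this is \<open>l0\<close> up to sign, hence
    integral, and its value on the facet is minus the square of \<open>c\<close>.\<close>
  define l where "l = - c *\<^sub>R l0"
  have "l \<in> dual_lattice M"
    using dual_lattice_scale[of l0 M 1] dual_lattice_scale[of l0 M "-1"] l0(1) c1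
    by (auto simp: l_def primitive_in_def)
  moreover have other: "p j \<bullet> l = -1" if "j \<noteq> i" for j using c[OF that] c1 by (auto simp: l_def)
  moreover have "p i \<bullet> l = real (d i) - 1"
  proof -
    have "0 = (\<Sum>j\<in>UNIV. (1 / real (d j)) *\<^sub>R p j) \<bullet> l" using bary by simp
    also have "\<dots> = (\<Sum>j\<in>UNIV. (1 / real (d j)) * (p j \<bullet> l))" by (simp add: inner_sum_left)
    also have "\<dots> = (\<Sum>j\<in>UNIV. (if j = i then (1 / real (d j)) * (p j \<bullet> l + 1) else 0) - 1 / real (d j))"
      by (intro sum.cong refl) (use other in \<open>auto simp: algebra_simps\<close>)
    also have "\<dots> = (1 / real (d i)) * (p i \<bullet> l + 1) - 1" using d(2) by (simp add: sum_subtractf)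
    finally show ?thesis using d(1)[of i] by (simp add: field_simps)
  qed
  ultimately show ?thesis by (intro bexI[of _ l]) auto
qed

text \<open>Vertices and normals are dual to each other up to one linear relation on each side. The
  descriptions of the polytope and of its dual both come from explicit barycentric
  coordinates.\<close>

lemma reflexive_simplex_exists:
  fixes d :: "'i::finite \<Rightarrow> nat" and \<Delta> M :: "'v::euclidean_space set"
  assumes d: "\<And>i. d i > 0" "(\<Sum>i\<in>UNIV. 1 / real (d i)) = 1"
    and pair: "reflexive_pair \<Delta> M" and weights: "simplex_with_weights \<Delta> (fermat_weights d)"
  shows "\<exists>l p. reflexive_simplex d \<Delta> M l p"
proof -
  obtain p where p: "bij_betw p UNIV {v. v extreme_point_of \<Delta>}"
    and bary0: "(\<Sum>i\<in>UNIV. real (fermat_weights d i) *\<^sub>R p i) = 0"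
    using weights unfolding simplex_with_weights_def by blast
  obtain C where C: "\<not> affine_dependent C" "\<Delta> = convex hull C"
    using weights unfolding simplex_with_weights_def simplex_def by blast
  have "{v. v extreme_point_of \<Delta>} = C" unfolding C(2) using extreme_point_of_convex_hull_affine_independent[OF C(1)] by blast
  then have rp: "range p = C" "inj p" using p by (auto simp: bij_betw_def)
  have lattice: "is_lattice M" using pair by (simp add: reflexive_pair_def)
  have pM: "p i \<in> M" for i
    using pair p unfolding reflexive_pair_def bij_betw_def by blast
  have Lpos: "Lcm (range d) > 0" by (rule Lcm_range_pos[OF d(1)])
  have "real (Lcm (range d)) *\<^sub>R (\<Sum>j\<in>UNIV. (1 / real (d j)) *\<^sub>R p j) = 0"
    using bary0 by (simp add: scaleR_sum_right real_fermat_weights[OF d(1)])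
  moreover have "real (Lcm (range d)) \<noteq> 0" using Lpos by linarith
  ultimately have bary: "(\<Sum>j\<in>UNIV. (1 / real (d j)) *\<^sub>R p j) = 0" by (simp only: scaleR_eq_0_iff) blast
  have "\<exists>l\<in>dual_lattice M. \<forall>j. p j \<bullet> l = (if j = i then real (d j) else 0) - 1" for i
    by (rule reflexive_simplex_normal[OF d pair _ rp(2) _ bary]) (use C rp in auto)
  then obtain l where lN: "\<And>i. l i \<in> dual_lattice M"
    and pl: "\<And>i j. p j \<bullet> l i = (if j = i then real (d j) else 0) - 1" by metis
  \<comment> \<open>0 lies in \<open>\<Delta>\<close>, so the affine dimension of
    \<open>\<Delta>\<close> is the dimension of its linear span, which therefore fills the span of
    \<open>M\<close>.\<close>
  have spanM: "span M = span (range p)"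
  proof -
    have "0 \<in> \<Delta>" using pair rel_interior_subset unfolding reflexive_pair_def by blast
    then have "int (dim \<Delta>) = int (dim M)"
      using pair aff_dim_zero[of \<Delta>] hull_inc[of 0 \<Delta> affine] unfolding reflexive_pair_def by simp
    then have "span \<Delta> = span (span M)"
      using pair by (intro dim_eq_span) (auto simp: reflexive_pair_def)
    moreover have "\<Delta> \<subseteq> span (range p)" unfolding C(2) rp(1)
      by (rule convex_hull_subset_span)
    then have "span \<Delta> \<subseteq> span (range p)" using span_mono span_span by metis
    moreover have "span (range p) \<subseteq> span M" using pM by (intro span_mono) auto
    ultimately show ?thesis by (metis span_span subset_antisym)
  qed
  have dnz: "d i \<noteq> 0" for i using d(1)[of i] by simp
  \<comment> \<open>At x = p_j the \<open>i\<close>-th coefficient is 1 - 1/d_j for i = j and -1/d_i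
    otherwise; the terms with 1/d_i cancel by the relation between the vertices.\<close>
  have recover: "(\<Sum>i\<in>UNIV. ((x \<bullet> l i) / real (d i)) *\<^sub>R p i) = x" if x: "x \<in> span M" for x
    using x unfolding spanM
  proof (induction rule: span_induct)
    show "subspace {x. (\<Sum>i\<in>UNIV. ((x \<bullet> l i) / real (d i)) *\<^sub>R p i) = x}"
      by (auto simp: subspace_def inner_add_left add_divide_distrib scaleR_left_distrib sum.distrib
          scaleR_sum_right[symmetric] simp flip: scaleR_scaleR times_divide_eq_right)
    fix x assume "x \<in> range p"
    then obtain j where j: "x = p j" by blast
    have "(\<Sum>i\<in>UNIV. ((x \<bullet> l i) / real (d i)) *\<^sub>R p i) =
        (\<Sum>i\<in>UNIV. (if i = j then p i else 0) - (1 / real (d i)) *\<^sub>R p i)"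
      unfolding j pl using d(1) by (intro sum.cong refl) (auto simp: algebra_simps diff_divide_distrib dnz)
    then show "(\<Sum>i\<in>UNIV. ((x \<bullet> l i) / real (d i)) *\<^sub>R p i) = x" by (simp add: sum_subtractf bary j)
  qed
  have weights0: "(\<Sum>i\<in>UNIV. (x \<bullet> l i) / real (d i)) = 0" if x: "x \<in> span M" for x
    using x unfolding spanM
  proof (induction rule: span_induct)
    show "subspace {x. (\<Sum>i\<in>UNIV. (x \<bullet> l i) / real (d i)) = 0}"
      by (auto simp: subspace_def inner_add_left add_divide_distrib sum.distrib
          simp flip: times_divide_eq_right sum_distrib_left)
    fix x assume "x \<in> range p"
    then obtain j where j: "x = p j" by blast
    have "(\<Sum>i\<in>UNIV. (x \<bullet> l i) / real (d i)) = (\<Sum>i\<in>UNIV. (if i = j then 1 else 0) - 1 / real (d i))"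
      unfolding j pl using d(1) by (intro sum.cong refl) (auto simp: diff_divide_distrib dnz)
    then show "(\<Sum>i\<in>UNIV. (x \<bullet> l i) / real (d i)) = 0" using d(2) by (simp add: sum_subtractf)
  qed
  have d1: "real (d i) \<ge> 1" for i using d(1)[of i] by linarith
  have poly: "\<Delta> = {x \<in> span M. \<forall>i. x \<bullet> l i \<ge> -1}"
  proof (intro equalityI subsetI)
    fix x assume x: "x \<in> \<Delta>"
    have "convex {x. x \<bullet> l i \<ge> -1}" for i using convex_halfspace_ge[of "-1" "l i"] by (simp add: inner_commute)
    moreover have "range p \<subseteq> {x. x \<bullet> l i \<ge> -1}" for i using pl d1 by auto
    ultimately have "\<Delta> \<subseteq> {x. x \<bullet> l i \<ge> -1}" for i unfolding C(2) rp(1)[symmetric] by (intro hull_minimal) auto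
    then show "x \<in> {x \<in> span M. \<forall>i. x \<bullet> l i \<ge> -1}" using x pair unfolding reflexive_pair_def by blast
  next
    fix x assume x: "x \<in> {x \<in> span M. \<forall>i. x \<bullet> l i \<ge> -1}"
    \<comment> \<open>Barycentric coordinates: \<open>l i\<close> increased by 1 vanishes on the
      facet opposite \<open>p i\<close> and has the value d_i at \<open>p i\<close>.\<close>
    let ?a = "\<lambda>i. (x \<bullet> l i + 1) / real (d i)"
    have "x = (\<Sum>i\<in>UNIV. ?a i *\<^sub>R p i)"
      using recover[of x] x bary by (simp add: add_divide_distrib scaleR_left_distrib sum.distrib)
    moreover have "(\<Sum>i\<in>UNIV. ?a i *\<^sub>R p i) \<in> \<Delta>"
      unfolding C(2)
    proof (rule convex_sum)
      show "(\<Sum>i\<in>UNIV. ?a i) = 1" using weights0[of x] x d(2) by (simp add: add_divide_distrib sum.distrib)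
      show "0 \<le> ?a i" for i
      proof -
        have "-1 \<le> x \<bullet> l i" using x by blast
        then show ?thesis using d1[of i] by (intro divide_nonneg_nonneg) linarith+
      qed
      show "p i \<in> convex hull C" for i using rp by (auto intro: hull_inc)
    qed auto
    ultimately show "x \<in> \<Delta>" by simp
  qed
  have lspan: "l i \<in> span M" for i using lN[of i] by (simp add: dual_lattice_def)
  have dual: "dual_polytope \<Delta> M = convex hull (range l)"
  proof (intro equalityI subsetI)
    fix y assume "y \<in> convex hull (range l)"
    moreover have "convex (dual_polytope \<Delta> M)"
    proof -
      have "dual_polytope \<Delta> M = span M \<inter> (\<Inter>x\<in>\<Delta>. {y. x \<bullet> y \<ge> -1})" by (auto simp: dual_polytope_def)
      then show ?thesis
        by (simp add: convex_Int convex_INT convex_halfspace_ge subspace_imp_convex)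
    qed
    moreover have "range l \<subseteq> dual_polytope \<Delta> M" using lspan poly by (auto simp: dual_polytope_def)
    ultimately show "y \<in> dual_polytope \<Delta> M" by (meson hull_minimal subsetD)
  next
    fix y assume y: "y \<in> dual_polytope \<Delta> M"
    let ?a = "\<lambda>i. (p i \<bullet> y + 1) / real (d i)"
    have p\<Delta>: "p i \<in> \<Delta>" for i using rp C by (auto intro: hull_inc)
    have a0: "0 \<le> ?a i" for i
    proof -
      have "-1 \<le> p i \<bullet> y" using y p\<Delta>[of i] by (simp add: dual_polytope_def)
      then show ?thesis using d1[of i] by (intro divide_nonneg_nonneg) linarith+
    qed
    have "0 = (\<Sum>j\<in>UNIV. (1 / real (d j)) *\<^sub>R p j) \<bullet> y" using bary by simp
    then have a1: "(\<Sum>i\<in>UNIV. ?a i) = 1"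
      using d(2) by (simp add: inner_sum_left add_divide_distrib sum.distrib)
    \<comment> \<open>The error of the proposed barycentric expansion pairs to zero with every
      vertex. The vertices span, so it pairs to zero with itself.\<close>
    define z where "z = y - (\<Sum>i\<in>UNIV. ?a i *\<^sub>R l i)"
    have "z \<in> span M" using y lspan unfolding z_def dual_polytope_def
      by (intro span_diff span_sum span_scale) auto
    have pz: "p j \<bullet> z = 0" for j
    proof -
      have "p j \<bullet> (\<Sum>i\<in>UNIV. ?a i *\<^sub>R l i) = (\<Sum>i\<in>UNIV. ?a i * ((if j = i then real (d j) else 0) - 1))"
        by (simp add: inner_sum_right pl)
      also have "\<dots> = ?a j * real (d j) - (\<Sum>i\<in>UNIV. ?a i)" by (rule sum_delta_minus_one(2))
      also have "\<dots> = p j \<bullet> y" using a1 d(1)[of j] by simp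
      finally show ?thesis by (simp add: z_def inner_diff_right)
    qed
    have "z \<bullet> z = 0"
    proof -
      have "span (range p) \<subseteq> {x. x \<bullet> z = 0}"
        by (rule span_minimal) (use pz in \<open>auto simp: subspace_def inner_add_left\<close>)
      then show ?thesis using \<open>z \<in> span M\<close> spanM by auto
    qed
    then have "y = (\<Sum>i\<in>UNIV. ?a i *\<^sub>R l i)" by (simp add: z_def)
    moreover have "(\<Sum>i\<in>UNIV. ?a i *\<^sub>R l i) \<in> convex hull (range l)"
      by (rule convex_sum) (use a0 a1 in \<open>auto intro: hull_inc\<close>)
    ultimately show "y \<in> convex hull (range l)" by simp
  qed
  have injl: "inj l"
  proof (rule injI, rule ccontr)
    fix i j assume "l i = l j" "i \<noteq> j"
    then show False using pl[of i i] pl[of i j] d(1)[of i] by simp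
  qed
  have aff_l: "\<not> affine_dependent (range l)"
  proof
    assume "affine_dependent (range l)"
    then obtain U where U: "sum U (range l) = 0" "\<exists>v\<in>range l. U v \<noteq> 0" "(\<Sum>v\<in>range l. U v *\<^sub>R v) = 0"
      using affine_dependent_explicit_finite[of "range l"] by auto
    then obtain j where j: "U (l j) \<noteq> 0" by blast
    \<comment> \<open>Pairing an affine relation between the normals with \<open>p j\<close>
      isolates the coefficient of \<open>l j\<close>, multiplied by d_j.\<close>
    have "0 = p j \<bullet> (\<Sum>i\<in>UNIV. U (l i) *\<^sub>R l i)" using U(3) by (simp add: sum.reindex[OF injl] o_def)
    also have "\<dots> = (\<Sum>i\<in>UNIV. U (l i) * ((if j = i then real (d j) else 0) - 1))"
      by (simp add: inner_sum_right pl)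
    also have "\<dots> = U (l j) * real (d j) - (\<Sum>i\<in>UNIV. U (l i))" by (rule sum_delta_minus_one(2))
    also have "(\<Sum>i\<in>UNIV. U (l i)) = 0" using U(1) by (simp add: sum.reindex[OF injl] o_def)
    finally show False using j d(1)[of j] by simp
  qed
  have "reflexive_simplex d \<Delta> M l p"
  proof (intro reflexive_simplex.intro toric_simplex.intro reflexive_simplex_axioms.intro)
    show "{v. v extreme_point_of dual_polytope \<Delta> M} = range l"
      unfolding dual using extreme_point_of_convex_hull_affine_independent[OF aff_l] by blast
    show "Gcd (range (fermat_weights d)) = 1" using weights by (simp add: simplex_with_weights_def)
    show "linear (\<lambda>x. x \<bullet> l i)" for i
      by (rule linearI) (simp_all add: inner_add_left)
    show "x \<bullet> l i \<in> \<int>" if "x \<in> M" for i x using lN[of i] that by (simp add: dual_lattice_def)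
    show "x = 0" if "x \<in> span M" "\<And>i. x \<bullet> l i = 0" for x using recover[OF that(1)] that(2) by simp
    show "p i \<bullet> l j = (if i = j then real (d i) else 0) - 1" for i j by (rule pl)
  qed (use d lattice_props[OF lattice] pM weights0 poly lN in auto)
  then show ?thesis by blast
qed

section \<open>Roots of unity and Bezout coefficients\<close>

lemma cis_2pi_eq_1_iff: "cis (2 * pi * x) = 1 \<longleftrightarrow> x \<in> \<int>"
proof
  assume "cis (2 * pi * x) = 1"
  then have "cos (2 * pi * x) = 1" by (simp add: complex_eq_iff)
  then obtain n :: int where "2 * pi * x = of_int n * 2 * pi" using cos_one_2pi_int by blast
  then have "x = of_int n" by simp
  then show "x \<in> \<int>" by simp
qed simp

lemma monom_at_cis: "monom_at (\<chi> i. cis (\<theta> i)) a = cis (\<Sum>i\<in>UNIV. \<theta> i * of_int (a $ i))"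
proof -
  have "(\<Prod>i\<in>A. cis (f i)) = cis (\<Sum>i\<in>A. f i)" if "finite A" for A and f :: "'a \<Rightarrow> real"
    using that by induction (simp_all add: cis_mult)
  then show ?thesis by (simp add: monom_at_def Complex.cis_power_int mult.commute)
qed

lemma root_of_unity_cis:
  assumes "z ^ n = 1" "n > 0"
  obtains k :: int where "z = cis (2 * pi * (of_int k / real n))"
proof -
  have "z \<in> (\<lambda>k. cis (2 * pi * real k / real n)) ` {..<n}"
    using Complex.bij_betw_roots_unity[OF assms(2)] assms(1) by (auto simp: bij_betw_def)
  then obtain k where "z = cis (2 * pi * real k / real n)" by blast
  then show thesis by (intro that[of "int k"]) simp
qed

lemma int_bezout:
  fixes w :: "'i::finite \<Rightarrow> nat"
  assumes "Gcd (range w) = 1"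
  shows "\<exists>b :: 'i \<Rightarrow> int. (\<Sum>i\<in>UNIV. b i * int (w i)) = 1"
proof -
  let ?A = "{\<Sum>i\<in>UNIV. b i * int (w i) | b. True}"
  have "0 \<in> ?A" by (intro CollectI exI[of _ "\<lambda>_. 0"]) simp
  moreover have "x - y \<in> ?A" if xy: "x \<in> ?A" "y \<in> ?A" for x y
  proof -
    obtain b b' where "x = (\<Sum>i\<in>UNIV. b i * int (w i))" "y = (\<Sum>i\<in>UNIV. b' i * int (w i))" using xy by blast
    then show ?thesis
      by (intro CollectI exI[of _ "\<lambda>i. b i - b' i"]) (simp add: left_diff_distrib sum_subtractf)
  qed
  ultimately obtain r where r: "r \<in> ?A" "\<forall>a\<in>?A. r dvd a" using int_ideal_principal[of ?A] by blast
  have "r dvd int (w j)" for j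
  proof -
    have "int (w j) \<in> ?A"
      by (intro CollectI exI[of _ "\<lambda>i. if i = j then 1 else 0"]) (simp add: if_distrib[of "\<lambda>x. x * _"] cong: if_cong)
    then show ?thesis using r(2) by blast
  qed
  then have "nat \<bar>r\<bar> dvd w j" for j by (simp add: nat_abs_dvd_iff)
  then have "nat \<bar>r\<bar> dvd Gcd (range w)" by (intro Gcd_greatest) auto
  then have "\<bar>r\<bar> = 1" using assms by simp
  then have "r * r = 1" by (metis abs_mult_self_eq mult_1)
  obtain b where "r = (\<Sum>i\<in>UNIV. b i * int (w i))" using r(1) by blast
  then have "(\<Sum>i\<in>UNIV. (r * b i) * int (w i)) = r * r" by (simp add: sum_distrib_left mult.assoc)
  then show ?thesis using \<open>r * r = 1\<close> by (intro exI[of _ "\<lambda>i. r * b i"]) simp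
qed

context reflexive_simplex begin

sublocale W: toric_simplex d "weight_polytope (fermat_weights d)" "weight_lattice (fermat_weights d)"
  "\<lambda>i x. x $ i" "weight_vertex d"
  by (rule toric_simplex_weight) (rule d_pos, rule d_sum)

abbreviation Mw :: "(real ^ 'i) set" where "Mw \<equiv> weight_lattice (fermat_weights d)"
abbreviation \<Delta>w :: "(real ^ 'i) set" where "\<Delta>w \<equiv> weight_polytope (fermat_weights d)"
abbreviation N :: "'v set" where "N \<equiv> dual_lattice M"
abbreviation Xw :: "(nat \<times> (real ^ 'i) \<Rightarrow> complex) set variety" where "Xw \<equiv> toric_variety \<Delta>w Mw"
abbreviation XM :: "(nat \<times> 'v \<Rightarrow> complex) set variety" where "XM \<equiv> toric_variety \<Delta> M"
abbreviation Pw :: "(complex ^ 'i) set set" where "Pw \<equiv> weighted_orbit w ` (UNIV - {0})"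
abbreviation Tw :: "(nat \<times> (real ^ 'i) \<Rightarrow> complex) set set" where "Tw \<equiv> scaling_orbit ` cone_points \<Delta>w Mw"
abbreviation TM :: "(nat \<times> 'v \<Rightarrow> complex) set set" where "TM \<equiv> scaling_orbit ` cone_points \<Delta> M"

text \<open>Pairing with the vertices \<open>l i\<close> of the dual simplex embeds \<open>M\<close> into \<open>M(w)\<close> with finite index and
  carries \<open>\<Delta>\<close> onto \<open>\<Delta>(w)\<close>; over the reals \<open>\<psi>\<close> is its inverse.\<close>

definition \<phi> :: "'v \<Rightarrow> real ^ 'i" where "\<phi> x = (\<chi> i. x \<bullet> l i)"
definition \<psi> :: "real ^ 'i \<Rightarrow> 'v" where "\<psi> m = (\<Sum>i\<in>UNIV. (m $ i / real (d i)) *\<^sub>R p i)"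

lemma \<phi>_nth [simp]: "\<phi> x $ i = x \<bullet> l i"
  by (simp add: \<phi>_def)

lemma linear_\<phi>: "linear \<phi>"
  by (rule linearI) (simp_all add: vec_eq_iff inner_add_left)

lemma linear_\<psi>: "linear \<psi>"
  by (rule linearI) (simp_all add: \<psi>_def add_divide_distrib scaleR_left_distrib sum.distrib scaleR_sum_right)

lemma \<psi>_in: "\<psi> m \<in> span M"
  unfolding \<psi>_def by (intro span_sum span_scale span_base vertex_in)

lemma \<phi>_in: "x \<in> M \<Longrightarrow> \<phi> x \<in> Mw"
  using sum_w_lam[OF span_base] lam_int by (simp add: weight_lattice_def)

text \<open>The subtracted term vanishes on the hyperplane containing M(w), which is why \<psi>
  inverts \<phi> there.\<close>

lemma \<psi>_lam: "\<psi> m \<bullet> l j = m $ j - (\<Sum>i\<in>UNIV. m $ i / real (d i))"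
  using lam_vertex_sum[of "\<lambda>i. m $ i / real (d i)" j] d_pos[of j] by (simp add: \<psi>_def)

lemma \<psi>_\<phi>:
  assumes "x \<in> span M" shows "\<psi> (\<phi> x) = x"
proof -
  have "(\<psi> (\<phi> x) - x) \<bullet> l j = 0" for j
    using lam_weights[OF assms] by (simp add: inner_diff_left \<psi>_lam)
  then show ?thesis using lam_inj[of "\<psi> (\<phi> x) - x"] span_diff[OF \<psi>_in assms] by simp
qed

lemma \<phi>_\<psi>:
  assumes "m \<in> span Mw" shows "\<phi> (\<psi> m) = m"
  using W.lam_weights[OF assms] by (simp add: vec_eq_iff \<psi>_lam)

lemma inj_\<phi>: "inj_on \<phi> (span M)"
  using \<psi>_\<phi> by (metis inj_onI)

lemma cone_\<phi>: "m \<in> M \<Longrightarrow> (k, \<phi> m) \<in> cone_monoid \<Delta>w Mw \<longleftrightarrow> (k, m) \<in> cone_monoid \<Delta> M"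
  by (simp add: W.cone_iff cone_iff \<phi>_in)

lemma expo_\<phi>: "W.expo k (\<phi> m) = expo k m"
  by (simp add: W.expo_def expo_def)

lemma vertex_barycenter: "(\<Sum>i\<in>UNIV. (1 / real (d i)) *\<^sub>R p i) = 0"
proof (rule lam_inj)
  show "(\<Sum>i\<in>UNIV. (1 / real (d i)) *\<^sub>R p i) \<in> span M"
    by (intro span_sum span_scale span_base vertex_in)
  show "(\<Sum>i\<in>UNIV. (1 / real (d i)) *\<^sub>R p i) \<bullet> l j = 0" for j
    using lam_vertex_sum[of "\<lambda>i. 1 / real (d i)" j] d_pos[of j] d_sum by simp
qed

subsection \<open>The lattice generated by the vertices of the dual polytope\<close>

definition \<Gamma> :: "'v monoid" where "\<Gamma> = additive_group N"
definition H :: "'v set" where "H = generate \<Gamma> {v. v extreme_point_of dual_polytope \<Delta> M}"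

lemma \<Gamma>_simps [simp]: "carrier \<Gamma> = N" "x \<otimes>\<^bsub>\<Gamma>\<^esub> y = x + y" "\<one>\<^bsub>\<Gamma>\<^esub> = 0"
  by (simp_all add: \<Gamma>_def additive_group_def)

lemma N_uminus: "y \<in> N \<Longrightarrow> - y \<in> N"
  using dual_lattice_scale[of y M "-1"] by simp

lemma N_diff: "x \<in> N \<Longrightarrow> y \<in> N \<Longrightarrow> x - y \<in> N"
  using dual_lattice_add[of x M "- y"] N_uminus[of y] by simp

lemma comm_group_\<Gamma>: "comm_group \<Gamma>"
proof (rule comm_groupI)
  show "\<exists>y\<in>carrier \<Gamma>. y \<otimes>\<^bsub>\<Gamma>\<^esub> x = \<one>\<^bsub>\<Gamma>\<^esub>" if "x \<in> carrier \<Gamma>" for x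
    using N_uminus that by (intro bexI[of _ "- x"]) auto
qed (auto simp: dual_lattice_zero dual_lattice_add)

lemma inv_\<Gamma>: "x \<in> N \<Longrightarrow> inv\<^bsub>\<Gamma>\<^esub> x = - x"
proof -
  interpret comm_group \<Gamma> by (rule comm_group_\<Gamma>)
  show "x \<in> N \<Longrightarrow> inv\<^bsub>\<Gamma>\<^esub> x = - x" by (rule inv_equality) (auto simp: N_uminus)
qed

lemma subgroup_H: "subgroup H \<Gamma>"
proof -
  interpret comm_group \<Gamma> by (rule comm_group_\<Gamma>)
  show ?thesis unfolding H_def dual_extreme by (rule generate_is_subgroup) (auto simp: normal_in_dual)
qed

lemma H_zero: "0 \<in> H" and H_add: "x \<in> H \<Longrightarrow> y \<in> H \<Longrightarrow> x + y \<in> H" and H_sub: "H \<subseteq> N"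
  using subgroup.one_closed[OF subgroup_H] subgroup.m_closed[OF subgroup_H, of x y] subgroup.subset[OF subgroup_H]
  by auto

lemma H_uminus: "x \<in> H \<Longrightarrow> - x \<in> H"
  using subgroup.m_inv_closed[OF subgroup_H, of x] inv_\<Gamma>[of x] H_sub by auto

lemma H_scale: "x \<in> H \<Longrightarrow> of_int n *\<^sub>R x \<in> H"
proof (induction n rule: int_induct[where k = 0])
  case base then show ?case using H_zero by simp
next
  case (step1 i) then show ?case using H_add[of "of_int i *\<^sub>R x" x] by (simp add: scaleR_left_distrib)
next
  case (step2 i) then show ?case using H_add[of "of_int i *\<^sub>R x" "- x"] H_uminus[of x]
    by (simp add: scaleR_left_diff_distrib)
qed

lemma normal_in_H: "l i \<in> H"
  unfolding H_def dual_extreme by (rule generate.incl) simp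

lemma H_combination: "(\<Sum>i\<in>A. of_int (c i) *\<^sub>R l i) \<in> H"
  by (induction A rule: infinite_finite_induct) (auto simp: H_zero H_add H_scale normal_in_H)

lemma span_eq_zeroI:
  assumes "z \<in> span M" "\<And>j. p j \<bullet> z = 0" shows "z = 0"
proof -
  have "\<psi> (\<phi> z) \<bullet> z = 0" unfolding \<psi>_def inner_sum_left using assms(2) by simp
  then show ?thesis using \<psi>_\<phi>[OF assms(1)] by simp
qed

lemma vertex_normal: "p j \<bullet> (\<Sum>i\<in>UNIV. c i *\<^sub>R l i) = c j * real (d j) - (\<Sum>i\<in>UNIV. c i)"
  unfolding inner_sum_right inner_scaleR_right lam_vertex
  by (rule sum_delta_minus_one(2))

text \<open>Counterpart of the expansion in vertices: the difference of the two sides is orthogonal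
  to every vertex.\<close>

lemma normal_expansion:
  assumes "y \<in> span M"
  shows "y = (\<Sum>i\<in>UNIV. (p i \<bullet> y / real (d i)) *\<^sub>R l i)"
proof -
  have ls: "l i \<in> span M" for i using normal_in_dual by (simp add: dual_lattice_def)
  have "(\<Sum>i\<in>UNIV. p i \<bullet> y / real (d i)) = (\<Sum>i\<in>UNIV. (1 / real (d i)) *\<^sub>R p i) \<bullet> y"
    by (simp add: inner_sum_left)
  then have 0: "(\<Sum>i\<in>UNIV. p i \<bullet> y / real (d i)) = 0" by (simp add: vertex_barycenter)
  have "y - (\<Sum>i\<in>UNIV. (p i \<bullet> y / real (d i)) *\<^sub>R l i) = 0"
  proof (rule span_eq_zeroI)
    show "y - (\<Sum>i\<in>UNIV. (p i \<bullet> y / real (d i)) *\<^sub>R l i) \<in> span M"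
      by (intro span_diff assms span_sum span_scale ls)
    show "p j \<bullet> (y - (\<Sum>i\<in>UNIV. (p i \<bullet> y / real (d i)) *\<^sub>R l i)) = 0" for j
      using 0 d_pos[of j] by (simp add: inner_diff_right vertex_normal)
  qed
  then show ?thesis by simp
qed

text \<open>The dual simplex satisfies the same relation as the simplex: pairing with
  \<open>p j\<close> gives w_j d_j minus the sum of the weights, which is L - L.\<close>

lemma normals_relation: "(\<Sum>i\<in>UNIV. real (w i) *\<^sub>R l i) = 0"
proof (rule span_eq_zeroI)
  show "(\<Sum>i\<in>UNIV. real (w i) *\<^sub>R l i) \<in> span M"
    using normal_in_dual by (intro span_sum span_scale) (auto simp: dual_lattice_def)
  show "p j \<bullet> (\<Sum>i\<in>UNIV. real (w i) *\<^sub>R l i) = 0" for j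
    using sum_w w_mult_d[of j] unfolding vertex_normal by (metis of_nat_mult of_nat_sum diff_self)
qed

text \<open>An integral linear form on \<open>M(w)\<close> extends to \<open>\<int>\<^sup>n\<^sup>+\<^sup>1\<close> because \<open>M(w)\<close> is the kernel of the
  primitive form \<open>w\<close>; the extension is made explicit by Bezout coefficients of the weights.\<close>

lemma in_H_of_integral:
  assumes y: "y \<in> N" and int: "\<And>m. m \<in> Mw \<Longrightarrow> \<psi> m \<bullet> y \<in> \<int>"
  shows "y \<in> H"
proof -
  define c where "c i = p i \<bullet> y / real (d i)" for i
  have pair: "\<psi> m \<bullet> y = (\<Sum>i\<in>UNIV. m $ i * c i)" for m
    by (simp add: \<psi>_def inner_sum_left c_def)
  obtain b :: "'i \<Rightarrow> int" where b: "(\<Sum>i\<in>UNIV. b i * int (w i)) = 1"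
    using int_bezout[OF weights_coprime] by blast
  define \<beta> where "\<beta> = (\<Sum>i\<in>UNIV. of_int (b i) * c i)"
  have "c i - real (w i) * \<beta> \<in> \<int>" for i
  proof -
    \<comment> \<open>The vector e_i - w_i b lies in M(w) because \<open>b\<close> has weighted sum
      1. Integrality of \<open>y\<close> on it is integrality of c_i - w_i \<beta>.\<close>
    define m where "m = (\<chi> j. (if j = i then 1 else 0) - real (w i) * of_int (b j))"
    have "(\<Sum>j\<in>UNIV. real (w j) * m $ j) =
        (\<Sum>j\<in>UNIV. (if j = i then real (w i) else 0) - real (w i) * of_int (b j * int (w j)))"
      by (intro sum.cong refl) (simp add: m_def algebra_simps)
    also have "\<dots> = real (w i) - real (w i) * of_int (\<Sum>j\<in>UNIV. b j * int (w j))"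
      by (simp add: sum_subtractf sum_distrib_left)
    finally have "m \<in> Mw" unfolding b by (simp add: weight_lattice_def m_def)
    moreover have "\<psi> m \<bullet> y = c i - real (w i) * \<beta>"
    proof -
      have "\<psi> m \<bullet> y = (\<Sum>j\<in>UNIV. (if j = i then c i else 0) - real (w i) * (of_int (b j) * c j))"
        unfolding pair by (intro sum.cong refl) (simp add: m_def algebra_simps)
      then show ?thesis by (simp add: sum_subtractf \<beta>_def sum_distrib_left)
    qed
    ultimately show ?thesis using int by metis
  qed
  then have n: "c i - real (w i) * \<beta> = of_int \<lfloor>c i - real (w i) * \<beta>\<rfloor>" for i by simp
  \<comment> \<open>Subtracting \<beta> times the relation between the normals changes the
    coefficients c_i into the integers just found, without changing \<open>y\<close>.\<close>
  have "y = (\<Sum>i\<in>UNIV. c i *\<^sub>R l i) - \<beta> *\<^sub>R (\<Sum>i\<in>UNIV. real (w i) *\<^sub>R l i)"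
    using normal_expansion[of y] y by (simp add: normals_relation dual_lattice_def c_def)
  also have "\<dots> = (\<Sum>i\<in>UNIV. (c i - real (w i) * \<beta>) *\<^sub>R l i)"
    by (simp add: scaleR_left_diff_distrib sum_subtractf scaleR_sum_right mult.commute)
  also have "\<dots> = (\<Sum>i\<in>UNIV. of_int \<lfloor>c i - real (w i) * \<beta>\<rfloor> *\<^sub>R l i)" by (subst n) (rule refl)
  also have "\<dots> \<in> H" by (rule H_combination)
  finally show ?thesis .
qed

text \<open>Pairing \<psi> m with a generator \<open>l j\<close> returns the coordinate m_j, an
  integer.\<close>

lemma integral_of_in_H:
  assumes "y \<in> H" "m \<in> Mw" shows "\<psi> m \<bullet> y \<in> \<int>"
  using assms(1) unfolding H_def dual_extreme
proof (induction rule: generate.induct)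
  case (incl h)
  then show ?case using assms(2) W.lam_weights[OF span_base[OF assms(2)]]
    by (auto simp: \<psi>_lam weight_lattice_def)
next
  case (inv h)
  then have "h \<in> N" using normal_in_dual by auto
  then show ?case using inv assms(2) W.lam_weights[OF span_base[OF assms(2)]]
    by (auto simp: inv_\<Gamma> \<psi>_lam weight_lattice_def)
qed (auto simp: inner_add_right)

abbreviation \<pi> :: "'v set monoid" where "\<pi> \<equiv> fundamental_group \<Delta> M"

lemma \<pi>_eq: "\<pi> = \<Gamma> Mod H"
  by (simp add: fundamental_group_def Let_def \<Gamma>_def H_def)

lemma comm_group_\<pi>: "comm_group \<pi>"
proof -
  interpret comm_group \<Gamma> by (rule comm_group_\<Gamma>)
  show ?thesis unfolding \<pi>_eq by (rule abelian_FactGroup[OF subgroup_H])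
qed

definition coset :: "'v \<Rightarrow> 'v set" where "coset y = H #>\<^bsub>\<Gamma>\<^esub> y"

lemma carrier_\<pi>: "carrier \<pi> = coset ` N"
  unfolding \<pi>_eq carrier_FactGroup coset_def by simp

lemma coset_iff: "z \<in> coset y \<longleftrightarrow> z - y \<in> H"
proof
  show "z - y \<in> H \<Longrightarrow> z \<in> coset y"
    unfolding coset_def r_coset_def by (auto intro!: bexI[of _ "z - y"])
qed (auto simp: coset_def r_coset_def)

lemma coset_self: "y \<in> coset y"
  by (simp add: coset_iff H_zero)

lemma coset_eqI: "y - z \<in> H \<Longrightarrow> coset y = coset z"
proof -
  assume yz: "y - z \<in> H"
  have "x - y \<in> H \<longleftrightarrow> x - z \<in> H" for x
    using H_add[OF _ yz, of "x - y"] H_add[OF _ H_uminus[OF yz], of "x - z"] by auto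
  then show "coset y = coset z" by (auto simp: coset_iff)
qed

lemma coset_sub: "y \<in> N \<Longrightarrow> coset y \<subseteq> N"
proof
  fix z assume "y \<in> N" "z \<in> coset y"
  then have "(z - y) + y \<in> N" using H_sub by (intro dual_lattice_add) (auto simp: coset_iff)
  then show "z \<in> N" by simp
qed

lemma coset_mult:
  assumes "y \<in> N" "z \<in> N" shows "coset y \<otimes>\<^bsub>\<pi>\<^esub> coset z = coset (y + z)"
proof -
  interpret comm_group \<Gamma> by (rule comm_group_\<Gamma>)
  have "H \<lhd> \<Gamma>" by (rule subgroup_imp_normal[OF subgroup_H])
  from normal.rcos_sum[OF this, of y z] show ?thesis
    using assms by (simp add: \<pi>_eq FactGroup_def coset_def)
qed

text \<open>By the expansion in the normals, a vector of \<open>N\<close> is determined modulo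
  \<open>H\<close> by the residues modulo d_i of its pairings with the vertices \<open>p i\<close>,
  and there are finitely many tuples of residues.\<close>

lemma finite_\<pi>: "finite (carrier \<pi>)"
proof -
  define f where "f y = (\<lambda>i. \<lfloor>p i \<bullet> y\<rfloor> mod int (d i))" for y
  have pint: "p i \<bullet> y = of_int \<lfloor>p i \<bullet> y\<rfloor>" if "y \<in> N" for y i
    using that vertex_in[of i] by (simp add: dual_lattice_def)
  have eq: "coset y = coset z" if yz: "y \<in> N" "z \<in> N" "f y = f z" for y z
  proof (rule coset_eqI)
    have "\<exists>k. p i \<bullet> (y - z) / real (d i) = of_int k" for i
    proof -
      have "\<lfloor>p i \<bullet> y\<rfloor> mod int (d i) = \<lfloor>p i \<bullet> z\<rfloor> mod int (d i)"
        using fun_cong[OF yz(3), of i] by (simp add: f_def)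
      then have "int (d i) dvd \<lfloor>p i \<bullet> y\<rfloor> - \<lfloor>p i \<bullet> z\<rfloor>" by (simp add: mod_eq_dvd_iff)
      then obtain k where "\<lfloor>p i \<bullet> y\<rfloor> - \<lfloor>p i \<bullet> z\<rfloor> = int (d i) * k" by blast
      then have "real_of_int (\<lfloor>p i \<bullet> y\<rfloor> - \<lfloor>p i \<bullet> z\<rfloor>) = real (d i) * of_int k" by simp
      then have "p i \<bullet> (y - z) = real (d i) * of_int k"
        using pint[OF yz(1), of i] pint[OF yz(2), of i] by (simp add: inner_diff_right)
      then show ?thesis using d_pos[of i] by (intro exI[of _ k]) simp
    qed
    then obtain k where k: "\<And>i. p i \<bullet> (y - z) / real (d i) = of_int (k i)" by metis
    have "y - z \<in> span M" using N_diff[OF yz(1,2)] by (simp add: dual_lattice_def)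
    from normal_expansion[OF this] show "y - z \<in> H" using H_combination[of k UNIV] by (simp add: k)
  qed
  have fin: "finite (f ` N)"
  proof (rule finite_subset)
    show "f ` N \<subseteq> (\<Pi>\<^sub>E i\<in>UNIV. {0..<int (d i)})"
      using d_pos by (auto simp: f_def)
    show "finite (\<Pi>\<^sub>E i\<in>UNIV. {0..<int (d i)})" by (intro finite_PiE) auto
  qed
  have "carrier \<pi> \<subseteq> (\<lambda>u. coset (SOME y. y \<in> N \<and> f y = u)) ` f ` N"
  proof
    fix g assume "g \<in> carrier \<pi>"
    then obtain y where y: "y \<in> N" "g = coset y" by (auto simp: carrier_\<pi>)
    let ?z = "SOME z. z \<in> N \<and> f z = f y"
    have "?z \<in> N \<and> f ?z = f y" by (rule someI[of _ y]) (simp add: y)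
    then have "g = coset ?z" using eq y by metis
    then show "g \<in> (\<lambda>u. coset (SOME y. y \<in> N \<and> f y = u)) ` f ` N" using y(1) by blast
  qed
  then show ?thesis using fin finite_subset by blast
qed

end

subsection \<open>The action of the fundamental group\<close>

context reflexive_simplex begin

sublocale qw: cone_quotient Pw "weighted_forms (fermat_weights d)" Tw "toric_sections \<Delta>w Mw" W.cox_map
  by (rule W.cone_quotient_cox)

sublocale qM: cone_quotient Pw "weighted_forms (fermat_weights d)" TM "toric_sections \<Delta> M" cox_map
  by (rule cone_quotient_cox)

lemma Xw_eq: "Xw = qw.tgt.X"
  by (simp add: toric_variety_def)

lemma XM_eq: "XM = qM.tgt.X"
  by (simp add: toric_variety_def)

lemma points_Xw [simp]: "points Xw = Tw" and points_XM [simp]: "points XM = TM"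
  by (simp_all add: Xw_eq XM_eq)

lemma carrier_\<pi>E: "g \<in> carrier \<pi> \<Longrightarrow> \<exists>y. y \<in> N \<and> g = coset y"
  unfolding carrier_\<pi> by (elim imageE) blast

definition \<tau> :: "'v \<Rightarrow> real ^ 'i \<Rightarrow> complex" where "\<tau> y m = cis (2 * pi * (\<psi> m \<bullet> y))"

lemma \<tau>_add: "\<tau> (y + z) m = \<tau> y m * \<tau> z m"
  by (simp add: \<tau>_def inner_add_right distrib_left cis_mult)

lemma \<tau>_lattice_add: "\<tau> y (m + m') = \<tau> y m * \<tau> y m'"
  by (simp add: \<tau>_def linear_add[OF linear_\<psi>] inner_add_left distrib_left cis_mult)

lemma \<tau>_zero [simp]: "\<tau> 0 m = 1" "\<tau> y 0 = 1"
  by (simp_all add: \<tau>_def linear_0[OF linear_\<psi>])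

lemma \<tau>_nonzero [simp]: "\<tau> y m \<noteq> 0"
  by (simp add: \<tau>_def)

lemma \<tau>_torus: "\<tau> y \<in> torus Mw"
  by (simp add: torus_def \<tau>_lattice_add)

lemma \<tau>_\<phi>:
  assumes "x \<in> M" "y \<in> N" shows "\<tau> y (\<phi> x) = 1"
  using assms by (simp add: \<tau>_def \<psi>_\<phi> span_base dual_lattice_def)

lemma \<tau>_eq_1_iff: "y \<in> N \<Longrightarrow> (\<forall>m\<in>Mw. \<tau> y m = 1) \<longleftrightarrow> y \<in> H"
  using in_H_of_integral integral_of_in_H by (auto simp: \<tau>_def cis_2pi_eq_1_iff)

definition T :: "'v \<Rightarrow> (nat \<times> (real ^ 'i) \<Rightarrow> complex) \<Rightarrow> nat \<times> (real ^ 'i) \<Rightarrow> complex" where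
  "T y \<xi> = (\<lambda>(k, m). \<tau> y m * \<xi> (k, m))"

lemma torus_translation_\<tau>: "torus_translation (\<tau> y) x = T y ` x"
  by (simp add: torus_translation_def T_def)

lemma T_add: "T y (T z \<xi>) = T (y + z) \<xi>"
  by (auto simp: T_def \<tau>_add fun_eq_iff)

lemma T_zero: "T 0 \<xi> = \<xi>"
  by (auto simp: T_def fun_eq_iff)

lemma T_cone:
  assumes \<xi>: "\<xi> \<in> cone_points \<Delta>w Mw" shows "T y \<xi> \<in> cone_points \<Delta>w Mw"
proof -
  obtain k m where km: "(k, m) \<in> cone_monoid \<Delta>w Mw" "k > 0" "\<xi> (k, m) \<noteq> 0"
    using \<xi> unfolding cone_points_def by blast
  have "\<xi> (0, 0) = 1" "\<And>k m. (k, m) \<notin> cone_monoid \<Delta>w Mw \<Longrightarrow> \<xi> (k, m) = 0"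
    using \<xi> by (auto simp: cone_points_def)
  then show ?thesis using km cone_points_mult[OF \<xi>]
    by (intro cone_pointsI[OF _ _ _ km(1)]) (auto simp: T_def \<tau>_lattice_add)
qed

lemma T_orbit: "T y ` scaling_orbit \<xi> = scaling_orbit (T y \<xi>)"
proof -
  have "T y (\<lambda>(k, m). c ^ k * \<xi> (k, m)) = (\<lambda>(k, m). c ^ k * T y \<xi> (k, m))" for c
    by (auto simp: T_def fun_eq_iff)
  then show ?thesis unfolding scaling_orbit_def by (auto simp: image_iff) metis
qed

lemma T_in: "x \<in> Tw \<Longrightarrow> T y ` x \<in> Tw"
  using T_cone T_orbit by blast

lemma T_cong:
  assumes "\<xi> \<in> cone_points \<Delta>w Mw" "y \<in> N" "z \<in> N" "y - z \<in> H"
  shows "T y \<xi> = T z \<xi>"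
proof
  fix a :: "nat \<times> (real ^ 'i)"
  obtain k m where a: "a = (k, m)" by (cases a)
  show "T y \<xi> a = T z \<xi> a"
  proof (cases "(k, m) \<in> cone_monoid \<Delta>w Mw")
    case True
    have "\<tau> (y - z) m = 1" using assms(4) H_sub \<tau>_eq_1_iff W.cone_in[OF True] by blast
    then have "\<tau> y m = \<tau> z m" using \<tau>_add[of "y - z" z m] by simp
    then show ?thesis by (simp add: T_def a)
  next
    case False then show ?thesis using assms(1) by (auto simp: T_def a cone_points_def)
  qed
qed

lemma cone_map_T: "cone_map Tw (toric_sections \<Delta>w Mw) Tw (toric_sections \<Delta>w Mw) (T y)"
proof unfold_locales
  show "T y ` x \<in> Tw" if "x \<in> Tw" for x using that by (rule T_in)
  fix k
  show "\<exists>l. \<forall>h\<in>toric_sections \<Delta>w Mw k. \<exists>h'\<in>toric_sections \<Delta>w Mw l. \<forall>x\<in>Tw. \<forall>c\<in>x. h' c = h (T y c)"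
  proof (intro exI[of _ k] ballI)
    fix h assume "h \<in> toric_sections \<Delta>w Mw k"
    then obtain A g where A: "finite A" "\<And>m. m \<in> A \<Longrightarrow> (k, m) \<in> cone_monoid \<Delta>w Mw"
      "h = (\<lambda>\<xi>. \<Sum>m\<in>A. g m * \<xi> (k, m))" by (elim toric_sectionsE) (rule that)
    have "(\<lambda>\<xi>. \<Sum>m\<in>A. (g m * \<tau> y m) * \<xi> (k, m)) \<in> toric_sections \<Delta>w Mw k"
      using A by (intro toric_sections_sum) auto
    then show "\<exists>h'\<in>toric_sections \<Delta>w Mw k. \<forall>x\<in>Tw. \<forall>c\<in>x. h' c = h (T y c)"
      by (rule bexI[rotated]) (simp add: A(3) T_def mult.assoc)
  qed
qed

text \<open>Group elements are cosets, so a representative has to be chosen; by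
  \<open>act_coset\<close> the choice is immaterial at points of the toric variety.\<close>

definition act :: "'v set \<Rightarrow> (nat \<times> (real ^ 'i) \<Rightarrow> complex) set \<Rightarrow> (nat \<times> (real ^ 'i) \<Rightarrow> complex) set" where
  "act g = torus_translation (\<tau> (SOME y. y \<in> g))"

lemma act_coset:
  assumes y: "y \<in> N" and x: "x \<in> Tw" shows "act (coset y) x = T y ` x"
proof -
  let ?z = "SOME z. z \<in> coset y"
  have z: "?z \<in> coset y" by (rule someI[of _ y]) (rule coset_self)
  have "T ?z \<xi> = T y \<xi>" if "\<xi> \<in> x" for \<xi>
    using z coset_sub[OF y] cone_point_of_orbit(1)[OF x that] y
    by (intro T_cong) (auto simp: coset_iff)
  then show ?thesis by (simp add: act_def torus_translation_\<tau>)
qed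

lemma T_T_image: "T y ` T z ` x = T (y + z) ` x"
  by (simp add: image_image T_add)

lemma T_uminus_image: "T (- y) ` T y ` x = x" "T y ` T (- y) ` x = x"
  by (simp_all add: T_T_image T_zero)

lemma isomorphism_act:
  assumes "g \<in> carrier \<pi>" shows "isomorphism Xw Xw (act g)"
proof -
  obtain y where y: "y \<in> N" "g = coset y" using carrier_\<pi>E[OF assms] by blast
  interpret a: cone_map Tw "toric_sections \<Delta>w Mw" Tw "toric_sections \<Delta>w Mw" "T y" by (rule cone_map_T)
  interpret b: cone_map Tw "toric_sections \<Delta>w Mw" Tw "toric_sections \<Delta>w Mw" "T (- y)" by (rule cone_map_T)
  have "morphism Xw Xw (act g)" unfolding Xw_eq by (rule a.morphism_image) (simp only: y act_coset)
  moreover have "morphism Xw Xw (image (T (- y)))" unfolding Xw_eq by (rule b.morphism_image) (rule refl)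
  moreover have "T (- y) ` act g x = x" "act g (T (- y) ` x) = x" if "x \<in> Tw" for x
    using that y T_in by (simp_all only: act_coset T_uminus_image)
  ultimately show ?thesis unfolding isomorphism_def points_Xw by blast
qed

lemma isomorphism_act_subvariety:
  assumes g: "g \<in> carrier \<pi>" and Z: "Z \<subseteq> Tw" "\<And>y x. y \<in> N \<Longrightarrow> x \<in> Z \<Longrightarrow> T y ` x \<in> Z"
  shows "isomorphism (subvariety Xw Z) (subvariety Xw Z) (act g)"
proof -
  obtain y where y: "y \<in> N" "g = coset y" using carrier_\<pi>E[OF g] by blast
  interpret a: cone_map Tw "toric_sections \<Delta>w Mw" Tw "toric_sections \<Delta>w Mw" "T y" by (rule cone_map_T)
  interpret b: cone_map Tw "toric_sections \<Delta>w Mw" Tw "toric_sections \<Delta>w Mw" "T (- y)" by (rule cone_map_T)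
  have act: "act g x = T y ` x" if "x \<in> Z" for x using that Z(1) y act_coset by blast
  have "morphism (subvariety Xw Z) (subvariety Xw Z) (act g)"
    unfolding Xw_eq by (rule a.morphism_image_subvariety[OF Z(1) Z(1)]) (use act Z(2) y(1) in auto)
  moreover have "morphism (subvariety Xw Z) (subvariety Xw Z) (image (T (- y)))"
    unfolding Xw_eq by (rule b.morphism_image_subvariety[OF Z(1) Z(1)]) (use Z(2) N_uminus[OF y(1)] in auto)
  moreover have "T (- y) ` act g x = x" "act g (T (- y) ` x) = x" if "x \<in> Z" for x
    using act[OF that] act[OF Z(2)[OF N_uminus[OF y(1)] that]] by (simp_all only: T_uminus_image)
  moreover have "points (subvariety Xw Z) \<subseteq> Z" by simp
  ultimately show ?thesis unfolding isomorphism_def by blast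
qed

text \<open>\<open>E\<close> ranges over all stable sets of points, so that one proof covers the
  toric variety and the invariant hypersurfaces in it.\<close>

lemma group_action_act:
  assumes E: "E \<subseteq> Tw" "\<And>y x. y \<in> N \<Longrightarrow> x \<in> E \<Longrightarrow> T y ` x \<in> E"
  shows "group_action \<pi> E (\<lambda>g. restrict (act g) E)"
proof -
  have act: "act (coset y) x = T y ` x" if "y \<in> N" "x \<in> E" for x y using that E(1) act_coset by blast
  have bij: "restrict (act g) E \<in> Bij E" if "g \<in> carrier \<pi>" for g
  proof -
    obtain y where y: "y \<in> N" "g = coset y" using carrier_\<pi>E[OF \<open>g \<in> carrier \<pi>\<close>] by blast
    have "bij_betw (image (T y)) E E"
      by (rule bij_betw_byWitness[where f' = "image (T (- y))"])
         (use T_uminus_image E(2) y N_uminus[OF y(1)] in auto)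
    then have "bij_betw (restrict (act g) E) E E"
      by (rule bij_betw_cong[THEN iffD1, rotated]) (simp add: y act)
    then show ?thesis by (simp add: Bij_def)
  qed
  have mult: "restrict (act (g \<otimes>\<^bsub>\<pi>\<^esub> h)) E = compose E (restrict (act g) E) (restrict (act h) E)"
    if gh: "g \<in> carrier \<pi>" "h \<in> carrier \<pi>" for g h
  proof -
    obtain y z where yz: "y \<in> N" "g = coset y" "z \<in> N" "h = coset z" using carrier_\<pi>E[OF gh(1)] carrier_\<pi>E[OF gh(2)] by blast
    have "act (coset (y + z)) x = act (coset y) (act (coset z) x)" if "x \<in> E" for x
      using act[OF dual_lattice_add[OF yz(1,3)] that] act[OF yz(3) that] act[OF yz(1) E(2)[OF yz(3) that]]
      by (simp add: T_T_image)
    then show ?thesis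
      using E(2) yz by (auto simp: coset_mult compose_def fun_eq_iff act)
  qed
  have "group \<pi>" using comm_group_\<pi> by (simp add: comm_group_def)
  moreover have "(\<lambda>g. restrict (act g) E) \<in> hom \<pi> (BijGroup E)"
    unfolding hom_def using bij mult by (auto simp: BijGroup_def)
  ultimately show ?thesis
    by (intro group_action.intro group_hom.intro group_hom_axioms.intro group_BijGroup)
qed

lemma cone_large: "m \<in> Mw \<Longrightarrow> \<exists>k. (k, m) \<in> cone_monoid \<Delta>w Mw"
proof -
  assume m: "m \<in> Mw"
  define k where "k = nat \<lceil>\<Sum>i\<in>UNIV. \<bar>m $ i\<bar>\<rceil>"
  have "0 \<le> m $ i + real k" for i
  proof -
    have "\<bar>m $ i\<bar> \<le> (\<Sum>i\<in>UNIV. \<bar>m $ i\<bar>)" by (rule member_le_sum) auto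
    also have "\<dots> \<le> real k" unfolding k_def by linarith
    finally show ?thesis by linarith
  qed
  then show "\<exists>k. (k, m) \<in> cone_monoid \<Delta>w Mw" using m by (auto simp: W.cone_iff)
qed

text \<open>Tested at the image of (1, ..., 1), where all coordinates on the cone are 1: an element
  fixing this point multiplies coordinates of degree \<open>k\<close> by the \<open>k\<close>-th
  power of some \<open>c\<close>, and the coordinate at (1, 0) gives \<open>c\<close> = 1. Every
  point of M(w) lies in some multiple of Delta(w), so the character is trivial on M(w) and comes
  from \<open>H\<close>.\<close>

lemma faithful_action_act: "faithful_action \<pi> Tw (\<lambda>g. restrict (act g) Tw)"
proof -
  have "inj_on (\<lambda>g. restrict (act g) Tw) (carrier \<pi>)"
  proof (rule inj_onI)
    fix g h assume gh: "g \<in> carrier \<pi>" "h \<in> carrier \<pi>" and eq: "restrict (act g) Tw = restrict (act h) Tw"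
    obtain y z where yz: "y \<in> N" "g = coset y" "z \<in> N" "h = coset z" using carrier_\<pi>E[OF gh(1)] carrier_\<pi>E[OF gh(2)] by blast
    let ?\<xi> = "W.cox_map (\<chi> i. 1)"
    have "(\<chi> i. 1) \<noteq> (0 :: complex ^ 'i)" by (simp add: vec_eq_iff)
    then have \<xi>: "scaling_orbit ?\<xi> \<in> Tw" using W.cox_map_in by blast
    have "act g (scaling_orbit ?\<xi>) = act h (scaling_orbit ?\<xi>)" 
      using fun_cong[OF eq, of "scaling_orbit ?\<xi>"] unfolding restrict_apply'[OF \<xi>] .
    then have "T (- z) ` T y ` scaling_orbit ?\<xi> = T (- z) ` T z ` scaling_orbit ?\<xi>"
      using yz act_coset \<xi> by simp
    then have "scaling_orbit (T (y - z) ?\<xi>) = scaling_orbit ?\<xi>"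
      by (simp only: T_orbit T_add) (simp add: T_zero)
    then have "T (y - z) ?\<xi> \<in> scaling_orbit ?\<xi>" using scaling_orbit_refl by metis
    then obtain c where c: "c \<noteq> 0" "T (y - z) ?\<xi> = (\<lambda>(k, m). c ^ k * ?\<xi> (k, m))"
      unfolding scaling_orbit_def by blast
    have val: "\<tau> (y - z) m = c ^ k" if km: "(k, m) \<in> cone_monoid \<Delta>w Mw" for k m
    proof -
      have "?\<xi> (k, m) = 1" using km by (simp add: W.cox_map_def monom_at_def)
      then show ?thesis using fun_cong[OF c(2), of "(k, m)"] by (simp add: T_def)
    qed
    have "c = 1" using val[OF W.cone_one_zero] by simp
    then have "\<tau> (y - z) m = 1" if "m \<in> Mw" for m using cone_large[OF that] val by auto
    then have "y - z \<in> H" using \<tau>_eq_1_iff N_diff yz by blast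
    then show "g = h" using yz coset_eqI by simp
  qed
  moreover have "group_action \<pi> Tw (\<lambda>g. restrict (act g) Tw)"
    by (rule group_action_act) (auto simp: T_in)
  ultimately show ?thesis
    by (intro faithful_action.intro faithful_action_axioms.intro)
qed

subsection \<open>The quotient map\<close>

definition R :: "(nat \<times> (real ^ 'i) \<Rightarrow> complex) \<Rightarrow> nat \<times> 'v \<Rightarrow> complex" where
  "R \<xi> = (\<lambda>(k, m). if (k, m) \<in> cone_monoid \<Delta> M then \<xi> (k, \<phi> m) else 0)"

text \<open>The commutative triangle of the two Cox maps. Preimages and images under
  \<open>R\<close> are computed by passing through weighted projective space, where openness and the
  descent of functions are already established.\<close>

lemma R_cox_map: "R (W.cox_map v) = cox_map v"
  by (auto simp: R_def W.cox_map_def cox_map_def fun_eq_iff expo_\<phi> cone_\<phi> cone_in)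

lemma R_cox_image: "R ` W.cox_map ` x = cox_map ` x"
  by (simp add: image_image R_cox_map)

lemma R_T: "y \<in> N \<Longrightarrow> R (T y \<xi>) = R \<xi>"
  by (auto simp: R_def T_def fun_eq_iff \<tau>_\<phi> cone_in)

text \<open>Compares the two groups: the roots of unity that identify points over P_Delta act on
  P_Delta(w) through \<open>N\<close>.\<close>

lemma deck_translation:
  assumes s: "s \<in> deck"
  shows "\<exists>y\<in>N. \<forall>v. W.cox_map (\<chi> i. s $ i * v $ i) = T y (W.cox_map v)"
proof -
  have "\<exists>k :: int. s $ i = cis (2 * pi * (of_int k / real (d i)))" for i
    using root_of_unity_cis[OF deck_root_of_unity[OF s] d_pos] by metis
  then obtain c :: "'i \<Rightarrow> int" where c: "\<And>i. s $ i = cis (2 * pi * (of_int (c i) / real (d i)))" by metis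
  \<comment> \<open>With s_i = exp(2 pi i c_i / d_i), this \<open>y\<close> pairs with \<psi> m, for
    \<open>m\<close> in M(w), to the sum of the m_i c_i / d_i, so its torus element takes the values
    of \<open>s\<close>.\<close>
  define y where "y = (\<Sum>i\<in>UNIV. (of_int (c i) / real (d i)) *\<^sub>R l i)"
  have key: "monom_at s (W.expo k m) = \<tau> y m" if m: "m \<in> Mw" for k m
  proof -
    have "s = (\<chi> i. cis (2 * pi * (of_int (c i) / real (d i))))" using c by (simp add: vec_eq_iff)
    then have "monom_at s (W.expo 0 m) = cis (\<Sum>i\<in>UNIV. 2 * pi * (of_int (c i) / real (d i)) * m $ i)"
      using W.expo_nth[OF m, of 0] by (simp add: monom_at_cis)
    also have "(\<Sum>i\<in>UNIV. 2 * pi * (of_int (c i) / real (d i)) * m $ i) = 2 * pi * (\<psi> m \<bullet> y)"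
      using W.lam_weights[OF span_base[OF m]]
      by (simp add: y_def inner_sum_right \<psi>_lam sum_distrib_left mult.assoc)
    finally have "monom_at s (W.expo 0 m) = \<tau> y m" by (simp add: \<tau>_def)
    \<comment> \<open>The shift by the degree is the exponent of (k, 0), which belongs to the
      exponents of \<open>M\<close> as well, so \<open>s\<close> is trivial on it.\<close>
    moreover have "monom_at s (W.expo k 0) = 1"
      using s expo_in[OF lattice_zero, of k] expo_\<phi>[of k 0] by (simp add: deck_def linear_0[OF linear_\<phi>])
    moreover have "monom_at s (W.expo 0 m + W.expo k 0) = monom_at s (W.expo 0 m) * monom_at s (W.expo k 0)"
      using s by (intro monom_at_add) (auto simp: deck_def)
    ultimately show ?thesis using W.expo_add[OF m W.lattice_zero, of 0 k] by simp
  qed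
  have "y \<in> N"
    unfolding dual_lattice_def
  proof (intro CollectI conjI ballI)
    show "y \<in> span M" using normal_in_dual unfolding y_def dual_lattice_def
      by (intro span_sum span_scale) auto
    fix x assume x: "x \<in> M"
    \<comment> \<open>Triviality of \<open>s\<close> on the exponents of \<open>M\<close> is exactly
      integrality of \<open>y\<close> on \<open>M\<close>.\<close>
    have "\<tau> y (\<phi> x) = 1"
      using key[OF \<phi>_in[OF x], of 0] s expo_in[OF x, of 0] by (simp add: expo_\<phi> deck_def)
    then show "x \<bullet> y \<in> \<int>" using \<psi>_\<phi>[OF span_base[OF x]] by (simp add: \<tau>_def cis_2pi_eq_1_iff)
  qed
  moreover have "W.cox_map (\<chi> i. s $ i * v $ i) = T y (W.cox_map v)" for v
    by (auto simp: fun_eq_iff T_def W.cox_map_def monom_at_mult key W.cone_in)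
  ultimately show ?thesis by blast
qed

text \<open>Lifts to weighted projective space with the same image in P_Delta differ by
  \<open>deck\<close>, so their images in P_Delta(w) differ by an element of \<open>N\<close>.
  Conversely, the torus elements of \<open>N\<close> become trivial on restriction to
  \<open>M\<close>.\<close>

lemma quotient_fibres:
  assumes x: "x \<in> Tw" "x' \<in> Tw"
  shows "R ` x = R ` x' \<longleftrightarrow> (\<exists>g\<in>carrier \<pi>. act g x = x')"
proof
  assume "\<exists>g\<in>carrier \<pi>. act g x = x'"
  then obtain y where "y \<in> N" "act (coset y) x = x'" using carrier_\<pi>E by blast
  then have "y \<in> N" "x' = T y ` x" using act_coset x(1) by auto
  then show "R ` x = R ` x'" by (simp add: image_image R_T)
next
  assume eq: "R ` x = R ` x'"
  obtain v v' where v: "x = W.cox_map ` weighted_orbit w v" "x' = W.cox_map ` weighted_orbit w v'"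
    using qw.surj_orbits[OF x(1)] qw.surj_orbits[OF x(2)] by blast
  then have "cox_map ` weighted_orbit w v = cox_map ` weighted_orbit w v'" using eq by (simp add: R_cox_image)
  from iffD1[OF cox_map_orbit_eq_iff this]
  obtain s where s: "s \<in> deck" "weighted_orbit w v' = weighted_orbit w (\<chi> i. s $ i * v $ i)"
    by (elim bexE)
  obtain y where y: "y \<in> N" "W.cox_map (\<chi> i. s $ i * v $ i) = T y (W.cox_map v)"
    using deck_translation[OF s(1)] by blast
  have "x' = T y ` x" using y(2) by (simp add: v s(2) W.image_cox_map T_orbit)
  then show "\<exists>g\<in>carrier \<pi>. act g x = x'" using y(1) act_coset[OF y(1) x(1)] by (intro bexI[of _ "coset y"]) (auto simp: carrier_\<pi>)
qed

lemma R_in: "x \<in> Tw \<Longrightarrow> R ` x \<in> TM"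
  using qw.surj_orbits qM.image_orbit R_cox_image by metis

lemma R_surj: "image R ` Tw = TM"
proof
  show "image R ` Tw \<subseteq> TM" using R_in by blast
  show "TM \<subseteq> image R ` Tw"
  proof
    fix y assume "y \<in> TM"
    then obtain x where "x \<in> Pw" "y = cox_map ` x" using qM.surj_orbits by blast
    then show "y \<in> image R ` Tw" using qw.image_orbit R_cox_image by (intro image_eqI[of _ _ "W.cox_map ` x"]) auto
  qed
qed

lemma preimage_R: "{x \<in> Tw. R ` x \<in> V} = image W.cox_map ` {x \<in> Pw. cox_map ` x \<in> V}"
proof (intro equalityI subsetI)
  fix x assume x: "x \<in> {x \<in> Tw. R ` x \<in> V}"
  then obtain u where u: "u \<in> Pw" "x = W.cox_map ` u" using qw.surj_orbits by blast
  then have "cox_map ` u \<in> V" using x R_cox_image by simp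
  then show "x \<in> image W.cox_map ` {x \<in> Pw. cox_map ` x \<in> V}" using u by blast
next
  fix x assume "x \<in> image W.cox_map ` {x \<in> Pw. cox_map ` x \<in> V}"
  then obtain u where u: "u \<in> Pw" "cox_map ` u \<in> V" "x = W.cox_map ` u" by blast
  then show "x \<in> {x \<in> Tw. R ` x \<in> V}" using qw.image_orbit R_cox_image by simp
qed

lemma image_R:
  assumes "U \<subseteq> Tw" shows "image R ` U = image cox_map ` {x \<in> Pw. W.cox_map ` x \<in> U}"
proof (intro equalityI subsetI)
  fix y assume "y \<in> image R ` U"
  then obtain x where x: "x \<in> U" "y = R ` x" by blast
  have "x \<in> Tw" using x(1) assms by blast
  then obtain u where u: "u \<in> Pw" "x = W.cox_map ` u" using qw.surj_orbits by blast
  then have "y = cox_map ` u" using x R_cox_image by simp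
  then show "y \<in> image cox_map ` {x \<in> Pw. W.cox_map ` x \<in> U}" using u x by blast
next
  fix y assume "y \<in> image cox_map ` {x \<in> Pw. W.cox_map ` x \<in> U}"
  then obtain u where u: "u \<in> Pw" "W.cox_map ` u \<in> U" "y = cox_map ` u" by blast
  then show "y \<in> image R ` U" using R_cox_image[of u] by (metis image_eqI)
qed

lemma continuous_R: "continuous_map (zar Xw) (zar XM) (image R)"
  unfolding continuous_map
proof (intro conjI allI impI)
  show "image R ` points Xw \<subseteq> points XM" using R_surj by simp
  fix V assume V: "openin (zar XM) V"
  have "openin (zar qw.src.X) {x \<in> Pw. cox_map ` x \<in> V}"
    using openin_continuous_map_preimage[OF qM.continuous_image V[unfolded XM_eq]] by simp
  then show "openin (zar Xw) {x \<in> points Xw. R ` x \<in> V}"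
    using qw.open_map_image unfolding points_Xw preimage_R open_map_def by (simp add: Xw_eq)
qed

lemma open_map_R: "open_map (zar Xw) (zar XM) (image R)"
  unfolding open_map_def
proof (intro allI impI)
  fix U assume U: "openin (zar Xw) U"
  then have UT: "U \<subseteq> Tw" using openin_subset by fastforce
  have "openin (zar qw.src.X) {x \<in> Pw. W.cox_map ` x \<in> U}"
    using openin_continuous_map_preimage[OF qw.continuous_image U[unfolded Xw_eq]] by simp
  then show "openin (zar XM) (image R ` U)"
    using qM.open_map_image unfolding image_R[OF UT] open_map_def by (simp add: XM_eq)
qed

text \<open>Both conditions descend from one and the same set of points of weighted projective
  space.\<close>

lemma ratio_on_R:
  assumes V: "V \<subseteq> TM"
  shows "ratio_on (toric_sections \<Delta> M) V f \<longleftrightarrow>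
    ratio_on (toric_sections \<Delta>w Mw) {x \<in> Tw. R ` x \<in> V} (f \<circ> image R)"
proof -
  have sub: "{x \<in> Tw. R ` x \<in> V} \<subseteq> Tw" by blast
  have eq: "{x \<in> Pw. W.cox_map ` x \<in> {x \<in> Tw. R ` x \<in> V}} = {x \<in> Pw. cox_map ` x \<in> V}"
    using qw.image_orbit R_cox_image by auto
  show ?thesis
    unfolding qM.ratio_on_descend[OF V] qw.ratio_on_descend[OF sub] eq
    by (rule ratio_on_cong) (simp add: R_cox_image)
qed

lemma quotient_by_R: "quotient_by \<pi> act Xw XM (image R)"
proof -
  have "acts_on \<pi> act Xw"
    unfolding acts_on_def points_Xw using group_action_act[of Tw] T_in isomorphism_act by auto
  moreover have "quotient_map (zar Xw) (zar XM) (image R)"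
    by (rule continuous_open_imp_quotient_map[OF continuous_R open_map_R]) (simp add: R_surj)
  moreover have "f \<in> reg XM V \<longleftrightarrow> f \<circ> image R \<in> reg Xw {x \<in> points Xw. R ` x \<in> V}"
    if V: "openin (zar XM) V" for V f
  proof -
    have U: "openin (zar Xw) {x \<in> Tw. R ` x \<in> V}"
      using openin_continuous_map_preimage[OF continuous_R V] by simp
    have "V \<subseteq> TM" using openin_subset[OF V] by simp
    from ratio_on_R[OF this, of f] show ?thesis
      using qM.tgt.reg_iff[of V f] qw.tgt.reg_iff[of _ "f \<circ> image R"] V U by (simp add: Xw_eq XM_eq)
  qed
  ultimately show ?thesis unfolding quotient_by_def using quotient_fibres by simp
qed

text \<open>Saturation makes \<open>Z\<close> stable under the group and equal to the full preimage
  of its image, so openness and the criterion for functions restrict from the ambient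
  varieties.\<close>

lemma quotient_by_R_subvariety:
  assumes Z: "saturated_under Tw (image R) Z"
  shows "quotient_by \<pi> act (subvariety Xw Z) (subvariety XM (image R ` Z)) (image R)"
proof -
  have ZT: "Z \<subseteq> Tw" and sat: "\<And>x x'. x \<in> Z \<Longrightarrow> x' \<in> Tw \<Longrightarrow> R ` x = R ` x' \<Longrightarrow> x' \<in> Z"
    using Z by (auto simp only: saturated_under_def)
  have stable: "T y ` x \<in> Z" if "y \<in> N" "x \<in> Z" for y x
    using that ZT by (intro sat[OF that(2)] T_in) (auto simp: image_image R_T)
  have Zpts: "points (subvariety Xw Z) = Z" using ZT by auto
  have acts: "acts_on \<pi> act (subvariety Xw Z)"
    unfolding acts_on_def Zpts
    using group_action_act[OF ZT stable] isomorphism_act_subvariety[OF _ ZT stable] by blast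
  have quot: "quotient_map (zar (subvariety Xw Z)) (zar (subvariety XM (image R ` Z))) (image R)"
  proof (rule continuous_open_imp_quotient_map)
    have pre: "{x \<in> points Xw. R ` x \<in> image R ` Z} = Z"
    proof (intro equalityI subsetI)
      fix x assume "x \<in> {x \<in> points Xw. R ` x \<in> image R ` Z}"
      then obtain z where "z \<in> Z" "R ` z = R ` x" "x \<in> Tw" unfolding points_Xw by force
      then show "x \<in> Z" using sat by blast
    qed (use ZT in auto)
    show "continuous_map (zar (subvariety Xw Z)) (zar (subvariety XM (image R ` Z))) (image R)"
      using continuous_R by (auto simp: continuous_map_in_subtopology continuous_map_from_subtopology)
    show "open_map (zar (subvariety Xw Z)) (zar (subvariety XM (image R ` Z))) (image R)"
      unfolding zar_subvariety by (rule open_map_restriction[OF open_map_R pre])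
    show "image R ` points (subvariety Xw Z) = points (subvariety XM (image R ` Z))"
      using Zpts R_in ZT by auto
  qed
  have reg: "f \<in> reg (subvariety XM (image R ` Z)) V \<longleftrightarrow>
      f \<circ> image R \<in> reg (subvariety Xw Z) {x \<in> Z. R ` x \<in> V}"
    if V: "openin (zar (subvariety XM (image R ` Z))) V" for V f
  proof -
    have VZ: "V \<subseteq> image R ` Z" using openin_subset[OF V] by auto
    have "image R ` Z \<subseteq> TM" using image_mono[OF ZT, of "image R"] unfolding R_surj .
    then have VT: "V \<subseteq> TM" by (rule subset_trans[OF VZ])
    have eq: "{x \<in> Tw. R ` x \<in> V} = {x \<in> Z. R ` x \<in> V}"
    proof (intro equalityI subsetI)
      fix x assume x: "x \<in> {x \<in> Tw. R ` x \<in> V}"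
      then obtain z where "z \<in> Z" "R ` z = R ` x" using VZ by force
      then show "x \<in> {x \<in> Z. R ` x \<in> V}" using sat x by blast
    qed (use ZT in blast)
    have "{x \<in> Z. R ` x \<in> V} \<subseteq> Tw" using ZT by blast
    then show ?thesis
      using ratio_on_R[OF VT, of f] qM.tgt.reg_subvariety_iff[OF VT] qw.tgt.reg_subvariety_iff
      by (simp add: Xw_eq XM_eq eq)
  qed
  have fibres: "R ` x = R ` x' \<longleftrightarrow> (\<exists>g\<in>carrier \<pi>. act g x = x')" if "x \<in> Z" "x' \<in> Z" for x x'
    using that ZT by (intro quotient_fibres) (erule (1) subsetD)+
  show ?thesis unfolding quotient_by_def Zpts
    by (intro conjI ballI allI impI acts quot fibres reg)
qed

end

text \<open>Continuity gives one inclusion. For the other, a neighbourhood of \<open>x\<close> has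
  an open image, which meets \<open>B\<close>, and a preimage of the common point lies in the
  neighbourhood.\<close>

lemma closure_of_open_preimage:
  assumes cont: "continuous_map X Y q" and opn: "open_map X Y q"
  shows "X closure_of {x \<in> topspace X. q x \<in> B} = {x \<in> topspace X. q x \<in> Y closure_of B}"
proof (intro equalityI subsetI)
  fix x assume x: "x \<in> X closure_of {x \<in> topspace X. q x \<in> B}"
  have "q ` {x \<in> topspace X. q x \<in> B} \<subseteq> B" by (rule image_subsetI) simp
  then have "Y closure_of (q ` {x \<in> topspace X. q x \<in> B}) \<subseteq> Y closure_of B" by (rule closure_of_mono)
  moreover have "q x \<in> Y closure_of (q ` {x \<in> topspace X. q x \<in> B})"
    by (rule subsetD[OF continuous_map_image_closure_subset[OF cont] imageI[OF x]])
  ultimately have "q x \<in> Y closure_of B" by (rule subsetD)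
  then show "x \<in> {x \<in> topspace X. q x \<in> Y closure_of B}" using x by (simp add: in_closure_of)
next
  fix x assume x: "x \<in> {x \<in> topspace X. q x \<in> Y closure_of B}"
  have "\<exists>y. y \<in> {x \<in> topspace X. q x \<in> B} \<and> y \<in> U" if U: "x \<in> U" "openin X U" for U
  proof -
    have "openin Y (q ` U)" using opn U by (simp add: open_map_def)
    moreover have "q x \<in> q ` U" using U by blast
    moreover have "\<forall>V. q x \<in> V \<and> openin Y V \<longrightarrow> (\<exists>y. y \<in> B \<and> y \<in> V)" using x by (simp add: in_closure_of)
    ultimately obtain b where "b \<in> B" "b \<in> q ` U" by meson
    then show ?thesis using openin_subset[OF U(2)] by blast
  qed
  then show "x \<in> X closure_of {x \<in> topspace X. q x \<in> B}" using x unfolding in_closure_of by simp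
qed

section \<open>Torus points and Fermat hypersurfaces\<close>

context toric_simplex begin

text \<open>The exponent of (k, m) splits into that of (k, 0), all of whose entries are
  \<open>k\<close>, and that of (0, m). The latter may have negative entries, whence the condition
  of nonzero coordinates.\<close>

lemma cox_map_torus:
  assumes v: "\<And>i. v $ i \<noteq> 0" and km: "(k, m) \<in> cone_monoid \<Delta> M"
  shows "cox_map v (k, m) = (\<Prod>i\<in>UNIV. v $ i) ^ k * monom_at v (expo 0 m)"
proof -
  have "expo (int k) m = expo (int k) 0 + expo 0 m"
    using expo_add[OF lattice_zero cone_in[OF km], of "int k" 0] by simp
  moreover have "monom_at v (expo (int k) 0) = (\<Prod>i\<in>UNIV. v $ i) ^ k"
    by (simp add: monom_at_def expo_def lam_simps flip: prod_power_distrib)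
  ultimately show ?thesis using km monom_at_add[of v "expo (int k) 0" "expo 0 m", OF v] by (simp add: cox_map_def)
qed

lemma cox_torus_in:
  assumes v: "\<And>i. v $ i \<noteq> 0" shows "(\<lambda>m. monom_at v (expo 0 m)) \<in> torus M"
  using monom_at_nonzero[OF v] monom_at_add[OF v]
  by (auto simp: torus_def expo_add[where k = 0 and k' = 0, simplified, symmetric])

lemma scaling_orbit_cox_torus:
  assumes v: "\<And>i. v $ i \<noteq> 0"
  shows "scaling_orbit (cox_map v) = torus_point \<Delta> M (\<lambda>m. monom_at v (expo 0 m))"
proof -
  have "cox_map v \<in> torus_point \<Delta> M (\<lambda>m. monom_at v (expo 0 m))"
    unfolding torus_point_def scaling_orbit_def
  proof (intro CollectI exI[of _ "\<Prod>i\<in>UNIV. v $ i"] conjI)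
    show "cox_map v = (\<lambda>(k, m). (\<Prod>i\<in>UNIV. v $ i) ^ k *
        (case (k, m) of (k, m) \<Rightarrow> if (k, m) \<in> cone_monoid \<Delta> M then monom_at v (expo 0 m) else 0))"
    proof
      fix a :: "nat \<times> 'v"
      show "cox_map v a = (case a of (k, m) \<Rightarrow> (\<Prod>i\<in>UNIV. v $ i) ^ k *
        (case (k, m) of (k, m) \<Rightarrow> if (k, m) \<in> cone_monoid \<Delta> M then monom_at v (expo 0 m) else 0))"
        using cox_map_torus[OF v, of "fst a" "snd a"] by (cases a) (simp add: cox_map_def)
    qed
  qed (use v in auto)
  then show ?thesis unfolding torus_point_def by (rule scaling_orbit_eq)
qed

lemma inj_vertex: "inj p"
proof (rule injI, rule ccontr)
  fix i j assume "p i = p j" "i \<noteq> j"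
  then show False using lam_vertex[of i i] lam_vertex[of i j] d_pos[of i] by simp
qed

lemma convex_polytope: "convex \<Delta>"
proof -
  have "convex {x. -1 \<le> lam i x}" for i
    using convex_linear_vimage[OF lam_linear[of i] convex_real_interval(1)[of "-1"]] by (simp add: vimage_def)
  moreover have "\<Delta> = span M \<inter> (\<Inter>i. {x. -1 \<le> lam i x})" unfolding polytope_eq by auto
  ultimately show ?thesis
    by (simp add: convex_Int convex_INT subspace_imp_convex)
qed

lemma vertex_in_polytope: "p i \<in> \<Delta>"
  by (simp add: polytope_iff span_base vertex_in lam_vertex)

lemma polytope_eq_hull: "\<Delta> = convex hull (range p)"
proof (intro equalityI subsetI)
  fix x assume x: "x \<in> \<Delta>"
  let ?a = "\<lambda>i. (lam i x + 1) / real (d i)"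
  have xs: "x \<in> span M" and x1: "\<And>i. -1 \<le> lam i x" using x by (auto simp: polytope_iff)
  have sum: "(\<Sum>i\<in>UNIV. ?a i) = 1" using lam_weights[OF xs] d_sum by (simp add: add_divide_distrib sum.distrib)
  have "x - (\<Sum>i\<in>UNIV. ?a i *\<^sub>R p i) = 0"
  proof (rule lam_inj)
    show "x - (\<Sum>i\<in>UNIV. ?a i *\<^sub>R p i) \<in> span M"
      by (intro span_diff xs span_sum span_scale span_base vertex_in)
    show "lam j (x - (\<Sum>i\<in>UNIV. ?a i *\<^sub>R p i)) = 0" for j
      using sum d_pos[of j] by (simp add: linear_diff[OF lam_linear] lam_vertex_sum)
  qed
  then have "x = (\<Sum>i\<in>UNIV. ?a i *\<^sub>R p i)" by simp
  moreover have "0 \<le> ?a i" for i using x1[of i] by (intro divide_nonneg_nonneg) linarith+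
  then have "(\<Sum>i\<in>UNIV. ?a i *\<^sub>R p i) \<in> convex hull (range p)"
    using sum by (intro convex_sum) (auto intro: hull_inc)
  ultimately show "x \<in> convex hull (range p)" by simp
next
  fix x assume "x \<in> convex hull (range p)"
  moreover have "convex hull (range p) \<subseteq> \<Delta>"
    using vertex_in_polytope by (intro hull_minimal convex_polytope) auto
  ultimately show "x \<in> \<Delta>" by blast
qed

text \<open>Points of the Fermat hypersurface outside the torus are limits of points in the torus: fill the
  vanishing coordinates with a small \<open>\<epsilon>\<close> and correct one of the others by a branch of the root.\<close>

lemma fermat_torus_dense:
  fixes v :: "complex ^ 'i"
  assumes v: "v \<noteq> 0" "(\<Sum>i\<in>UNIV. v $ i ^ d i) = 0"
    and h: "continuous_on UNIV h" "h v \<noteq> (0 :: complex)"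
  shows "\<exists>v'. (\<forall>i. v' $ i \<noteq> 0) \<and> (\<Sum>i\<in>UNIV. v' $ i ^ d i) = 0 \<and> h v' \<noteq> 0"
proof -
  obtain j where j: "v $ j \<noteq> 0" using v(1) by (auto simp: vec_eq_iff)
  define Z where "Z = {i. v $ i = 0}"
  define e where "e n = complex_of_real (inverse (real (Suc n)))" for n
  define \<delta> where "\<delta> n = (\<Sum>i\<in>Z. e n ^ d i)" for n
  \<comment> \<open>\<open>\<delta>\<close> is the error caused by filling the zeros. Multiplying
    the \<open>j\<close>-th coordinate by a d_j-th root of \<open>r\<close> subtracts exactly
    \<open>\<delta>\<close> from its d_j-th power.\<close>
  define r where "r n = 1 - \<delta> n / v $ j ^ d j" for n
  define u where "u n = (\<chi> i. if i \<in> Z then e n else if i = j then v $ j * exp (Ln (r n) / of_nat (d j)) else v $ i)"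
    for n
  have jZ: "j \<notin> Z" using j by (simp add: Z_def)
  have e_nz: "e n \<noteq> 0" for n by (simp add: e_def del: of_nat_Suc)
  have "(\<lambda>n. of_real (inverse (real (Suc n)))) \<longlonglongrightarrow> complex_of_real 0"
    by (intro tendsto_of_real LIMSEQ_inverse_real_of_nat)
  then have e_lim: "e \<longlonglongrightarrow> 0" unfolding e_def by simp
  have "\<delta> \<longlonglongrightarrow> (\<Sum>i\<in>Z. 0 ^ d i)" unfolding \<delta>_def by (intro tendsto_sum tendsto_power e_lim)
  then have "\<delta> \<longlonglongrightarrow> 0" using d_pos by (simp add: power_0_left less_imp_neq[symmetric])
  then have "r \<longlonglongrightarrow> 1 - 0 / v $ j ^ d j" unfolding r_def using j by (intro tendsto_intros) auto
  then have r_lim: "r \<longlonglongrightarrow> 1" by simp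
  have "(\<lambda>n. exp (Ln (r n) / of_nat (d j))) \<longlonglongrightarrow> exp (Ln 1 / of_nat (d j))"
    using d_pos[of j] r_lim by (intro tendsto_intros) auto
  then have root_lim: "(\<lambda>n. exp (Ln (r n) / of_nat (d j))) \<longlonglongrightarrow> 1" by simp
  have u_lim: "u \<longlonglongrightarrow> v"
  proof (rule vec_tendstoI)
    fix i
    show "(\<lambda>n. u n $ i) \<longlonglongrightarrow> v $ i"
    proof (cases "i \<in> Z")
      case True then show ?thesis using e_lim by (simp add: u_def) (simp add: Z_def)
    next
      case False
      then show ?thesis using tendsto_mult[OF tendsto_const[of "v $ j"] root_lim]
        by (cases "i = j") (simp_all add: u_def)
    qed
  qed
  have "(h \<longlongrightarrow> h v) (at v)" using h(1) by (simp add: continuous_on_def)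
  then have "isCont h v" by (simp add: isCont_def)
  then have "(\<lambda>n. h (u n)) \<longlonglongrightarrow> h v" using u_lim isCont_tendsto_compose by blast
  then have "eventually (\<lambda>n. h (u n) \<noteq> 0) sequentially" using h(2) tendsto_imp_eventually_ne by blast
  moreover have "eventually (\<lambda>n. r n \<noteq> 0) sequentially" using r_lim tendsto_imp_eventually_ne by force
  ultimately have "eventually (\<lambda>n. h (u n) \<noteq> 0 \<and> r n \<noteq> 0) sequentially" by (rule eventually_conj)
  \<comment> \<open>\<open>r n\<close> has to be nonzero for the exponential of its scaled logarithm
    to be a root of it.\<close>
  then obtain n where n: "h (u n) \<noteq> 0" "r n \<noteq> 0" using eventually_happens'[OF sequentially_bot] by blast
  have "exp (Ln (r n) / of_nat (d j)) ^ d j = r n"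
    using n(2) d_pos[of j] by (simp flip: exp_of_nat_mult)
  then have uj: "u n $ j ^ d j = v $ j ^ d j - \<delta> n"
    using jZ j by (simp add: u_def power_mult_distrib r_def field_simps)
  have "(\<Sum>i\<in>UNIV. u n $ i ^ d i) = (\<Sum>i\<in>Z. u n $ i ^ d i) + (\<Sum>i\<in>- Z. u n $ i ^ d i)"
    by (subst sum.union_disjoint[symmetric]) auto
  also have "(\<Sum>i\<in>- Z. u n $ i ^ d i) = u n $ j ^ d j + (\<Sum>i\<in>- Z - {j}. u n $ i ^ d i)"
    using jZ by (intro sum.remove) auto
  also have "(\<Sum>i\<in>- Z - {j}. u n $ i ^ d i) = (\<Sum>i\<in>- Z - {j}. v $ i ^ d i)"
    by (intro sum.cong refl) (auto simp: u_def)
  also have "(\<Sum>i\<in>Z. u n $ i ^ d i) = \<delta> n" unfolding \<delta>_def by (intro sum.cong refl) (auto simp: u_def)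
  also have "\<delta> n + (u n $ j ^ d j + (\<Sum>i\<in>- Z - {j}. v $ i ^ d i)) = v $ j ^ d j + (\<Sum>i\<in>- Z - {j}. v $ i ^ d i)"
    by (simp add: uj)
  also have "\<dots> = (\<Sum>i\<in>- Z. v $ i ^ d i)" using jZ by (intro sum.remove[symmetric]) auto
  also have "\<dots> = (\<Sum>i\<in>UNIV. v $ i ^ d i)"
    using d_pos by (intro sum.mono_neutral_left) (auto simp: Z_def power_0_left less_imp_neq[symmetric])
  finally have "(\<Sum>i\<in>UNIV. u n $ i ^ d i) = 0" using v(2) by simp
  moreover have "u n $ i \<noteq> 0" for i using e_nz j by (auto simp: u_def Z_def)
  ultimately show ?thesis using n(1) by blast
qed

text \<open>The Fermat equation in toric terms: by \<open>cox_map_vertex\<close>, the coordinate at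
  (1, p_i) is the d_i-th power of v_i.\<close>

definition fermat_points :: "(nat \<times> 'v \<Rightarrow> complex) set set" where
  "fermat_points = {x \<in> scaling_orbit ` cone_points \<Delta> M. \<forall>\<xi>\<in>x. (\<Sum>i\<in>UNIV. \<xi> (1, p i)) = 0}"

text \<open>Closedness holds because the equation is a single section of degree 1. For density it
  suffices to meet basic open sets; their defining sections are continuous in the Cox coordinates
  for the ordinary topology, so approximation in that topology is enough.\<close>

lemma fermat_points_closure:
  fixes f :: "'v \<Rightarrow>\<^sub>0 complex"
  assumes f: "Poly_Mapping.lookup f = (\<lambda>m. if m \<in> range p then 1 else 0)"
  shows "hypersurface \<Delta> M f = fermat_points"
proof -
  interpret q: cone_quotient "weighted_orbit w ` (UNIV - {0})" "weighted_forms w"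
     "scaling_orbit ` cone_points \<Delta> M" "toric_sections \<Delta> M" cox_map by (rule cone_quotient_cox)
  have keys: "Poly_Mapping.keys f = range p" by (auto simp: in_keys_iff f split: if_splits)
  have fsum: "(\<Sum>m\<in>Poly_Mapping.keys f. Poly_Mapping.lookup f m * c m) = (\<Sum>i\<in>UNIV. c (p i))" for c :: "'v \<Rightarrow> complex"
    unfolding keys by (subst sum.reindex[OF inj_vertex]) (simp add: f)
  let ?A = "{torus_point \<Delta> M t | t. t \<in> torus M \<and>
      (\<Sum>m\<in>Poly_Mapping.keys f. Poly_Mapping.lookup f m * t m) = 0}"
  have hyp: "hypersurface \<Delta> M f = zar q.tgt.X closure_of ?A"
    unfolding hypersurface_def toric_variety_def ..
  define h0 where "h0 = (\<lambda>\<xi> :: nat \<times> 'v \<Rightarrow> complex. \<Sum>i\<in>UNIV. 1 * \<xi> (1, p i))"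
  have h0: "h0 \<in> toric_sections \<Delta> M 1"
    unfolding h0_def by (rule toric_sections_sum) (use cone_vertex in auto)
  have fp: "fermat_points = scaling_orbit ` cone_points \<Delta> M - q.tgt.D h0"
  proof (intro equalityI subsetI)
    fix x assume x: "x \<in> fermat_points"
    then have xT: "x \<in> scaling_orbit ` cone_points \<Delta> M" by (simp only: fermat_points_def mem_Collect_eq)
    obtain \<xi> where \<xi>: "\<xi> \<in> x" using q.tgt.orbit_nonempty[OF xT] by blast
    then have "h0 \<xi> = 0" using x by (simp add: fermat_points_def h0_def)
    then have "x \<notin> q.tgt.D h0" using \<xi> by (auto simp: nonvanishing_def)
    then show "x \<in> scaling_orbit ` cone_points \<Delta> M - q.tgt.D h0" using xT by blast
  next
    fix x assume x: "x \<in> scaling_orbit ` cone_points \<Delta> M - q.tgt.D h0"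
    then have "\<forall>\<xi>\<in>x. h0 \<xi> = 0" using q.tgt.zero_on_orbit[OF _ _ h0] by blast
    then show "x \<in> fermat_points" using x by (simp only: fermat_points_def h0_def mem_Collect_eq) simp
  qed
  have closed: "closedin (zar q.tgt.X) fermat_points"
    unfolding fp closedin_def using q.tgt.openin_nonvanishing[OF h0]
    by (auto simp: Diff_Diff_Int Int_absorb1 nonvanishing_def)
  show ?thesis
  proof (rule equalityI)
    have "?A \<subseteq> fermat_points"
    proof
      fix x assume "x \<in> ?A"
      then obtain t where t: "x = torus_point \<Delta> M t" "t \<in> torus M" "(\<Sum>i\<in>UNIV. t (p i)) = 0" by (auto simp: fsum)
      let ?\<xi> = "\<lambda>(k, m). if (k, m) \<in> cone_monoid \<Delta> M then t m else 0"
      have t0: "t 0 = 1"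
      proof -
        have "t (0 + 0) = t 0 * t 0" "t 0 \<noteq> 0" using t(2) lattice_zero unfolding torus_def by blast+
        then show ?thesis by simp
      qed
      have "?\<xi> \<in> cone_points \<Delta> M"
        by (rule cone_pointsI[OF _ _ _ cone_one_zero])
           (use t0 cone_zero cone_one_zero cone_add cone_in t(2) in \<open>auto simp: torus_def\<close>)
      moreover have "(\<Sum>i\<in>UNIV. \<xi> (1, p i)) = 0" if \<xi>: "\<xi> \<in> scaling_orbit ?\<xi>" for \<xi>
      proof -
        obtain c where "\<xi> = (\<lambda>(k, m). c ^ k * ?\<xi> (k, m))" using \<xi> unfolding scaling_orbit_def by blast
        then have "\<xi> (1, p i) = c * t (p i)" for i using cone_vertex by simp
        then show ?thesis using t(3) by (simp flip: sum_distrib_left)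
      qed
      ultimately show "x \<in> fermat_points" unfolding fermat_points_def t(1) torus_point_def by blast
    qed
    then show "hypersurface \<Delta> M f \<subseteq> fermat_points"
      unfolding hyp by (rule closure_of_minimal[OF _ closed])
  next
    show "fermat_points \<subseteq> hypersurface \<Delta> M f"
    proof
      fix x assume x: "x \<in> fermat_points"
      then have xT: "x \<in> scaling_orbit ` cone_points \<Delta> M" by (simp only: fermat_points_def mem_Collect_eq)
      have "\<exists>y. y \<in> ?A \<and> y \<in> U" if U: "x \<in> U" "openin (zar q.tgt.X) U" for U
      proof -
        obtain k h where h: "h \<in> toric_sections \<Delta> M k" "x \<in> q.tgt.D h" "q.tgt.D h \<subseteq> U"
          using U unfolding q.tgt.openin_zar_iff by blast
        obtain z where "z \<in> weighted_orbit w ` (UNIV - {0})" "x = cox_map ` z" using q.surj_orbits[OF xT] by blast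
        then obtain v where v: "v \<noteq> 0" "x = cox_map ` weighted_orbit w v" by blast
        have vx: "cox_map v \<in> x" using v(2) weighted_orbit_refl by blast
        have "(\<Sum>i\<in>UNIV. cox_map v (1, p i)) = 0" using x vx unfolding fermat_points_def by blast
        then have v0: "(\<Sum>i\<in>UNIV. v $ i ^ d i) = 0" by (simp only: cox_map_vertex)
        obtain A g where A: "finite A" "\<forall>m\<in>A. (k, m) \<in> cone_monoid \<Delta> M"
          "h = (\<lambda>\<xi>. \<Sum>m\<in>A. g m * \<xi> (k, m))" using toric_sectionsE[OF h(1)] by metis
        have "continuous_on UNIV (\<lambda>v. cox_map v (k, m))" if "m \<in> A" for m
        proof -
          have km: "(k, m) \<in> cone_monoid \<Delta> M" using A(2) that by blast
          have "cox_map v (k, m) = (\<Prod>i\<in>UNIV. v $ i ^ nat (expo (int k) m $ i))" for v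
            using km by (simp add: cox_map_def monom_at_nonneg cone_expo_nonneg)
          then show ?thesis by (simp add: continuous_on_prod continuous_on_power continuous_on_component)
        qed
        then have "continuous_on UNIV (\<lambda>v. h (cox_map v))"
          unfolding A(3) by (intro continuous_on_sum continuous_on_mult continuous_on_const)
        moreover have "h (cox_map v) \<noteq> 0" using h(2) vx by (auto simp: nonvanishing_def)
        ultimately obtain v' where v': "\<forall>i. v' $ i \<noteq> 0" "(\<Sum>i\<in>UNIV. v' $ i ^ d i) = 0" "h (cox_map v') \<noteq> 0"
          using fermat_torus_dense[OF v(1) v0] by blast
        have nz: "v' $ i \<noteq> 0" for i using v'(1) by blast
        let ?y = "torus_point \<Delta> M (\<lambda>m. monom_at v' (expo 0 m))"
        have y: "?y = scaling_orbit (cox_map v')" by (rule scaling_orbit_cox_torus[OF nz, symmetric])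
        have "v' \<noteq> 0" using nz by (auto simp: vec_eq_iff)
        then have yT: "?y \<in> scaling_orbit ` cone_points \<Delta> M" unfolding y using cox_map_in by blast
        have "cox_map v' \<in> ?y" unfolding y by (rule scaling_orbit_refl)
        then have "?y \<in> q.tgt.D h" using q.tgt.nonzero_on_orbit[OF yT _ h(1)] v'(3) by blast
        moreover have "?y \<in> ?A"
        proof -
          \<comment> \<open>The product of all coordinates is the scaling factor between the Cox
            point and the torus point; dividing by it turns the Fermat equation into the equation of
            \<open>f\<close> on the torus.\<close>
          have "v' $ i ^ d i = (\<Prod>i\<in>UNIV. v' $ i) * monom_at v' (expo 0 (p i))" for i
            using cox_map_torus[OF nz cone_vertex[of i]] cox_map_vertex[of v' i] by simp
          then have "(\<Prod>i\<in>UNIV. v' $ i) * (\<Sum>i\<in>UNIV. monom_at v' (expo 0 (p i))) = 0"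
            using v'(2) by (simp add: sum_distrib_left)
          then have "(\<Sum>i\<in>UNIV. monom_at v' (expo 0 (p i))) = 0" using nz by simp
          then show ?thesis using cox_torus_in[OF nz] unfolding fsum by blast
        qed
        ultimately show ?thesis using h(3) by blast
      qed
      then show "x \<in> hypersurface \<Delta> M f" unfolding hyp in_closure_of using xT by auto
    qed
  qed
qed

text \<open>The derivative along the \<open>i\<close>-th normal has coefficient d_i - 1 at
  \<open>p i\<close> and -1 at the other vertices. The vertex coordinates sum to zero on the
  hypersurface, so d_i times the \<open>i\<close>-th one remains, and at every point some vertex
  coordinate is nonzero.\<close>

lemma fermat_points_regular:
  assumes normals: "\<And>i. \<exists>u\<in>dual_lattice M. \<forall>j. p j \<bullet> u = lam i (p j)"
  shows "fermat_points \<in> regular_family \<Delta> M"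
proof -
  obtain f :: "'v \<Rightarrow>\<^sub>0 complex" where f: "Poly_Mapping.lookup f = (\<lambda>m. if m \<in> range p then 1 else 0)"
    using exists_poly_mapping[of "range p" "\<lambda>_. 1"] by auto
  have keys: "Poly_Mapping.keys f = range p" by (auto simp: in_keys_iff f split: if_splits)
  have "smooth_on_orbit_at M f \<Theta> x" if x: "x \<in> fermat_points" "x \<in> torus_orbit \<Delta> M \<Theta>" for \<Theta> x
    unfolding smooth_on_orbit_at_def
  proof
    fix \<xi> assume \<xi>x: "\<xi> \<in> x"
    have "x \<in> scaling_orbit ` cone_points \<Delta> M" using x(1) by (simp only: fermat_points_def mem_Collect_eq)
    then have "\<xi> \<in> cone_points \<Delta> M" using \<xi>x by (rule cone_point_of_orbit)
    then obtain v where v: "v \<noteq> 0" "\<xi> = cox_map v" by (rule cox_map_surj)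
    then obtain i where "v $ i \<noteq> 0" by (auto simp: vec_eq_iff)
    then have i: "\<xi> (1, p i) \<noteq> 0" unfolding v(2) cox_map_vertex by simp
    obtain u where u: "u \<in> dual_lattice M" "\<forall>j. p j \<bullet> u = lam i (p j)" using normals by blast
    have sum0: "(\<Sum>j\<in>UNIV. \<xi> (1, p j)) = 0" using x(1) \<xi>x unfolding fermat_points_def by blast
    \<comment> \<open>Coordinates at vertices outside \<Theta> vanish on this orbit, so the part of
      \<open>f\<close> on \<Theta> may be replaced by all of \<open>f\<close> in the
      derivative.\<close>
    have zero: "\<xi> (1, p j) = 0" if "p j \<notin> \<Theta>" for j
    proof -
      have "(1, p j) \<notin> cone_monoid \<Theta> M" using that by (auto simp: cone_monoid_def)
      then show ?thesis using x(2) \<xi>x cone_vertex[of j] unfolding torus_orbit_def by blast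
    qed
    have "(\<Sum>m\<in>Poly_Mapping.keys f \<inter> \<Theta>. of_real (m \<bullet> u) * Poly_Mapping.lookup f m * \<xi> (1, m)) =
        (\<Sum>m\<in>range p. of_real (m \<bullet> u) * \<xi> (1, m))"
      unfolding keys using zero by (intro sum.mono_neutral_cong_left) (auto simp: f)
    also have "\<dots> = (\<Sum>j\<in>UNIV. of_real (p j \<bullet> u) * \<xi> (1, p j))"
      by (simp add: sum.reindex[OF inj_vertex])
    also have "\<dots> = (\<Sum>j\<in>UNIV. (if j = i then of_nat (d i) * \<xi> (1, p i) else 0) - \<xi> (1, p j))"
      by (intro sum.cong refl) (simp add: u(2) lam_vertex left_diff_distrib)
    also have "\<dots> = of_nat (d i) * \<xi> (1, p i)" by (simp add: sum_subtractf sum0[simplified])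
    finally show "\<exists>u\<in>dual_lattice M.
        (\<Sum>m\<in>Poly_Mapping.keys f \<inter> \<Theta>. of_real (m \<bullet> u) * Poly_Mapping.lookup f m * \<xi> (1, m)) \<noteq> 0"
      using u(1) i d_pos[of i] by (intro bexI[of _ u]) auto
  qed
  then have "regular_polynomial \<Delta> M f"
    unfolding regular_polynomial_def has_newton_polyhedron_def fermat_points_closure[OF f] keys
    using vertex_in polytope_eq_hull by auto
  then show ?thesis unfolding regular_family_def using fermat_points_closure[OF f] by blast
qed

end

text \<open>If g divides all weights, then every d_i divides lcm(d) / g, so lcm(d) divides lcm(d) /
  g and g = 1.\<close>

lemma Gcd_fermat_weights:
  fixes d :: "'i::finite \<Rightarrow> nat"
  assumes d: "\<And>i. d i > 0" shows "Gcd (range (fermat_weights d)) = 1"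
proof -
  define g where "g = Gcd (range (fermat_weights d))"
  have L: "Lcm (range d) > 0" by (rule Lcm_range_pos[OF d])
  have "g dvd fermat_weights d undefined" unfolding g_def by (intro Gcd_dvd) auto
  then obtain q where q: "Lcm (range d) = g * q"
    using fermat_weights_mult[of d undefined] by (metis dvd_def mult.assoc)
  have q0: "q > 0" "g > 0" using L q by (auto intro: gr0I)
  have "d i dvd q" for i
  proof -
    have "g dvd fermat_weights d i" unfolding g_def by (intro Gcd_dvd) auto
    then obtain c where "fermat_weights d i = g * c" by blast
    then have "g * (c * d i) = g * q" using fermat_weights_mult[of d i] q by (simp add: mult.assoc)
    then have "q = c * d i" using q0 by simp
    then show ?thesis by simp
  qed
  then have "Lcm (range d) dvd q" by (intro Lcm_least) auto
  then have "g * q \<le> q" using q q0 by (metis dvd_imp_le)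
  then show ?thesis using q0 by (simp add: g_def[symmetric])
qed

lemma weighted_to_toric_cox:
  fixes d :: "'i::finite \<Rightarrow> nat"
  assumes d: "\<And>i. d i > 0" "(\<Sum>i\<in>UNIV. 1 / real (d i)) = 1"
  defines "w \<equiv> fermat_weights d"
  shows "weighted_to_toric w = image (toric_simplex.cox_map (weight_polytope w) (weight_lattice w) (\<lambda>i x. x $ i))"
proof -
  interpret W: toric_simplex d "weight_polytope w" "weight_lattice w" "\<lambda>i x. x $ i" "weight_vertex d"
    unfolding w_def by (rule toric_simplex_weight[OF d])
  have "(case a of (k, m) \<Rightarrow> if (k, m) \<in> cone_monoid (weight_polytope w) (weight_lattice w)
         then \<Prod>i\<in>UNIV. v $ i ^ nat \<lfloor>m $ i + real k\<rfloor> else 0) = W.cox_map v a" for v a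
    using W.cone_expo_nonneg[of "fst a" "snd a"]
    by (cases a) (auto simp: W.cox_map_def monom_at_nonneg W.expo_def)
  then have "(\<lambda>v (k, m). if (k, m) \<in> cone_monoid (weight_polytope w) (weight_lattice w)
         then \<Prod>i\<in>UNIV. v $ i ^ nat \<lfloor>m $ i + real k\<rfloor> else 0) = W.cox_map" by (intro ext)
  then show ?thesis by (intro ext) (simp only: weighted_to_toric_def)
qed

text \<open>The fibres are governed by \<open>deck\<close> for M(w). If b has weighted sum 1, the
  value \<open>t\<close> of the monomial with exponent b at \<open>s\<close> satisfies s_i =
  t^(w_i), so this group moves points only inside their weighted orbits.\<close>

lemma weighted_cox_inj:
  fixes d :: "'i::finite \<Rightarrow> nat"
  assumes d: "\<And>i. d i > 0" "(\<Sum>i\<in>UNIV. 1 / real (d i)) = 1"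
  defines "w \<equiv> fermat_weights d"
  shows "inj_on (weighted_to_toric w) (weighted_orbit w ` (UNIV - {0}))"
proof (rule inj_onI)
  interpret W: toric_simplex d "weight_polytope w" "weight_lattice w" "\<lambda>i x. x $ i" "weight_vertex d"
    unfolding w_def by (rule toric_simplex_weight[OF d])
  fix x y assume x: "x \<in> weighted_orbit w ` (UNIV - {0})" and y: "y \<in> weighted_orbit w ` (UNIV - {0})"
    and eq: "weighted_to_toric w x = weighted_to_toric w y"
  obtain v v' where v: "x = weighted_orbit w v" "y = weighted_orbit w v'" using x y by blast
  have "W.cox_map ` weighted_orbit w v = W.cox_map ` weighted_orbit w v'"
    using eq unfolding v weighted_to_toric_cox[OF d, folded w_def] .
  from iffD1[OF W.cox_map_orbit_eq_iff[folded w_def] this]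
  obtain s where s: "s \<in> W.deck" "weighted_orbit w v' = weighted_orbit w (\<chi> i. s $ i * v $ i)" by (elim bexE)
  obtain b :: "'i \<Rightarrow> int" where b: "(\<Sum>i\<in>UNIV. b i * int (w i)) = 1"
    using int_bezout[OF Gcd_fermat_weights[of d, OF d(1)]] unfolding w_def by blast
  define t where "t = monom_at s (\<chi> i. b i)"
  have s_nz: "\<And>i. s $ i \<noteq> 0" using s(1) by (simp add: W.deck_def)
  have "s $ i = t ^ w i" for i
  proof -
    \<comment> \<open>The vector e_i - w_i b lies in M(w), so \<open>s\<close> is trivial on it;
      this compares s_i with the w_i-th power of \<open>t\<close>.\<close>
    define a where "a = axis i 1 - int (w i) *s (\<chi> i. b i)"
    define m where "m = (\<chi> j. real_of_int (a $ j))"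
    have "(\<Sum>j\<in>UNIV. int (w j) * a $ j) = (\<Sum>j\<in>UNIV. (if j = i then int (w i) else 0) - int (w i) * (b j * int (w j)))"
      by (intro sum.cong refl) (auto simp: a_def axis_def algebra_simps)
    also have "\<dots> = 0" using b by (simp add: sum_subtractf flip: sum_distrib_left)
    finally have "real_of_int (\<Sum>j\<in>UNIV. int (w j) * a $ j) = 0" by simp
    then have m: "m \<in> weight_lattice w" by (simp add: weight_lattice_def m_def)
    have "W.expo 0 m = a" by (simp add: W.expo_def m_def vec_eq_iff)
    then have "monom_at s a = 1" using W.expo_in[OF m, of 0] s(1) by (simp add: W.deck_def)
    moreover have "axis i 1 = a + int (w i) *s (\<chi> i. b i)" by (simp add: a_def)
    then have "monom_at s (axis i 1) = monom_at s a * monom_at s (int (w i) *s (\<chi> i. b i))"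
      using monom_at_add[of s, OF s_nz] by simp
    moreover have "monom_at s (int (w i) *s (\<chi> i. b i)) = t powi int (w i)"
      unfolding t_def
      by (rule character_on_scale[of UNIV]) (auto simp: int_subgroup_def character_on_def monom_at_nonzero[OF s_nz] monom_at_add[OF s_nz])
    ultimately show ?thesis by (simp add: monom_at_axis)
  qed
  moreover have "t \<noteq> 0" unfolding t_def by (rule monom_at_nonzero[OF s_nz])
  ultimately have "(\<chi> i. s $ i * v $ i) \<in> weighted_orbit w v"
    unfolding weighted_orbit_def by (intro CollectI exI[of _ t]) simp
  then show "x = y" using s(2) v weighted_orbit_eq by metis
qed

section \<open>Families of hypersurfaces\<close>

context reflexive_simplex begin

lemma exists_push_forward:
  assumes "Poly_Mapping.keys f \<subseteq> M"
  shows "\<exists>f' :: (real ^ 'i) \<Rightarrow>\<^sub>0 complex. Poly_Mapping.keys f' = \<phi> ` Poly_Mapping.keys f \<and>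
    (\<forall>m\<in>Poly_Mapping.keys f. Poly_Mapping.lookup f' (\<phi> m) = Poly_Mapping.lookup f m)"
proof -
  obtain f' where f': "Poly_Mapping.lookup f' =
      (\<lambda>m'. if m' \<in> \<phi> ` Poly_Mapping.keys f then Poly_Mapping.lookup f (\<psi> m') else 0)"
    using exists_poly_mapping[of "\<phi> ` Poly_Mapping.keys f" "\<lambda>m'. Poly_Mapping.lookup f (\<psi> m')"] by auto
  have \<psi>: "\<psi> (\<phi> m) = m" if "m \<in> Poly_Mapping.keys f" for m using \<psi>_\<phi>[OF span_base] assms that by blast
  have "Poly_Mapping.keys f' = \<phi> ` Poly_Mapping.keys f"
    using \<psi> by (auto simp: in_keys_iff f' split: if_splits)
  then show ?thesis using \<psi> by (intro exI[of _ f']) (simp add: f')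
qed

definition push :: "('v \<Rightarrow>\<^sub>0 complex) \<Rightarrow> (real ^ 'i) \<Rightarrow>\<^sub>0 complex" where
  "push f = (SOME f'. Poly_Mapping.keys f' = \<phi> ` Poly_Mapping.keys f \<and>
    (\<forall>m\<in>Poly_Mapping.keys f. Poly_Mapping.lookup f' (\<phi> m) = Poly_Mapping.lookup f m))"

lemma push:
  assumes "Poly_Mapping.keys f \<subseteq> M"
  shows "Poly_Mapping.keys (push f) = \<phi> ` Poly_Mapping.keys f"
    and "m \<in> Poly_Mapping.keys f \<Longrightarrow> Poly_Mapping.lookup (push f) (\<phi> m) = Poly_Mapping.lookup f m"
  using someI_ex[OF exists_push_forward[OF assms], folded push_def] by auto

lemma inj_on_\<phi>_keys: "A \<subseteq> M \<Longrightarrow> inj_on \<phi> A"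
  using inj_on_subset[OF inj_\<phi>] span_superset by blast

lemma push_sum:
  assumes "Poly_Mapping.keys f \<subseteq> M"
  shows "(\<Sum>m\<in>Poly_Mapping.keys (push f). Poly_Mapping.lookup (push f) m * c m) =
    (\<Sum>m\<in>Poly_Mapping.keys f. Poly_Mapping.lookup f m * c (\<phi> m))"
  unfolding push(1)[OF assms] by (subst sum.reindex[OF inj_on_\<phi>_keys[OF assms]]) (simp add: push(2)[OF assms])

lemma torus_zero: "t \<in> torus M \<Longrightarrow> t 0 = 1"
proof -
  assume t: "t \<in> torus M"
  have "t (0 + 0) = t 0 * t 0" "t 0 \<noteq> 0" using t lattice_zero unfolding torus_def by blast+
  then show ?thesis by simp
qed

lemma R_scaling_orbit: "R ` scaling_orbit \<xi> = scaling_orbit (R \<xi>)"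
proof -
  have "R (\<lambda>(k, m). c ^ k * \<xi> (k, m)) = (\<lambda>(k, m). c ^ k * R \<xi> (k, m))" for c
    by (auto simp: R_def fun_eq_iff)
  then show ?thesis unfolding scaling_orbit_def by (auto simp: image_iff) metis
qed

lemma R_torus_point: "R ` torus_point \<Delta>w Mw t = torus_point \<Delta> M (t \<circ> \<phi>)"
proof -
  have "R (\<lambda>(k, m). if (k, m) \<in> cone_monoid \<Delta>w Mw then t m else 0) =
      (\<lambda>(k, m). if (k, m) \<in> cone_monoid \<Delta> M then (t \<circ> \<phi>) m else 0)"
    by (auto simp: R_def fun_eq_iff cone_\<phi> cone_in)
  then show ?thesis unfolding torus_point_def R_scaling_orbit by simp
qed

lemma torus_point_in: "t \<in> torus Mw \<Longrightarrow> torus_point \<Delta>w Mw t \<in> Tw"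
proof -
  assume t: "t \<in> torus Mw"
  have "t (0 + 0) = t 0 * t 0" "t 0 \<noteq> 0" using t W.lattice_zero unfolding torus_def by blast+
  then have t0: "t 0 = 1" by simp
  have "(\<lambda>(k, m). if (k, m) \<in> cone_monoid \<Delta>w Mw then t m else 0) \<in> cone_points \<Delta>w Mw"
    by (rule cone_pointsI[OF _ _ _ W.cone_one_zero])
       (use t0 W.cone_zero W.cone_one_zero W.cone_add W.cone_in t in \<open>auto simp: torus_def\<close>)
  then show ?thesis unfolding torus_point_def by blast
qed

text \<open>A point lying over the torus has nonzero vertex coordinates, hence nonzero Cox
  coordinates, so it is a torus point whose values are the monomials in those coordinates.\<close>

lemma torus_point_lift:
  assumes x: "x \<in> Tw" and t: "t \<in> torus M" "R ` x = torus_point \<Delta> M t"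
  shows "\<exists>t'\<in>torus Mw. x = torus_point \<Delta>w Mw t' \<and> (\<forall>m\<in>M. t' (\<phi> m) = t m)"
proof -
  obtain u where "u \<in> Pw" "x = W.cox_map ` u" using qw.surj_orbits[OF x] by blast
  then obtain v where v: "x = W.cox_map ` weighted_orbit w v" by blast
  have xo: "x = scaling_orbit (W.cox_map v)" unfolding v by (rule W.image_cox_map)
  have "cox_map v \<in> torus_point \<Delta> M t"
    using t(2) weighted_orbit_refl unfolding v R_cox_image by blast
  then obtain c where c: "c \<noteq> 0" "cox_map v = (\<lambda>(k, m). c ^ k * (if (k, m) \<in> cone_monoid \<Delta> M then t m else 0))"
    unfolding torus_point_def scaling_orbit_def by auto
  have val: "cox_map v (k, m) = c ^ k * t m" if "(k, m) \<in> cone_monoid \<Delta> M" for k m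
    using fun_cong[OF c(2), of "(k, m)"] that by simp
  have nz: "v $ i \<noteq> 0" for i
  proof -
    have "v $ i ^ d i = c * t (p i)" using val[OF cone_vertex[of i]] cox_map_vertex[of v i] by simp
    moreover have "t (p i) \<noteq> 0" using t(1) vertex_in[of i] unfolding torus_def by blast
    ultimately show ?thesis using c(1) d_pos[of i] by (metis mult_eq_0_iff power_0_left less_numeral_extra(3))
  qed
  define t' where "t' = (\<lambda>m. monom_at v (W.expo 0 m))"
  \<comment> \<open>The coordinate at (1, 0) identifies the scaling factor: it equals
    \<open>c\<close> on the toric side and the product of the v_i in Cox coordinates.\<close>
  have b: "(\<Prod>i\<in>UNIV. v $ i) = c"
  proof -
    have "cox_map v (1, 0) = (\<Prod>i\<in>UNIV. v $ i)"
      using cox_map_torus[OF nz cone_one_zero] by simp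
    then show ?thesis using val[OF cone_one_zero] torus_zero[OF t(1)] by simp
  qed
  have "t' (\<phi> m) = t m" if m: "m \<in> M" for m
  proof -
    obtain k where "(k, \<phi> m) \<in> cone_monoid \<Delta>w Mw" using cone_large[OF \<phi>_in[OF m]] by blast
    then have k: "(k, m) \<in> cone_monoid \<Delta> M" using cone_\<phi>[OF m] by blast
    have "c ^ k * t m = c ^ k * monom_at v (expo 0 m)" 
      by (rule trans[OF val[OF k, symmetric] cox_map_torus[OF nz k, unfolded b]])
    then show ?thesis using c(1) by (simp add: t'_def expo_\<phi>)
  qed
  moreover have "t' \<in> torus Mw" unfolding t'_def by (rule W.cox_torus_in[OF nz])
  moreover have "x = torus_point \<Delta>w Mw t'" unfolding xo t'_def by (rule W.scaling_orbit_cox_torus[OF nz])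
  ultimately show ?thesis by blast
qed

text \<open>The solutions inside the two tori correspond under \<open>R\<close>, and closure
  commutes with preimages under an open continuous map.\<close>

lemma hypersurface_push:
  assumes f: "Poly_Mapping.keys f \<subseteq> M"
  shows "hypersurface \<Delta>w Mw (push f) = {x \<in> Tw. R ` x \<in> hypersurface \<Delta> M f}"
proof -
  let ?A = "{torus_point \<Delta> M t | t. t \<in> torus M \<and>
      (\<Sum>m\<in>Poly_Mapping.keys f. Poly_Mapping.lookup f m * t m) = 0}"
  let ?Aw = "{torus_point \<Delta>w Mw t | t. t \<in> torus Mw \<and>
      (\<Sum>m\<in>Poly_Mapping.keys (push f). Poly_Mapping.lookup (push f) m * t m) = 0}"
  have "?Aw = {x \<in> points Xw. R ` x \<in> ?A}"
  proof (intro equalityI subsetI)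
    fix x assume "x \<in> ?Aw"
    then obtain t where t: "x = torus_point \<Delta>w Mw t" "t \<in> torus Mw"
      "(\<Sum>m\<in>Poly_Mapping.keys f. Poly_Mapping.lookup f m * t (\<phi> m)) = 0" unfolding push_sum[OF f] by blast
    have "t \<circ> \<phi> \<in> torus M" using t(2) \<phi>_in by (simp add: torus_def linear_add[OF linear_\<phi>])
    then have "R ` x \<in> ?A" using t(3) unfolding t(1) R_torus_point by (intro CollectI exI[of _ "t \<circ> \<phi>"]) simp
    moreover have "x \<in> points Xw" unfolding points_Xw t(1) by (rule torus_point_in[OF t(2)])
    ultimately show "x \<in> {x \<in> points Xw. R ` x \<in> ?A}" by simp
  next
    fix x assume "x \<in> {x \<in> points Xw. R ` x \<in> ?A}"
    then obtain t where t: "x \<in> Tw" "R ` x = torus_point \<Delta> M t" "t \<in> torus M"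
      "(\<Sum>m\<in>Poly_Mapping.keys f. Poly_Mapping.lookup f m * t m) = 0" unfolding points_Xw by blast
    obtain t' where t': "t' \<in> torus Mw" "x = torus_point \<Delta>w Mw t'" "\<forall>m\<in>M. t' (\<phi> m) = t m"
      using torus_point_lift[OF t(1,3,2)] by blast
    have "(\<Sum>m\<in>Poly_Mapping.keys f. Poly_Mapping.lookup f m * t' (\<phi> m)) =
        (\<Sum>m\<in>Poly_Mapping.keys f. Poly_Mapping.lookup f m * t m)"
      using t'(3) f by (intro sum.cong refl) (simp add: subset_iff)
    then have "(\<Sum>m\<in>Poly_Mapping.keys (push f). Poly_Mapping.lookup (push f) m * t' m) = 0"
      unfolding push_sum[OF f] using t(4) by simp
    then show "x \<in> ?Aw" using t'(1,2) by blast
  qed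
  then show ?thesis
    unfolding hypersurface_def using closure_of_open_preimage[OF continuous_R open_map_R, of ?A] by simp
qed

lemma hypersurface_sub: "hypersurface \<Delta> M f \<subseteq> TM"
  unfolding hypersurface_def using closure_of_subset_topspace[of "zar XM"] by simp

lemma hypersurface_push_saturated:
  assumes f: "Poly_Mapping.keys f \<subseteq> M"
  shows "saturated_under Tw (image R) (hypersurface \<Delta>w Mw (push f))"
  unfolding saturated_under_def hypersurface_push[OF f] by auto

lemma image_hypersurface_push:
  assumes f: "Poly_Mapping.keys f \<subseteq> M"
  shows "image R ` hypersurface \<Delta>w Mw (push f) = hypersurface \<Delta> M f"
proof (intro equalityI subsetI)
  fix y assume y: "y \<in> hypersurface \<Delta> M f"
  have "y \<in> image R ` Tw" using subsetD[OF hypersurface_sub y] unfolding R_surj .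
  then obtain x where "x \<in> Tw" "y = R ` x" by (rule imageE)
  then show "y \<in> image R ` hypersurface \<Delta>w Mw (push f)" using y unfolding hypersurface_push[OF f] by blast
qed (auto simp: hypersurface_push[OF f])

lemma image_\<phi>_polytope: "\<phi> ` \<Delta> = \<Delta>w"
proof (intro equalityI subsetI)
  fix m assume m: "m \<in> \<Delta>w"
  then have ms: "m \<in> span Mw" by (simp add: W.polytope_iff)
  have "\<psi> m \<in> \<Delta>" using m \<psi>_in[of m] W.lam_weights[OF ms] by (simp add: polytope_iff W.polytope_iff \<psi>_lam)
  then show "m \<in> \<phi> ` \<Delta>" using \<phi>_\<psi>[OF ms] by (metis image_eqI)
next
  fix m assume "m \<in> \<phi> ` \<Delta>"
  then obtain x where x: "x \<in> \<Delta>" "m = \<phi> x" by blast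
  then have xs: "x \<in> span M" by (simp add: polytope_iff)
  have "\<phi> ` span M \<subseteq> span Mw"
    unfolding linear_span_image[OF linear_\<phi>, symmetric] using \<phi>_in by (intro span_mono) blast
  then show "m \<in> \<Delta>w" using x xs by (auto simp: polytope_iff W.polytope_iff)
qed

text \<open>A form integral on \<open>M\<close> may take fractional values on M(w), but L times it
  is integral there: on \<psi> m it is the sum of the w_i m_i with the integer factors
  \<open>p i \<bullet> u\<close>. A nonzero factor L does not affect whether a derivative
  vanishes.\<close>

lemma dual_transfer:
  assumes u: "u \<in> N"
  shows "\<exists>u'\<in>dual_lattice Mw. \<forall>m\<in>M. \<phi> m \<bullet> u' = real L * (m \<bullet> u)"
proof -
  define u0 where "u0 = (\<chi> i. real (w i) * (p i \<bullet> u))"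
  \<comment> \<open>Elements of the dual lattice have to lie in the span of M(w), so the coefficient
    vector is projected there; its pairings with M(w) are unchanged.\<close>
  obtain u' z where u': "u' \<in> span Mw" "\<And>m. m \<in> span Mw \<Longrightarrow> orthogonal z m" "u0 = u' + z"
    using orthogonal_subspace_decomp_exists[of Mw u0] by metis
  have eq: "m \<bullet> u' = (\<Sum>i\<in>UNIV. m $ i * (real (w i) * (p i \<bullet> u)))" if "m \<in> Mw" for m
  proof -
    have "m \<bullet> z = 0" using u'(2)[OF span_base[OF that]] by (simp add: orthogonal_def inner_commute)
    then have "m \<bullet> u' = m \<bullet> u0" using u'(3) by (simp add: inner_add_right)
    then show ?thesis by (simp add: u0_def inner_vec_def)
  qed
  have pu: "p i \<bullet> u \<in> \<int>" for i using u vertex_in[of i] by (simp add: dual_lattice_def)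
  have "m \<bullet> u' \<in> \<int>" if "m \<in> Mw" for m
    unfolding eq[OF that] using that pu by (intro Ints_sum Ints_mult) (auto simp: weight_lattice_def)
  then have "u' \<in> dual_lattice Mw" using u'(1) by (simp add: dual_lattice_def)
  moreover have "\<phi> m \<bullet> u' = real L * (m \<bullet> u)" if m: "m \<in> M" for m
  proof -
    have "\<phi> m \<bullet> u' = real L * (\<psi> (\<phi> m) \<bullet> u)"
      unfolding eq[OF \<phi>_in[OF m]] by (simp add: \<psi>_def inner_sum_left sum_distrib_left real_w mult_ac)
    then show ?thesis using \<psi>_\<phi>[OF span_base[OF m]] by simp
  qed
  ultimately show ?thesis by blast
qed

lemma face_preimage:
  assumes "\<Theta> face_of \<Delta>w" shows "{x \<in> \<Delta>. \<phi> x \<in> \<Theta>} face_of \<Delta>"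
  unfolding face_of_def
proof (intro conjI ballI impI)
  have \<Theta>: "convex \<Theta>" "\<And>a b x. a \<in> \<Delta>w \<Longrightarrow> b \<in> \<Delta>w \<Longrightarrow> x \<in> \<Theta> \<Longrightarrow> x \<in> open_segment a b \<Longrightarrow> a \<in> \<Theta> \<and> b \<in> \<Theta>"
    using assms unfolding face_of_def by blast+
  show "convex {x \<in> \<Delta>. \<phi> x \<in> \<Theta>}"
    using convex_Int[OF convex_polytope convex_linear_vimage[OF linear_\<phi> \<Theta>(1)]] by (simp add: vimage_def Int_def)
  have face: "\<phi> a \<in> \<Theta> \<and> \<phi> b \<in> \<Theta>"
    if ab: "a \<in> \<Delta>" "b \<in> \<Delta>" "x \<in> {x \<in> \<Delta>. \<phi> x \<in> \<Theta>}" "x \<in> open_segment a b" for a b x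
  proof -
    obtain u where u: "a \<noteq> b" "0 < u" "u < 1" "x = (1 - u) *\<^sub>R a + u *\<^sub>R b"
      using ab(4) by (auto simp: in_segment)
    have "\<phi> a \<noteq> \<phi> b" using inj_\<phi> ab(1,2) u(1) by (auto simp: inj_on_def polytope_iff)
    moreover have "\<phi> x = (1 - u) *\<^sub>R \<phi> a + u *\<^sub>R \<phi> b"
      by (simp add: u(4) linear_add[OF linear_\<phi>] linear_scale[OF linear_\<phi>])
    ultimately have "\<phi> x \<in> open_segment (\<phi> a) (\<phi> b)" using u(2,3) by (auto simp: in_segment)
    then show ?thesis using \<Theta>(2)[of "\<phi> a" "\<phi> b" "\<phi> x"] ab image_\<phi>_polytope by blast
  qed
  show "a \<in> {x \<in> \<Delta>. \<phi> x \<in> \<Theta>}" "b \<in> {x \<in> \<Delta>. \<phi> x \<in> \<Theta>}"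
    if "a \<in> \<Delta>" "b \<in> \<Delta>" "x \<in> {x \<in> \<Delta>. \<phi> x \<in> \<Theta>}" "x \<in> open_segment a b" for a b x
    using face[OF that] that by auto
qed auto

lemma cone_monoid_face:
  assumes "m \<in> M" "\<Theta> \<subseteq> \<Delta>w"
  shows "(k, \<phi> m) \<in> cone_monoid \<Theta> Mw \<longleftrightarrow> (k, m) \<in> cone_monoid {x \<in> \<Delta>. \<phi> x \<in> \<Theta>} M"
proof
  assume "(k, \<phi> m) \<in> cone_monoid \<Theta> Mw"
  then obtain z where z: "z \<in> \<Theta>" "\<phi> m = real k *\<^sub>R z" by (auto simp: cone_monoid_def)
  then obtain x where x: "x \<in> \<Delta>" "z = \<phi> x" using assms(2) image_\<phi>_polytope by blast
  have "\<phi> m = \<phi> (real k *\<^sub>R x)" using z x by (simp add: linear_scale[OF linear_\<phi>])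
  moreover have "m \<in> span M" "real k *\<^sub>R x \<in> span M"
    using assms(1) x(1) by (auto simp: span_base span_scale polytope_iff)
  ultimately have "m = real k *\<^sub>R x" using inj_\<phi> by (simp add: inj_on_def)
  then show "(k, m) \<in> cone_monoid {x \<in> \<Delta>. \<phi> x \<in> \<Theta>} M" using z x assms(1) by (auto simp: cone_monoid_def)
next
  assume "(k, m) \<in> cone_monoid {x \<in> \<Delta>. \<phi> x \<in> \<Theta>} M"
  then show "(k, \<phi> m) \<in> cone_monoid \<Theta> Mw"
    using \<phi>_in[OF assms(1)] by (auto simp: cone_monoid_def linear_scale[OF linear_\<phi>])
qed

text \<open>Faces correspond under \<phi>, and \<open>R\<close> sends points of the orbit of a face
  to the orbit of the corresponding face. Regularity of \<open>f\<close> yields a direction in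
  \<open>N\<close> with nonzero derivative, and \<open>dual_transfer\<close> supplies a direction
  for M(w) whose derivative is L times as large.\<close>

lemma regular_push:
  assumes reg: "regular_polynomial \<Delta> M f"
  shows "regular_polynomial \<Delta>w Mw (push f)"
proof -
  have keys: "Poly_Mapping.keys f \<subseteq> M" "convex hull (Poly_Mapping.keys f) = \<Delta>"
    using reg by (auto simp: regular_polynomial_def has_newton_polyhedron_def)
  have keys_\<Delta>: "Poly_Mapping.keys f \<subseteq> \<Delta>" using hull_subset[of _ convex] unfolding keys(2)[symmetric] .
  have newton: "has_newton_polyhedron (push f) \<Delta>w Mw"
    unfolding has_newton_polyhedron_def push(1)[OF keys(1)] convex_hull_linear_image[OF linear_\<phi>, symmetric] keys(2)
      image_\<phi>_polytope using keys(1) \<phi>_in by auto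
  have "smooth_on_orbit_at Mw (push f) \<Theta> x"
    if \<Theta>: "\<Theta> face_of \<Delta>w" "\<Theta> \<noteq> {}" and x: "x \<in> hypersurface \<Delta>w Mw (push f)" "x \<in> torus_orbit \<Delta>w Mw \<Theta>" for \<Theta> x
    unfolding smooth_on_orbit_at_def
  proof
    fix \<xi> assume \<xi>: "\<xi> \<in> x"
    let ?\<Theta> = "{x \<in> \<Delta>. \<phi> x \<in> \<Theta>}"
    have sub: "\<Theta> \<subseteq> \<Delta>w" using \<Theta>(1) by (rule face_of_imp_subset)
    have face: "?\<Theta> face_of \<Delta>" by (rule face_preimage[OF \<Theta>(1)])
    have "?\<Theta> \<noteq> {}"
    proof -
      obtain z where "z \<in> \<Theta>" using \<Theta>(2) by blast
      moreover then obtain x where "x \<in> \<Delta>" "z = \<phi> x" using sub image_\<phi>_polytope by blast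
      ultimately show ?thesis by blast
    qed
    moreover have Rx: "R ` x \<in> hypersurface \<Delta> M f" using x(1) unfolding hypersurface_push[OF keys(1)] by simp
    moreover have "R ` x \<in> torus_orbit \<Delta> M ?\<Theta>"
      unfolding torus_orbit_def points_XM
    proof (intro CollectI conjI ballI)
      show "R ` x \<in> TM" using Rx hypersurface_sub by blast
      fix \<eta> a assume \<eta>: "\<eta> \<in> R ` x" and a: "a \<in> cone_monoid \<Delta> M"
      obtain \<xi>' where \<xi>': "\<xi>' \<in> x" "\<eta> = R \<xi>'" using \<eta> by blast
      obtain k m where km: "a = (k, m)" by (cases a)
      have m: "m \<in> M" "(k, \<phi> m) \<in> cone_monoid \<Delta>w Mw" using a km cone_in cone_\<phi> by auto
      have "\<xi>' (k, \<phi> m) \<noteq> 0 \<longleftrightarrow> (k, \<phi> m) \<in> cone_monoid \<Theta> Mw"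
        using x(2) \<xi>'(1) m(2) unfolding torus_orbit_def by blast
      then show "\<eta> a \<noteq> 0 \<longleftrightarrow> a \<in> cone_monoid ?\<Theta> M"
        using a cone_monoid_face[OF m(1) sub] by (simp add: \<xi>'(2) km R_def)
    qed
    ultimately have "smooth_on_orbit_at M f ?\<Theta> (R ` x)"
      using reg face unfolding regular_polynomial_def by blast
    then obtain u where u: "u \<in> N"
      "(\<Sum>m\<in>Poly_Mapping.keys f \<inter> ?\<Theta>. of_real (m \<bullet> u) * Poly_Mapping.lookup f m * R \<xi> (1, m)) \<noteq> 0"
      using \<xi> unfolding smooth_on_orbit_at_def by blast
    obtain u' where u': "u' \<in> dual_lattice Mw" "\<forall>m\<in>M. \<phi> m \<bullet> u' = real L * (m \<bullet> u)"
      using dual_transfer[OF u(1)] by blast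
    have "Poly_Mapping.keys (push f) \<inter> \<Theta> = \<phi> ` (Poly_Mapping.keys f \<inter> ?\<Theta>)"
      unfolding push(1)[OF keys(1)] using keys_\<Delta> by auto
    moreover have "inj_on \<phi> (Poly_Mapping.keys f \<inter> ?\<Theta>)" by (rule inj_on_\<phi>_keys) (use keys(1) in blast)
    ultimately have "(\<Sum>m\<in>Poly_Mapping.keys (push f) \<inter> \<Theta>.
        of_real (m \<bullet> u') * Poly_Mapping.lookup (push f) m * \<xi> (1, m)) =
      (\<Sum>m\<in>Poly_Mapping.keys f \<inter> ?\<Theta>.
        of_real (\<phi> m \<bullet> u') * Poly_Mapping.lookup (push f) (\<phi> m) * \<xi> (1, \<phi> m))"
      by (simp add: sum.reindex)
    also have "\<dots> = (\<Sum>m\<in>Poly_Mapping.keys f \<inter> ?\<Theta>.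
        of_nat L * (of_real (m \<bullet> u) * Poly_Mapping.lookup f m * R \<xi> (1, m)))"
    proof (rule sum.cong[OF refl])
      fix m assume m: "m \<in> Poly_Mapping.keys f \<inter> ?\<Theta>"
      then have mM: "m \<in> M" and m\<Delta>: "m \<in> \<Delta>" using keys(1) by auto
      have "(1, m) \<in> cone_monoid \<Delta> M" using mM m\<Delta> by (simp add: cone_monoid_def)
      then have "R \<xi> (1, m) = \<xi> (1, \<phi> m)" by (simp add: R_def)
      moreover have "\<phi> m \<bullet> u' = real L * (m \<bullet> u)" using u'(2) mM by blast
      moreover have "Poly_Mapping.lookup (push f) (\<phi> m) = Poly_Mapping.lookup f m"
        using m by (intro push(2)[OF keys(1)]) blast
      ultimately show "of_real (\<phi> m \<bullet> u') * Poly_Mapping.lookup (push f) (\<phi> m) * \<xi> (1, \<phi> m) =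
          of_nat L * (of_real (m \<bullet> u) * Poly_Mapping.lookup f m * R \<xi> (1, m))"
        by (simp add: mult.assoc)
    qed
    also have "\<dots> = of_nat L * (\<Sum>m\<in>Poly_Mapping.keys f \<inter> ?\<Theta>.
        of_real (m \<bullet> u) * Poly_Mapping.lookup f m * R \<xi> (1, m))" by (rule sum_distrib_left[symmetric])
    finally show "\<exists>u\<in>dual_lattice Mw. (\<Sum>m\<in>Poly_Mapping.keys (push f) \<inter> \<Theta>.
        of_real (m \<bullet> u) * Poly_Mapping.lookup (push f) m * \<xi> (1, m)) \<noteq> 0"
      using u(2) u'(1) L_pos by (intro bexI[of _ u']) auto
  qed
  then show ?thesis unfolding regular_polynomial_def using newton by blast
qed

lemma family_of_quotients:
  "comm_group \<pi> \<and> finite (carrier \<pi>) \<and>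
   (\<exists>act q \<F>.
     faithful_action \<pi> (points Xw) (\<lambda>g. restrict (act g) (points Xw)) \<and>
     (\<forall>g\<in>carrier \<pi>. \<exists>t\<in>torus Mw. \<forall>x\<in>points Xw. act g x = torus_translation t x) \<and>
     quotient_by \<pi> act Xw XM q \<and>
     \<F> \<subseteq> regular_family \<Delta>w Mw \<and>
     (\<forall>Z\<in>\<F>. quotient_by \<pi> act (subvariety Xw Z) (subvariety XM (q ` Z)) q) \<and>
     regular_family \<Delta> M = (\<lambda>Z. q ` Z) ` \<F>)"
proof (intro conjI comm_group_\<pi> finite_\<pi> exI)
  \<comment> \<open>The subfamily consists of the hypersurfaces whose equations are transported from
    regular Laurent polynomials on \<open>M\<close>, so that all their exponents lie in the image of
    \<open>M\<close> under \<phi>.\<close>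
  let ?F = "{hypersurface \<Delta>w Mw (push f) | f. regular_polynomial \<Delta> M f}"
  have keys: "Poly_Mapping.keys f \<subseteq> M" if "regular_polynomial \<Delta> M f" for f
    using that by (simp add: regular_polynomial_def has_newton_polyhedron_def)
  show "faithful_action \<pi> (points Xw) (\<lambda>g. restrict (act g) (points Xw))"
    unfolding points_Xw by (rule faithful_action_act)
  show "\<forall>g\<in>carrier \<pi>. \<exists>t\<in>torus Mw. \<forall>x\<in>points Xw. act g x = torus_translation t x"
    unfolding act_def using \<tau>_torus by blast
  show "quotient_by \<pi> act Xw XM (image R)" by (rule quotient_by_R)
  show "?F \<subseteq> regular_family \<Delta>w Mw" unfolding regular_family_def using regular_push by blast
  show "\<forall>Z\<in>?F. quotient_by \<pi> act (subvariety Xw Z) (subvariety XM (image R ` Z)) (image R)"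
    using quotient_by_R_subvariety hypersurface_push_saturated keys by blast
  have "(\<lambda>Z. image R ` Z) ` ?F = {image R ` hypersurface \<Delta>w Mw (push f) | f. regular_polynomial \<Delta> M f}" by blast
  also have "\<dots> = regular_family \<Delta> M"
    unfolding regular_family_def using image_hypersurface_push[OF keys] by (metis (no_types, lifting))
  finally show "regular_family \<Delta> M = (\<lambda>Z. image R ` Z) ` ?F" by (rule sym)
qed

end

text \<open>The Cox map of M(w) is a quotient map in the sense of \<open>cone_quotient\<close> and,
  by coprimality of the weights, injective on orbits.\<close>

lemma isomorphism_weighted:
  fixes d :: "'i::finite \<Rightarrow> nat"
  assumes d: "\<And>i. d i > 0" "(\<Sum>i\<in>UNIV. 1 / real (d i)) = 1"
  defines "w \<equiv> fermat_weights d"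
  shows "isomorphism (weighted_projective_space w) (toric_variety (weight_polytope w) (weight_lattice w))
    (weighted_to_toric w)"
proof -
  interpret W: toric_simplex d "weight_polytope w" "weight_lattice w" "\<lambda>i x. x $ i" "weight_vertex d"
    unfolding w_def by (rule toric_simplex_weight[OF d])
  interpret q: cone_quotient "weighted_orbit w ` (UNIV - {0})" "weighted_forms w"
     "scaling_orbit ` cone_points (weight_polytope w) (weight_lattice w)"
     "toric_sections (weight_polytope w) (weight_lattice w)" W.cox_map
    using W.cone_quotient_cox unfolding w_def .
  show ?thesis
    using q.isomorphism_image weighted_cox_inj[OF d, folded w_def]
    unfolding weighted_to_toric_cox[OF d, folded w_def] weighted_projective_space_def toric_variety_def .
qed

lemma fermat_in_family:
  fixes d :: "'i::finite \<Rightarrow> nat"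
  assumes d: "\<And>i. d i > 0" "(\<Sum>i\<in>UNIV. 1 / real (d i)) = 1"
  defines "w \<equiv> fermat_weights d"
  shows "weighted_to_toric w ` fermat_hypersurface d \<in> regular_family (weight_polytope w) (weight_lattice w)"
proof -
  interpret W: toric_simplex d "weight_polytope w" "weight_lattice w" "\<lambda>i x. x $ i" "weight_vertex d"
    unfolding w_def by (rule toric_simplex_weight[OF d])
  interpret q: cone_quotient "weighted_orbit w ` (UNIV - {0})" "weighted_forms w"
     "scaling_orbit ` cone_points (weight_polytope w) (weight_lattice w)"
     "toric_sections (weight_polytope w) (weight_lattice w)" W.cox_map
    using W.cone_quotient_cox unfolding w_def .
  have "W.fermat_points \<in> regular_family (weight_polytope w) (weight_lattice w)"
  proof (rule W.fermat_points_regular)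
    fix i :: 'i
    \<comment> \<open>As a form on M(w), the \<open>i\<close>-th coordinate is represented by the
      orthogonal projection of e_i to the span of M(w).\<close>
    obtain u z where u: "u \<in> span (weight_lattice w)" "\<And>m. m \<in> span (weight_lattice w) \<Longrightarrow> orthogonal z m"
        "axis i 1 = u + z"
      using orthogonal_subspace_decomp_exists[of "weight_lattice w" "axis i 1"] by metis
    have eq: "m \<bullet> u = m $ i" if "m \<in> weight_lattice w" for m
    proof -
      have "m \<bullet> z = 0" using u(2)[OF span_base[OF that]] by (simp add: orthogonal_def inner_commute)
      then have "m \<bullet> u = m \<bullet> axis i 1" unfolding u(3) by (simp add: inner_add_right)
      then show ?thesis by (simp add: inner_axis)
    qed
    have "u \<in> dual_lattice (weight_lattice w)" using u(1) eq by (simp add: dual_lattice_def W.lam_int)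
    then show "\<exists>u\<in>dual_lattice (weight_lattice w). \<forall>j. weight_vertex d j \<bullet> u = weight_vertex d j $ i"
      using eq W.vertex_in by blast
  qed
  moreover have "image W.cox_map ` fermat_hypersurface d = W.fermat_points"
  proof (intro equalityI subsetI)
    fix y assume "y \<in> image W.cox_map ` fermat_hypersurface d"
    then obtain x where x: "y = W.cox_map ` x" "x \<in> fermat_hypersurface d" by (rule imageE)
    have xP: "x \<in> weighted_orbit w ` (UNIV - {0})"
      using x(2) q.src.points_eq unfolding fermat_hypersurface_def w_def weighted_projective_space_def by blast
    have "(\<Sum>i\<in>UNIV. W.cox_map v (1, weight_vertex d i)) = 0" if "v \<in> x" for v
      unfolding W.cox_map_vertex using x(2) that unfolding fermat_hypersurface_def by blast
    then show "y \<in> W.fermat_points" unfolding W.fermat_points_def x(1) using q.image_orbit[OF xP] by blast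
  next
    fix y assume y: "y \<in> W.fermat_points"
    then have "y \<in> scaling_orbit ` cone_points (weight_polytope w) (weight_lattice w)"
      by (simp only: W.fermat_points_def mem_Collect_eq)
    then obtain x where x: "x \<in> weighted_orbit w ` (UNIV - {0})" "y = W.cox_map ` x" using q.surj_orbits by blast
    have "(\<Sum>i\<in>UNIV. v $ i ^ d i) = 0" if "v \<in> x" for v
      using y that unfolding W.fermat_points_def x(2) W.cox_map_vertex[symmetric] by blast
    moreover have "x \<in> points (weighted_projective_space w)"
      unfolding weighted_projective_space_def q.src.points_eq by (rule x(1))
    ultimately have "x \<in> fermat_hypersurface d" unfolding fermat_hypersurface_def w_def by blast
    then show "y \<in> image W.cox_map ` fermat_hypersurface d" unfolding x(2) by blast
  qed
  ultimately show ?thesis unfolding weighted_to_toric_cox[OF d, folded w_def] by simp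
qed

theorem corollary5p5p6:
  fixes d :: "'i::finite \<Rightarrow> nat"
  assumes "\<And>i. d i > 0" and "(\<Sum>i\<in>UNIV. 1 / real (d i)) = 1"
  shows
    "(let w = fermat_weights d;
          Mw = weight_lattice w;
          \<Delta>w = weight_polytope w
      in isomorphism (weighted_projective_space w) (toric_variety \<Delta>w Mw) (weighted_to_toric w) \<and>
         weighted_to_toric w ` fermat_hypersurface d \<in> regular_family \<Delta>w Mw \<and>
         (\<forall>\<Delta> M :: 'v::euclidean_space set.
            reflexive_pair \<Delta> M \<and> simplex_with_weights \<Delta> w \<longrightarrow>
              comm_group (fundamental_group \<Delta> M) \<and> finite (carrier (fundamental_group \<Delta> M)) \<and>
              (\<exists>act q \<F>.
                 faithful_action (fundamental_group \<Delta> M) (points (toric_variety \<Delta>w Mw))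
                   (\<lambda>g. restrict (act g) (points (toric_variety \<Delta>w Mw))) \<and>
                 (\<forall>g\<in>carrier (fundamental_group \<Delta> M). \<exists>t\<in>torus Mw.
                    \<forall>x\<in>points (toric_variety \<Delta>w Mw). act g x = torus_translation t x) \<and>
                 quotient_by (fundamental_group \<Delta> M) act
                   (toric_variety \<Delta>w Mw) (toric_variety \<Delta> M) q \<and>
                 \<F> \<subseteq> regular_family \<Delta>w Mw \<and>
                 (\<forall>Z\<in>\<F>. quotient_by (fundamental_group \<Delta> M) act
                   (subvariety (toric_variety \<Delta>w Mw) Z)
                   (subvariety (toric_variety \<Delta> M) (q ` Z)) q) \<and>
                 regular_family \<Delta> M = (\<lambda>Z. q ` Z) ` \<F>)))"
  unfolding Let_def
proof (intro conjI[OF isomorphism_weighted[OF assms] conjI[OF fermat_in_family[OF assms]]] allI impI)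
  fix \<Delta> M :: "'v set"
  assume "reflexive_pair \<Delta> M \<and> simplex_with_weights \<Delta> (fermat_weights d)"
  then obtain l p where "reflexive_simplex d \<Delta> M l p" using reflexive_simplex_exists[OF assms] by blast
  from reflexive_simplex.family_of_quotients[OF this]
  show "comm_group (fundamental_group \<Delta> M) \<and> finite (carrier (fundamental_group \<Delta> M)) \<and>
    (\<exists>act q \<F>.
       faithful_action (fundamental_group \<Delta> M)
         (points (toric_variety (weight_polytope (fermat_weights d)) (weight_lattice (fermat_weights d))))
         (\<lambda>g. restrict (act g)
            (points (toric_variety (weight_polytope (fermat_weights d)) (weight_lattice (fermat_weights d))))) \<and>
       (\<forall>g\<in>carrier (fundamental_group \<Delta> M). \<exists>t\<in>torus (weight_lattice (fermat_weights d)).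
          \<forall>x\<in>points (toric_variety (weight_polytope (fermat_weights d)) (weight_lattice (fermat_weights d))).
             act g x = torus_translation t x) \<and>
       quotient_by (fundamental_group \<Delta> M) act
         (toric_variety (weight_polytope (fermat_weights d)) (weight_lattice (fermat_weights d)))
         (toric_variety \<Delta> M) q \<and>
       \<F> \<subseteq> regular_family (weight_polytope (fermat_weights d)) (weight_lattice (fermat_weights d)) \<and>
       (\<forall>Z\<in>\<F>. quotient_by (fundamental_group \<Delta> M) act
         (subvariety (toric_variety (weight_polytope (fermat_weights d)) (weight_lattice (fermat_weights d))) Z)
         (subvariety (toric_variety \<Delta> M) (q ` Z)) q) \<and>
       regular_family \<Delta> M = (\<lambda>Z. q ` Z) ` \<F>)" .
qed

end
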